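(* Let $\mathbf C$ be a category and $W$ a class of arrows of $\mathbf C$ satisfying the conditions CF1, CF2, CF3 for a calculus of fractions. Then the weakly globular double categories $\mathbf C\{W\}$ and $\mathbf{Dbl}(\mathbf C(W^{-1}))$ are equivalent in the 2-category $\mathsf{WGDbl}_{\mathrm{ps}}$ of weakly globular double categories, pseudo-functors and vertical transformations.
   Context: **Double categories.** A double category $\mathbb X$ is an internal category in $\mathsf{Cat}$: categories $\mathbb X_0$ (objects and vertical arrows) and $\mathbb X_1$ (horizontal arrows as objects, double cells as arrows, composed vertically), functors $d_0,d_1:\mathbb X_1\to\mathbb X_0$ (horizontal domain, codomain), $s$ (horizontal identities) and $m$ (horizontal composition). The horizontal nerve $N_h\mathbb X:\Delta^{op}\to\mathsf{Cat}$ has $(N_h\mathbb X)_k=\mathbb X_1\times_{\mathbb X_0}\overset{k}{\cdots}\times_{\mathbb X_0}\mathbb X_1$ (and $\mathbb X_0,\mathbb X_1$ for $k=0,1$). $\mathbb X$ is weakly globular if the quotient functor $\gamma:\mathbb X_0\to\mathbb X_0^d$ onto the discrete category of path components is an equivalence and induces equivalences $\mathbb X_1\times_{\mathbb X_0}\overset{n}{\cdots}\times_{\mathbb X_0}\mathbb X_1\simeq\mathbb X_1\times_{\mathbb X_0^d}\overset{n}{\cdots}\times_{\mathbb X_0^d}\mathbb X_1$ for $n\ge 2$. A pseudo-functor $\mathbb X\to\mathbb Y$ is a pseudo-natural transformation $N_h\mathbb X\Rightarrow N_h\mathbb Y$, and a vertical transformation is a modification of such. **Conditions on $W$.** CF1: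 $W$ contains all isomorphisms and is closed under composition. CF2: for $f:C\to B$ and $w:A\to B$ in $W$ there are $\bar f:D\to A$ and $\bar w:D\to C$ with $\bar w\in W$ and $w\bar f=f\bar w$. CF3: if $w\in W$ and $wf=wg$, there is $\tilde w\in W$ with $f\tilde w=g\tilde w$. **The double category $\mathbf C\{W\}$.** Objects: arrows $(w)=(w:A\to B)$ in $W$. Horizontal arrows from $(w:A\to B)$ to $(w':A'\to B')$: arrows $f:A\to A'$ of $\mathbf C$, composed as in $\mathbf C$. Vertical arrows from $(w_1:A_1\to B)$ to $(w_2:A_2\to B)$ (same codomain $B$): equivalence classes $[u_1,C,u_2]$ of pairs $u_1:C\to A_1$, $u_2:C\to A_2$ with $w_1u_1=w_2u_2\in W$, where $(u_1,C,u_2)\sim(v_1,D,v_2)$ if there are $r_1:E\to C$, $r_2:E\to D$ with $u_ir_1=v_ir_2$ ($i=1,2$) and $w_1u_1r_1\in W$. Double cells with top $f_1:(w_1)\to(w_1')$, bottom $f_2:(w_2)\to(w_2')$, left side $[u_1,C,u_2]$ and right side $[u_1',C',u_2']$: equivalence classes of arrows $\varphi:C\to C'$, for representatives $(u_1,C,u_2)$, $(u'_1,C',u_2')$ of the sides, with $f_iu_i=u_i'\varphi$ ($i=1,2$); $\varphi$ and $\psi:D\to D'$ (with representatives $(v_1,D,v_2)$, $(v_1',D',v_2')$) are equivalent if there are $r:E\to C$, $s:E\to D$, $r':E'\to C'$, $s':E'\to D'$, $\chi:E\to E'$ with $\varphi r=r'\chi$, $\psi s=s'\chi$, $u_ir=v_is$,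 $u'_ir'=v'_is'$ ($i=1,2$), $w_1u_1r\in W$, $w_1'u_1'r'\in W$. Vertical composites: $[v_1,D,v_2]\cdot[u_1,C,u_2]=[u_1\bar v_1,E,v_2\bar u_2]$ for any $\bar v_1:E\to C$, $\bar u_2:E\to D$ with $u_2\bar v_1=v_1\bar u_2$ and $w_2u_2\bar v_1\in W$; a vertical composite of cells $\varphi:C\to C'$ and $\psi:D\to D'$ is represented, for such composites $E,E'$ of the left and right sides, by any $\xi:\bar E\to E'$ for which there is $r:\bar E\to E$ in $W$ with $\bar v_1'\xi=\varphi\bar v_1r$ and $\bar u_2'\xi=\psi\bar u_2r$. Horizontal composite of cells $\varphi:C\to C'$ and $\psi:D\to D'$ with $[u_1',C',u_2']=[v_1,D,v_2]$: choose $r,s$ with $u_i'r=v_is$ and $w_1'u_1'r\in W$, and $\bar r\in W$, $\bar\varphi$ with $\varphi\bar r=r\bar\varphi$; the composite is represented by $\psi s\bar\varphi$ with left side $(u_1\bar r,u_2\bar r)$. These are independent of choices and make $\mathbf C\{W\}$ a weakly globular double category. **The bicategory of fractions $\mathbf C(W^{-1})$.** Objects: those of $\mathbf C$. Arrows $A\to B$: spans $A\xleftarrow{w}S\xrightarrow{f}B$ with $w\in W$. 2-cells $(w_1,S_1,f_1)\Rightarrow(w_2,S_2,f_2)$: equivalence classes of pairs $u_1:T\to S_1$, $u_2:T\to S_2$ with $w_1u_1=w_2u_2\in W$ and $f_1u_1=f_2u_2$, where $(u_1,T,u_2)\sim(u_1',T',u_2')$ if there are $t:\bar T\to T$, $t':\bar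 T\to T'$ with $u_it=u_i't'$ ($i=1,2$) and $w_1u_1t\in W$. The composite of $A\xleftarrow{w_1}S\xrightarrow{f_1}B$ and $B\xleftarrow{w_2}T\xrightarrow{f_2}C$ is $A\xleftarrow{w_1\bar w_2}U\xrightarrow{f_2\bar f_1}C$ for a chosen commutative square $f_1\bar w_2=w_2\bar f_1$ with $\bar w_2\in W$ (from CF2, with identity squares chosen when one of the two given arrows is an identity). There is at most one 2-cell between any two parallel arrows, so the remaining structure is determined. **The double category $\mathbf{Dbl}(\mathcal B)$ of marked paths in a bicategory $\mathcal B$** (a weakly globular double category). Choose for each finite path of composable arrows in $\mathcal B$ a composite $\varphi_{f_1\cdots f_n}$ (a bracketing, the identity for an empty path, $\varphi_f=f$); for concatenations there are unique invertible comparison 2-cells $\Phi$ built from associativity and unit cells. Objects: $(A_0\xrightarrow{f_1}\cdots\xrightarrow{f_n}A_n;i_0)$, a finite path with $0\le i_0\le n$. There is a unique vertical arrow from $(A_0\to\cdots\to A_n;i_0)$ to $(B_0\to\cdots\to B_m;j_0)$ if $A_{i_0}=B_{j_0}$ and none otherwise. Horizontal arrows: $(A_0\to\cdots\to A_n;i_0,i_1)$ with $i_0\le i_1$, from the path marked at $i_0$ to the same path marked at $i_1$, composed by $(i_0,i_1),(i_1,i_2)\mapsto(i_0,i_2)$. Double cells from $(A_0\xrightarrow{f_1}\cdots;i_0,i_1)$ to $(B_0\xrightarrow{g_1}\cdots;j_0,j_1)$, existing only when $A_{i_0}=B_{j_0}$, $A_{i_1}=B_{j_1}$, are 2-cells $\varphi_{f_{i_0+1}\cdots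 f_{i_1}}\Rightarrow\varphi_{g_{j_0+1}\cdots g_{j_1}}$; vertical composition is that of 2-cells, horizontal composition is that of 2-cells conjugated by the $\Phi$. *)

theory Defs
  imports Main
begin

section \<open>Categories, functors, natural transformations\<close>

text \<open>Composition is written in the applicative order: \<open>g \<cdot> f\<close> is \<open>f\<close> followed by \<open>g\<close>.
  Values of all operations outside the carrier sets are irrelevant.\<close>

record ('o, 'a) cat =
  Obj :: "'o set"
  Arr :: "'a set"
  src :: "'a \<Rightarrow> 'o"
  tgt :: "'a \<Rightarrow> 'o"
  idn :: "'o \<Rightarrow> 'a"
  cmp :: "'a \<Rightarrow> 'a \<Rightarrow> 'a"  (infixl "\<cdot>\<index>" 70)

definition hom :: "('o, 'a) cat \<Rightarrow> 'o \<Rightarrow> 'o \<Rightarrow> 'a set" where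
  "hom C a b = {f \<in> Arr C. src C f = a \<and> tgt C f = b}"

locale category =
  fixes C :: "('o, 'a) cat" (structure)
  assumes src_in: "f \<in> Arr C \<Longrightarrow> src C f \<in> Obj C"
    and tgt_in: "f \<in> Arr C \<Longrightarrow> tgt C f \<in> Obj C"
    and idn_in: "a \<in> Obj C \<Longrightarrow> idn C a \<in> hom C a a"
    and cmp_in: "f \<in> hom C a b \<Longrightarrow> g \<in> hom C b c \<Longrightarrow> g \<cdot> f \<in> hom C a c"
    and idn_right: "f \<in> hom C a b \<Longrightarrow> f \<cdot> idn C a = f"
    and idn_left: "f \<in> hom C a b \<Longrightarrow> idn C b \<cdot> f = f"
    and cmp_assoc: "f \<in> hom C a b \<Longrightarrow> g \<in> hom C b c \<Longrightarrow> h \<in> hom C c d \<Longrightarrow>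
      h \<cdot> (g \<cdot> f) = (h \<cdot> g) \<cdot> f"

definition is_iso :: "('o, 'a) cat \<Rightarrow> 'a \<Rightarrow> bool" where
  "is_iso C f \<longleftrightarrow> f \<in> Arr C \<and> (\<exists>g \<in> hom C (tgt C f) (src C f).
     g \<cdot>\<^bsub>C\<^esub> f = idn C (src C f) \<and> f \<cdot>\<^bsub>C\<^esub> g = idn C (tgt C f))"

record ('o, 'a, 'p, 'b) ftr =
  fob :: "'o \<Rightarrow> 'p"
  far :: "'a \<Rightarrow> 'b"

definition is_functor :: "('o, 'a) cat \<Rightarrow> ('p, 'b) cat \<Rightarrow> ('o, 'a, 'p, 'b) ftr \<Rightarrow> bool" where
  "is_functor C D F \<longleftrightarrow>
     (\<forall>a \<in> Obj C. fob F a \<in> Obj D) \<and>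
     (\<forall>f \<in> Arr C. far F f \<in> hom D (fob F (src C f)) (fob F (tgt C f))) \<and>
     (\<forall>a \<in> Obj C. far F (idn C a) = idn D (fob F a)) \<and>
     (\<forall>f \<in> Arr C. \<forall>g \<in> Arr C. src C g = tgt C f \<longrightarrow>
        far F (g \<cdot>\<^bsub>C\<^esub> f) = far F g \<cdot>\<^bsub>D\<^esub> far F f)"

definition id_ftr :: "('o, 'a, 'o, 'a) ftr" where
  "id_ftr = \<lparr>fob = \<lambda>a. a, far = \<lambda>f. f\<rparr>"

definition comp_ftr :: "('p, 'b, 'q, 'c) ftr \<Rightarrow> ('o, 'a, 'p, 'b) ftr \<Rightarrow> ('o, 'a, 'q, 'c) ftr"
  where "comp_ftr G F = \<lparr>fob = fob G \<circ> fob F, far = far G \<circ> far F\<rparr>"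

definition nat_trans :: "('o, 'a) cat \<Rightarrow> ('p, 'b) cat \<Rightarrow> ('o, 'a, 'p, 'b) ftr \<Rightarrow>
    ('o, 'a, 'p, 'b) ftr \<Rightarrow> ('o \<Rightarrow> 'b) \<Rightarrow> bool" where
  "nat_trans C D F G \<tau> \<longleftrightarrow>
     (\<forall>a \<in> Obj C. \<tau> a \<in> hom D (fob F a) (fob G a)) \<and>
     (\<forall>f \<in> Arr C. far G f \<cdot>\<^bsub>D\<^esub> \<tau> (src C f) = \<tau> (tgt C f) \<cdot>\<^bsub>D\<^esub> far F f)"

definition nat_iso :: "('o, 'a) cat \<Rightarrow> ('p, 'b) cat \<Rightarrow> ('o, 'a, 'p, 'b) ftr \<Rightarrow>
    ('o, 'a, 'p, 'b) ftr \<Rightarrow> ('o \<Rightarrow> 'b) \<Rightarrow> bool" where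
  "nat_iso C D F G \<tau> \<longleftrightarrow> nat_trans C D F G \<tau> \<and> (\<forall>a \<in> Obj C. is_iso D (\<tau> a))"

definition equivalence_of_categories ::
    "('o, 'a) cat \<Rightarrow> ('p, 'b) cat \<Rightarrow> ('o, 'a, 'p, 'b) ftr \<Rightarrow> bool" where
  "equivalence_of_categories C D F \<longleftrightarrow> is_functor C D F \<and>
     (\<exists>G \<eta> \<epsilon>. is_functor D C G \<and> nat_iso C C id_ftr (comp_ftr G F) \<eta> \<and>
        nat_iso D D (comp_ftr F G) id_ftr \<epsilon>)"

section \<open>Composable strings of arrows\<close>

text \<open>A string of arrows is a pair \<open>(a, fs)\<close> of its starting object and the list of its arrows
  in the order in which they are traversed; the starting object matters only if \<open>fs\<close> is empty.\<close>

definition is_path :: "'o set \<Rightarrow> 'a set \<Rightarrow> ('a \<Rightarrow> 'o) \<Rightarrow> ('a \<Rightarrow> 'o) \<Rightarrow> 'o \<times> 'a list \<Rightarrow> bool" where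
  "is_path Os As s t = (\<lambda>(a, fs). a \<in> Os \<and> set fs \<subseteq> As \<and> (fs \<noteq> [] \<longrightarrow> s (hd fs) = a) \<and>
     successively (\<lambda>f g. t f = s g) fs)"

definition vertex :: "('a \<Rightarrow> 'o) \<Rightarrow> 'o \<times> 'a list \<Rightarrow> nat \<Rightarrow> 'o" where
  "vertex t p i = (if i = 0 then fst p else t (snd p ! (i - 1)))"

definition segment :: "('a \<Rightarrow> 'o) \<Rightarrow> 'o \<times> 'a list \<Rightarrow> nat \<Rightarrow> nat \<Rightarrow> 'o \<times> 'a list" where
  "segment t p i j = (vertex t p i, drop i (take j (snd p)))"

definition path_comp :: "('o, 'a) cat \<Rightarrow> 'o \<times> 'a list \<Rightarrow> 'a" where
  "path_comp K p = foldl (\<lambda>f g. g \<cdot>\<^bsub>K\<^esub> f) (idn K (fst p)) (snd p)"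

section \<open>Pseudo-natural transformations between functors from the opposite of Delta to Cat\<close>

text \<open>A monotone map from \<open>[m]\<close> to \<open>[k]\<close> is given by the list of its \<open>m + 1\<close> values.\<close>

definition Delta :: "nat \<Rightarrow> nat \<Rightarrow> nat list set" where
  "Delta m k = {\<theta>. length \<theta> = Suc m \<and> sorted \<theta> \<and> set \<theta> \<subseteq> {..k}}"

definition Delta_id :: "nat \<Rightarrow> nat list" where
  "Delta_id k = [0..<Suc k]"

definition Delta_comp :: "nat list \<Rightarrow> nat list \<Rightarrow> nat list" where
  "Delta_comp \<theta> \<phi> = map ((!) \<theta>) \<phi>"

text \<open>\<open>act S \<theta>\<close> is the functor from level \<open>k\<close> to level \<open>m\<close> given by a monotone map \<open>\<theta>\<close>
  from \<open>[m]\<close> to \<open>[k]\<close>.\<close>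

record ('x, 'y) scat =
  lev :: "nat \<Rightarrow> ('x, 'y) cat"
  act :: "nat list \<Rightarrow> ('x, 'y, 'x, 'y) ftr"

text \<open>\<open>pcoh F m k \<theta> x\<close> is the component at \<open>x\<close> of the natural isomorphism
  \<open>F\<^sub>\<theta> : T(\<theta>) F\<^sub>k \<Rightarrow> F\<^sub>m S(\<theta>)\<close>.\<close>

record ('x, 'y, 'z, 'w) pstrans =
  pcmp :: "nat \<Rightarrow> ('x, 'y, 'z, 'w) ftr"
  pcoh :: "nat \<Rightarrow> nat \<Rightarrow> nat list \<Rightarrow> 'x \<Rightarrow> 'w"

definition pseudo_natural ::
    "('x, 'y) scat \<Rightarrow> ('z, 'w) scat \<Rightarrow> ('x, 'y, 'z, 'w) pstrans \<Rightarrow> bool" where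
  "pseudo_natural S T F \<longleftrightarrow>
     (\<forall>k. is_functor (lev S k) (lev T k) (pcmp F k)) \<and>
     (\<forall>m k. \<forall>\<theta> \<in> Delta m k.
        nat_iso (lev S k) (lev T m) (comp_ftr (act T \<theta>) (pcmp F k))
          (comp_ftr (pcmp F m) (act S \<theta>)) (pcoh F m k \<theta>)) \<and>
     (\<forall>k. \<forall>x \<in> Obj (lev S k).
        pcoh F k k (Delta_id k) x = idn (lev T k) (fob (pcmp F k) x)) \<and>
     (\<forall>l m k. \<forall>\<phi> \<in> Delta l m. \<forall>\<theta> \<in> Delta m k. \<forall>x \<in> Obj (lev S k).
        pcoh F l k (Delta_comp \<theta> \<phi>) x =
          pcoh F l m \<phi> (fob (act S \<theta>) x) \<cdot>\<^bsub>lev T l\<^esub> far (act T \<phi>) (pcoh F m k \<theta> x))"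

definition id_pstrans :: "('x, 'y) scat \<Rightarrow> ('x, 'y, 'x, 'y) pstrans" where
  "id_pstrans S = \<lparr>pcmp = \<lambda>k. id_ftr,
     pcoh = \<lambda>m k \<theta> x. idn (lev S m) (fob (act S \<theta>) x)\<rparr>"

definition comp_pstrans :: "('u, 'v) scat \<Rightarrow> ('z, 'w, 'u, 'v) pstrans \<Rightarrow>
    ('x, 'y, 'z, 'w) pstrans \<Rightarrow> ('x, 'y, 'u, 'v) pstrans" where
  "comp_pstrans U G F = \<lparr>pcmp = \<lambda>k. comp_ftr (pcmp G k) (pcmp F k),
     pcoh = \<lambda>m k \<theta> x. far (pcmp G m) (pcoh F m k \<theta> x)
       \<cdot>\<^bsub>lev U m\<^esub> pcoh G m k \<theta> (fob (pcmp F k) x)\<rparr>"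

definition modification :: "('x, 'y) scat \<Rightarrow> ('z, 'w) scat \<Rightarrow> ('x, 'y, 'z, 'w) pstrans \<Rightarrow>
    ('x, 'y, 'z, 'w) pstrans \<Rightarrow> (nat \<Rightarrow> 'x \<Rightarrow> 'w) \<Rightarrow> bool" where
  "modification S T F G \<mu> \<longleftrightarrow>
     (\<forall>k. nat_trans (lev S k) (lev T k) (pcmp F k) (pcmp G k) (\<mu> k)) \<and>
     (\<forall>m k. \<forall>\<theta> \<in> Delta m k. \<forall>x \<in> Obj (lev S k).
        \<mu> m (fob (act S \<theta>) x) \<cdot>\<^bsub>lev T m\<^esub> pcoh F m k \<theta> x =
          pcoh G m k \<theta> x \<cdot>\<^bsub>lev T m\<^esub> far (act T \<theta>) (\<mu> k x))"

definition invertible_modification :: "('x, 'y) scat \<Rightarrow> ('z, 'w) scat \<Rightarrow>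
    ('x, 'y, 'z, 'w) pstrans \<Rightarrow> ('x, 'y, 'z, 'w) pstrans \<Rightarrow> (nat \<Rightarrow> 'x \<Rightarrow> 'w) \<Rightarrow> bool" where
  "invertible_modification S T F G \<mu> \<longleftrightarrow> modification S T F G \<mu> \<and>
     (\<exists>\<nu>. modification S T G F \<nu> \<and>
        (\<forall>k. \<forall>x \<in> Obj (lev S k).
           \<nu> k x \<cdot>\<^bsub>lev T k\<^esub> \<mu> k x = idn (lev T k) (fob (pcmp F k) x) \<and>
           \<mu> k x \<cdot>\<^bsub>lev T k\<^esub> \<nu> k x = idn (lev T k) (fob (pcmp G k) x)))"

section \<open>Double categories and the 2-category of weakly globular double categories\<close>

text \<open>Types: objects \<open>'o\<close>, vertical arrows \<open>'v\<close>, horizontal arrows \<open>'h\<close>, double cells \<open>'c\<close>.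
  \<open>hm\<close> takes its arguments in the order of traversal: \<open>hm (h, h')\<close> is \<open>h\<close> followed by \<open>h'\<close>.\<close>

record ('o, 'v, 'h, 'c) dblcat =
  X0 :: "('o, 'v) cat"
  X1 :: "('h, 'c) cat"
  d0 :: "('h, 'c, 'o, 'v) ftr"
  d1 :: "('h, 'c, 'o, 'v) ftr"
  hid :: "('o, 'v, 'h, 'c) ftr"
  hm :: "('h \<times> 'h, 'c \<times> 'c, 'h, 'c) ftr"

definition hpairs :: "('o, 'v, 'h, 'c) dblcat \<Rightarrow> ('h \<times> 'h, 'c \<times> 'c) cat" where
  "hpairs X =
    \<lparr>Obj = {(h, h'). h \<in> Obj (X1 X) \<and> h' \<in> Obj (X1 X) \<and> fob (d1 X) h = fob (d0 X) h'},
     Arr = {(c, c'). c \<in> Arr (X1 X) \<and> c' \<in> Arr (X1 X) \<and> far (d1 X) c = far (d0 X) c'},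
     src = map_prod (src (X1 X)) (src (X1 X)),
     tgt = map_prod (tgt (X1 X)) (tgt (X1 X)),
     idn = map_prod (idn (X1 X)) (idn (X1 X)),
     cmp = \<lambda>(c, c') (b, b'). (c \<cdot>\<^bsub>X1 X\<^esub> b, c' \<cdot>\<^bsub>X1 X\<^esub> b')\<rparr>"

text \<open>The two horizontal categories: objects with horizontal arrows, and vertical arrows with
  double cells. That they are categories expresses the axioms of an internal category.\<close>

definition hcat_ob :: "('o, 'v, 'h, 'c) dblcat \<Rightarrow> ('o, 'h) cat" where
  "hcat_ob X = \<lparr>Obj = Obj (X0 X), Arr = Obj (X1 X), src = fob (d0 X), tgt = fob (d1 X),
     idn = fob (hid X), cmp = \<lambda>h' h. fob (hm X) (h, h')\<rparr>"

definition hcat_ar :: "('o, 'v, 'h, 'c) dblcat \<Rightarrow> ('v, 'c) cat" where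
  "hcat_ar X = \<lparr>Obj = Arr (X0 X), Arr = Arr (X1 X), src = far (d0 X), tgt = far (d1 X),
     idn = far (hid X), cmp = \<lambda>c' c. far (hm X) (c, c')\<rparr>"

definition double_category :: "('o, 'v, 'h, 'c) dblcat \<Rightarrow> bool" where
  "double_category X \<longleftrightarrow>
     category (X0 X) \<and> category (X1 X) \<and>
     is_functor (X1 X) (X0 X) (d0 X) \<and> is_functor (X1 X) (X0 X) (d1 X) \<and>
     is_functor (X0 X) (X1 X) (hid X) \<and> is_functor (hpairs X) (X1 X) (hm X) \<and>
     category (hcat_ob X) \<and> category (hcat_ar X)"

text \<open>The \<open>n\<close>-fold fibre product of \<open>K\<close> over \<open>B\<close> along \<open>s, t : K \<rightarrow> B\<close>, as a category of
  lists.\<close>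

definition fibre_power :: "('h, 'c) cat \<Rightarrow> ('h, 'c, 'p, 'q) ftr \<Rightarrow> ('h, 'c, 'p, 'q) ftr \<Rightarrow>
    nat \<Rightarrow> ('h list, 'c list) cat" where
  "fibre_power K s t n =
    \<lparr>Obj = {hs. length hs = n \<and> set hs \<subseteq> Obj K \<and>
        successively (\<lambda>h h'. fob t h = fob s h') hs},
     Arr = {cs. length cs = n \<and> set cs \<subseteq> Arr K \<and>
        successively (\<lambda>c c'. far t c = far s c') cs},
     src = map (src K), tgt = map (tgt K), idn = map (idn K), cmp = map2 (cmp K)\<rparr>"

text \<open>The nerve at level \<open>k\<close>, uniformly in \<open>k\<close>: strings of \<open>k\<close> horizontal arrows (cells) together
  with the starting object (vertical arrow). For \<open>k = 0\<close> this is \<open>X0\<close>, for \<open>k > 0\<close> it is the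
  \<open>k\<close>-fold fibre product of \<open>X1\<close> over \<open>X0\<close>, the starting object being redundant.\<close>

definition nerve_level :: "('o, 'v, 'h, 'c) dblcat \<Rightarrow> nat \<Rightarrow> ('o \<times> 'h list, 'v \<times> 'c list) cat"
  where
  "nerve_level X k = (let P = fibre_power (X1 X) (d0 X) (d1 X) k in
    \<lparr>Obj = {(a, hs). a \<in> Obj (X0 X) \<and> hs \<in> Obj P \<and> (hs \<noteq> [] \<longrightarrow> fob (d0 X) (hd hs) = a)},
     Arr = {(v, cs). v \<in> Arr (X0 X) \<and> cs \<in> Arr P \<and> (cs \<noteq> [] \<longrightarrow> far (d0 X) (hd cs) = v)},
     src = map_prod (src (X0 X)) (src P),
     tgt = map_prod (tgt (X0 X)) (tgt P),
     idn = map_prod (idn (X0 X)) (idn P),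
     cmp = \<lambda>(v, cs) (u, bs). (v \<cdot>\<^bsub>X0 X\<^esub> u, cs \<cdot>\<^bsub>P\<^esub> bs)\<rparr>)"

definition string_act :: "('o, 'a) cat \<Rightarrow> nat list \<Rightarrow> 'o \<times> 'a list \<Rightarrow> 'o \<times> 'a list" where
  "string_act K \<theta> p = (vertex (tgt K) p (\<theta> ! 0),
     map (\<lambda>i. path_comp K (segment (tgt K) p (\<theta> ! i) (\<theta> ! Suc i))) [0..<length \<theta> - 1])"

definition hnerve :: "('o, 'v, 'h, 'c) dblcat \<Rightarrow> ('o \<times> 'h list, 'v \<times> 'c list) scat" where
  "hnerve X = \<lparr>lev = nerve_level X,
     act = \<lambda>\<theta>. \<lparr>fob = string_act (hcat_ob X) \<theta>, far = string_act (hcat_ar X) \<theta>\<rparr>\<rparr>"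

definition path_component :: "('o, 'a) cat \<Rightarrow> 'o \<Rightarrow> 'o set" where
  "path_component C a =
     {b. (a, b) \<in> ({(src C f, tgt C f) |f. f \<in> Arr C} \<union> {(tgt C f, src C f) |f. f \<in> Arr C})\<^sup>*}"

text \<open>A discrete category has its objects as arrows.\<close>

definition discrete :: "'o set \<Rightarrow> ('o, 'o) cat" where
  "discrete S = \<lparr>Obj = S, Arr = S, src = \<lambda>a. a, tgt = \<lambda>a. a, idn = \<lambda>a. a, cmp = \<lambda>b a. a\<rparr>"

definition components :: "('o, 'a) cat \<Rightarrow> ('o set, 'o set) cat" where
  "components C = discrete (path_component C ` Obj C)"

definition gamma :: "('o, 'a) cat \<Rightarrow> ('o, 'a, 'o set, 'o set) ftr" where
  "gamma C = \<lparr>fob = path_component C, far = \<lambda>f. path_component C (src C f)\<rparr>"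

definition weakly_globular :: "('o, 'v, 'h, 'c) dblcat \<Rightarrow> bool" where
  "weakly_globular X \<longleftrightarrow> double_category X \<and>
     equivalence_of_categories (X0 X) (components (X0 X)) (gamma (X0 X)) \<and>
     (\<forall>n \<ge> 2. equivalence_of_categories
        (fibre_power (X1 X) (d0 X) (d1 X) n)
        (fibre_power (X1 X) (comp_ftr (gamma (X0 X)) (d0 X)) (comp_ftr (gamma (X0 X)) (d1 X)) n)
        id_ftr)"

definition pseudo_functor :: "('o, 'v, 'h, 'c) dblcat \<Rightarrow> ('p, 'w, 'k, 'e) dblcat \<Rightarrow>
    ('o \<times> 'h list, 'v \<times> 'c list, 'p \<times> 'k list, 'w \<times> 'e list) pstrans \<Rightarrow> bool" where
  "pseudo_functor X Y F \<longleftrightarrow> pseudo_natural (hnerve X) (hnerve Y) F"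

text \<open>An equivalence internal to the 2-category whose objects are the weakly globular double
  categories, whose arrows are the pseudo-functors and whose 2-cells are the vertical
  transformations.\<close>

definition equivalent_in_WGDbl_ps ::
    "('o, 'v, 'h, 'c) dblcat \<Rightarrow> ('p, 'w, 'k, 'e) dblcat \<Rightarrow> bool" where
  "equivalent_in_WGDbl_ps X Y \<longleftrightarrow> weakly_globular X \<and> weakly_globular Y \<and>
     (\<exists>F G \<eta> \<epsilon>. pseudo_functor X Y F \<and> pseudo_functor Y X G \<and>
        invertible_modification (hnerve X) (hnerve X)
          (id_pstrans (hnerve X)) (comp_pstrans (hnerve X) G F) \<eta> \<and>
        invertible_modification (hnerve Y) (hnerve Y)
          (comp_pstrans (hnerve Y) F G) (id_pstrans (hnerve Y)) \<epsilon>)"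

section \<open>Calculus of fractions\<close>

locale calculus_of_fractions = category C
  for C :: "('o, 'a) cat" (structure) +
  fixes W :: "'a set"
  assumes W_arr: "W \<subseteq> Arr C"
    and CF1_iso: "is_iso C f \<Longrightarrow> f \<in> W"
    and CF1_comp: "f \<in> W \<Longrightarrow> g \<in> W \<Longrightarrow> src C g = tgt C f \<Longrightarrow> g \<cdot> f \<in> W"
    and CF2: "f \<in> Arr C \<Longrightarrow> w \<in> W \<Longrightarrow> tgt C f = tgt C w \<Longrightarrow>
      \<exists>d. \<exists>f' \<in> hom C d (src C w). \<exists>w' \<in> hom C d (src C f). w' \<in> W \<and> w \<cdot> f' = f \<cdot> w'"
    and CF3: "w \<in> W \<Longrightarrow> f \<in> hom C a (src C w) \<Longrightarrow> g \<in> hom C a (src C w) \<Longrightarrow> w \<cdot> f = w \<cdot> g \<Longrightarrow>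
      \<exists>w' \<in> W. tgt C w' = a \<and> f \<cdot> w' = g \<cdot> w'"

text \<open>Pairs \<open>(u\<^sub>1, u\<^sub>2)\<close> with common domain and \<open>w\<^sub>1 u\<^sub>1 = w\<^sub>2 u\<^sub>2 \<in> W\<close>, and their equivalence. They
  occur both in the vertical arrows of \<open>C{W}\<close> and in the 2-cells of the bicategory of
  fractions.\<close>

definition side_rep :: "('o, 'a) cat \<Rightarrow> 'a set \<Rightarrow> 'a \<Rightarrow> 'a \<Rightarrow> 'a \<times> 'a \<Rightarrow> bool" where
  "side_rep C W w1 w2 = (\<lambda>(u1, u2). \<exists>c. u1 \<in> hom C c (src C w1) \<and> u2 \<in> hom C c (src C w2) \<and>
     w1 \<cdot>\<^bsub>C\<^esub> u1 = w2 \<cdot>\<^bsub>C\<^esub> u2 \<and> w1 \<cdot>\<^bsub>C\<^esub> u1 \<in> W)"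

definition side_eq :: "('o, 'a) cat \<Rightarrow> 'a set \<Rightarrow> 'a \<Rightarrow> 'a \<times> 'a \<Rightarrow> 'a \<times> 'a \<Rightarrow> bool" where
  "side_eq C W w1 = (\<lambda>(u1, u2) (v1, v2).
     \<exists>e. \<exists>r1 \<in> hom C e (src C u1). \<exists>r2 \<in> hom C e (src C v1).
       u1 \<cdot>\<^bsub>C\<^esub> r1 = v1 \<cdot>\<^bsub>C\<^esub> r2 \<and> u2 \<cdot>\<^bsub>C\<^esub> r1 = v2 \<cdot>\<^bsub>C\<^esub> r2 \<and> w1 \<cdot>\<^bsub>C\<^esub> u1 \<cdot>\<^bsub>C\<^esub> r1 \<in> W)"

section \<open>The double category \<open>C{W}\<close>\<close>

text \<open>A horizontal arrow is \<open>(w, f, w')\<close>. A vertical arrow is \<open>(w\<^sub>1, U, w\<^sub>2)\<close>, where \<open>U\<close> is an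
  equivalence class of pairs \<open>(u\<^sub>1, u\<^sub>2)\<close>.\<close>

type_synonym 'a hor = "'a \<times> 'a \<times> 'a"
type_synonym 'a ver = "'a \<times> ('a \<times> 'a) set \<times> 'a"

definition ver_class :: "('o, 'a) cat \<Rightarrow> 'a set \<Rightarrow> 'a \<Rightarrow> 'a \<Rightarrow> 'a \<times> 'a \<Rightarrow> ('a \<times> 'a) set" where
  "ver_class C W w1 w2 p = {q. side_rep C W w1 w2 q \<and> side_eq C W w1 p q}"

definition CW_hor :: "('o, 'a) cat \<Rightarrow> 'a set \<Rightarrow> 'a hor set" where
  "CW_hor C W = {(w, f, w'). w \<in> W \<and> w' \<in> W \<and> f \<in> hom C (src C w) (src C w')}"

definition CW_ver :: "('o, 'a) cat \<Rightarrow> 'a set \<Rightarrow> 'a ver set" where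
  "CW_ver C W = {(w1, U, w2). w1 \<in> W \<and> w2 \<in> W \<and> tgt C w1 = tgt C w2 \<and>
     (\<exists>p. side_rep C W w1 w2 p \<and> U = ver_class C W w1 w2 p)}"

definition CW_ver_id :: "('o, 'a) cat \<Rightarrow> 'a set \<Rightarrow> 'a \<Rightarrow> 'a ver" where
  "CW_ver_id C W w = (w, ver_class C W w w (idn C (src C w), idn C (src C w)), w)"

text \<open>Compositions of classes are given as the union of the classes of all composites of
  representatives, for all choices involved.\<close>

definition CW_ver_comp :: "('o, 'a) cat \<Rightarrow> 'a set \<Rightarrow> 'a ver \<Rightarrow> 'a ver \<Rightarrow> 'a ver" where
  "CW_ver_comp C W = (\<lambda>(w2, V, w3) (w1, U, w2').
     (w1, \<Union> {ver_class C W w1 w3 (u1 \<cdot>\<^bsub>C\<^esub> x, v2 \<cdot>\<^bsub>C\<^esub> y) | u1 u2 v1 v2 x y e.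
        (u1, u2) \<in> U \<and> (v1, v2) \<in> V \<and> x \<in> hom C e (src C u1) \<and> y \<in> hom C e (src C v1) \<and>
        u2 \<cdot>\<^bsub>C\<^esub> x = v1 \<cdot>\<^bsub>C\<^esub> y \<and> w2 \<cdot>\<^bsub>C\<^esub> u2 \<cdot>\<^bsub>C\<^esub> x \<in> W}, w3))"

definition CW_X0 :: "('o, 'a) cat \<Rightarrow> 'a set \<Rightarrow> ('a, 'a ver) cat" where
  "CW_X0 C W = \<lparr>Obj = W, Arr = CW_ver C W,
     src = \<lambda>(w1, U, w2). w1, tgt = \<lambda>(w1, U, w2). w2,
     idn = CW_ver_id C W, cmp = CW_ver_comp C W\<rparr>"

text \<open>A representative \<open>(u\<^sub>1, u\<^sub>2, u\<^sub>1', u\<^sub>2', \<phi>)\<close> of a double cell consists of representatives of the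
  two sides and the arrow \<open>\<phi>\<close>. A double cell is its boundary together with an equivalence class
  of such representatives.\<close>

type_synonym 'a crep = "'a \<times> 'a \<times> 'a \<times> 'a \<times> 'a"

record 'a cell =
  ctop :: "'a hor"
  cbot :: "'a hor"
  cleft :: "'a ver"
  cright :: "'a ver"
  creps :: "'a crep set"

definition cell_rep :: "('o, 'a) cat \<Rightarrow> 'a hor \<Rightarrow> 'a hor \<Rightarrow> 'a ver \<Rightarrow> 'a ver \<Rightarrow> 'a crep \<Rightarrow> bool"
  where
  "cell_rep C = (\<lambda>(w1, f1, w1') (w2, f2, w2') (_, U, _) (_, U', _) (u1, u2, u1', u2', \<phi>).
     (u1, u2) \<in> U \<and> (u1', u2') \<in> U' \<and> \<phi> \<in> hom C (src C u1) (src C u1') \<and>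
     f1 \<cdot>\<^bsub>C\<^esub> u1 = u1' \<cdot>\<^bsub>C\<^esub> \<phi> \<and> f2 \<cdot>\<^bsub>C\<^esub> u2 = u2' \<cdot>\<^bsub>C\<^esub> \<phi>)"

definition cell_eq :: "('o, 'a) cat \<Rightarrow> 'a set \<Rightarrow> 'a hor \<Rightarrow> 'a crep \<Rightarrow> 'a crep \<Rightarrow> bool" where
  "cell_eq C W = (\<lambda>(w1, f1, w1') (u1, u2, u1', u2', \<phi>) (v1, v2, v1', v2', \<psi>).
     \<exists>e e'. \<exists>r \<in> hom C e (src C u1). \<exists>s \<in> hom C e (src C v1).
       \<exists>r' \<in> hom C e' (src C u1'). \<exists>s' \<in> hom C e' (src C v1'). \<exists>\<chi> \<in> hom C e e'.
         \<phi> \<cdot>\<^bsub>C\<^esub> r = r' \<cdot>\<^bsub>C\<^esub> \<chi> \<and> \<psi> \<cdot>\<^bsub>C\<^esub> s = s' \<cdot>\<^bsub>C\<^esub> \<chi> \<and>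
         u1 \<cdot>\<^bsub>C\<^esub> r = v1 \<cdot>\<^bsub>C\<^esub> s \<and> u2 \<cdot>\<^bsub>C\<^esub> r = v2 \<cdot>\<^bsub>C\<^esub> s \<and>
         u1' \<cdot>\<^bsub>C\<^esub> r' = v1' \<cdot>\<^bsub>C\<^esub> s' \<and> u2' \<cdot>\<^bsub>C\<^esub> r' = v2' \<cdot>\<^bsub>C\<^esub> s' \<and>
         w1 \<cdot>\<^bsub>C\<^esub> u1 \<cdot>\<^bsub>C\<^esub> r \<in> W \<and> w1' \<cdot>\<^bsub>C\<^esub> u1' \<cdot>\<^bsub>C\<^esub> r' \<in> W)"

definition cell_class :: "('o, 'a) cat \<Rightarrow> 'a set \<Rightarrow> 'a hor \<Rightarrow> 'a hor \<Rightarrow> 'a ver \<Rightarrow> 'a ver \<Rightarrow>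
    'a crep \<Rightarrow> 'a crep set" where
  "cell_class C W t b l r p = {q. cell_rep C t b l r q \<and> cell_eq C W t p q}"

definition CW_cell :: "('o, 'a) cat \<Rightarrow> 'a set \<Rightarrow> 'a cell set" where
  "CW_cell C W =
     {\<lparr>ctop = (w1, f1, w1'), cbot = (w2, f2, w2'), cleft = (w1, U, w2), cright = (w1', U', w2'),
       creps = cell_class C W (w1, f1, w1') (w2, f2, w2') (w1, U, w2) (w1', U', w2') p\<rparr>
      | w1 f1 w1' w2 f2 w2' U U' p.
        (w1, f1, w1') \<in> CW_hor C W \<and> (w2, f2, w2') \<in> CW_hor C W \<and>
        (w1, U, w2) \<in> CW_ver C W \<and> (w1', U', w2') \<in> CW_ver C W \<and>
        cell_rep C (w1, f1, w1') (w2, f2, w2') (w1, U, w2) (w1', U', w2') p}"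

text \<open>The vertical identity cell on a horizontal arrow \<open>f\<close> is represented by \<open>f\<close>, with identity
  representatives of its sides.\<close>

definition CW_cell_vid :: "('o, 'a) cat \<Rightarrow> 'a set \<Rightarrow> 'a hor \<Rightarrow> 'a cell" where
  "CW_cell_vid C W = (\<lambda>(w, f, w').
     let i = idn C (src C w); i' = idn C (src C w');
         l = CW_ver_id C W w; r = CW_ver_id C W w'
     in \<lparr>ctop = (w, f, w'), cbot = (w, f, w'), cleft = l, cright = r,
         creps = cell_class C W (w, f, w') (w, f, w') l r (i, i, i', i', f)\<rparr>)"

text \<open>In \<open>CW_cell_vcomp C W \<beta> \<alpha>\<close> the cell \<open>\<alpha>\<close> lies above \<open>\<beta>\<close>. In the notation of vertical
  composition of vertical arrows, \<open>(x, y)\<close> are the arrows \<open>E \<rightarrow> C\<close>, \<open>E \<rightarrow> D\<close> for the left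
  sides, \<open>(x', y')\<close> those for the right sides.\<close>

definition CW_cell_vcomp :: "('o, 'a) cat \<Rightarrow> 'a set \<Rightarrow> 'a cell \<Rightarrow> 'a cell \<Rightarrow> 'a cell" where
  "CW_cell_vcomp C W \<beta> \<alpha> =
     (let t = ctop \<alpha>; b = cbot \<beta>;
          l = CW_ver_comp C W (cleft \<beta>) (cleft \<alpha>);
          r = CW_ver_comp C W (cright \<beta>) (cright \<alpha>);
          w2 = fst (cbot \<alpha>); w2' = snd (snd (cbot \<alpha>))
      in \<lparr>ctop = t, cbot = b, cleft = l, cright = r,
          creps = \<Union> {cell_class C W t b l r
              (u1 \<cdot>\<^bsub>C\<^esub> x \<cdot>\<^bsub>C\<^esub> q, v2 \<cdot>\<^bsub>C\<^esub> y \<cdot>\<^bsub>C\<^esub> q, u1' \<cdot>\<^bsub>C\<^esub> x', v2' \<cdot>\<^bsub>C\<^esub> y', \<xi>)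
            | u1 u2 u1' u2' \<phi> v1 v2 v1' v2' \<psi> x y x' y' q \<xi> e e' e0.
              (u1, u2, u1', u2', \<phi>) \<in> creps \<alpha> \<and> (v1, v2, v1', v2', \<psi>) \<in> creps \<beta> \<and>
              x \<in> hom C e (src C u1) \<and> y \<in> hom C e (src C v1) \<and>
              u2 \<cdot>\<^bsub>C\<^esub> x = v1 \<cdot>\<^bsub>C\<^esub> y \<and> w2 \<cdot>\<^bsub>C\<^esub> u2 \<cdot>\<^bsub>C\<^esub> x \<in> W \<and>
              x' \<in> hom C e' (src C u1') \<and> y' \<in> hom C e' (src C v1') \<and>
              u2' \<cdot>\<^bsub>C\<^esub> x' = v1' \<cdot>\<^bsub>C\<^esub> y' \<and> w2' \<cdot>\<^bsub>C\<^esub> u2' \<cdot>\<^bsub>C\<^esub> x' \<in> W \<and>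
              q \<in> W \<and> q \<in> hom C e0 e \<and> \<xi> \<in> hom C e0 e' \<and>
              x' \<cdot>\<^bsub>C\<^esub> \<xi> = \<phi> \<cdot>\<^bsub>C\<^esub> x \<cdot>\<^bsub>C\<^esub> q \<and> y' \<cdot>\<^bsub>C\<^esub> \<xi> = \<psi> \<cdot>\<^bsub>C\<^esub> y \<cdot>\<^bsub>C\<^esub> q}\<rparr>)"

definition CW_X1 :: "('o, 'a) cat \<Rightarrow> 'a set \<Rightarrow> ('a hor, 'a cell) cat" where
  "CW_X1 C W = \<lparr>Obj = CW_hor C W, Arr = CW_cell C W,
     src = ctop, tgt = cbot, idn = CW_cell_vid C W, cmp = CW_cell_vcomp C W\<rparr>"

definition CW_hor_id :: "('o, 'a) cat \<Rightarrow> 'a \<Rightarrow> 'a hor" where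
  "CW_hor_id C w = (w, idn C (src C w), w)"

definition CW_hor_comp :: "('o, 'a) cat \<Rightarrow> 'a hor \<times> 'a hor \<Rightarrow> 'a hor" where
  "CW_hor_comp C = (\<lambda>((w, f, w'), (_, g, w'')). (w, g \<cdot>\<^bsub>C\<^esub> f, w''))"

text \<open>The horizontal identity cell on \<open>[u\<^sub>1, A, u\<^sub>2]\<close> is represented by the identity of \<open>A\<close>.\<close>

definition CW_cell_hid :: "('o, 'a) cat \<Rightarrow> 'a set \<Rightarrow> 'a ver \<Rightarrow> 'a cell" where
  "CW_cell_hid C W = (\<lambda>(w1, U, w2).
     let t = CW_hor_id C w1; b = CW_hor_id C w2; v = (w1, U, w2)
     in \<lparr>ctop = t, cbot = b, cleft = v, cright = v,
         creps = \<Union> {cell_class C W t b v v (u1, u2, u1, u2, idn C (src C u1))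
           | u1 u2. (u1, u2) \<in> U}\<rparr>)"

text \<open>The first cell of the pair lies to the left of the second; \<open>(z, \<phi>')\<close> plays the role of
  the arrows written \<open>r\<close> and \<open>\<phi>\<close> with a bar.\<close>

definition CW_cell_hcomp :: "('o, 'a) cat \<Rightarrow> 'a set \<Rightarrow> 'a cell \<times> 'a cell \<Rightarrow> 'a cell" where
  "CW_cell_hcomp C W = (\<lambda>(\<alpha>, \<beta>).
     let t = CW_hor_comp C (ctop \<alpha>, ctop \<beta>);
         b = CW_hor_comp C (cbot \<alpha>, cbot \<beta>);
         l = cleft \<alpha>; r = cright \<beta>; w1' = snd (snd (ctop \<alpha>))
     in \<lparr>ctop = t, cbot = b, cleft = l, cright = r,
         creps = \<Union> {cell_class C W t b l r
             (u1 \<cdot>\<^bsub>C\<^esub> z, u2 \<cdot>\<^bsub>C\<^esub> z, v1', v2', \<psi> \<cdot>\<^bsub>C\<^esub> s \<cdot>\<^bsub>C\<^esub> \<phi>')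
           | u1 u2 u1' u2' \<phi> v1 v2 v1' v2' \<psi> p s z \<phi>' e e'.
             (u1, u2, u1', u2', \<phi>) \<in> creps \<alpha> \<and> (v1, v2, v1', v2', \<psi>) \<in> creps \<beta> \<and>
             p \<in> hom C e (src C u1') \<and> s \<in> hom C e (src C v1) \<and>
             u1' \<cdot>\<^bsub>C\<^esub> p = v1 \<cdot>\<^bsub>C\<^esub> s \<and> u2' \<cdot>\<^bsub>C\<^esub> p = v2 \<cdot>\<^bsub>C\<^esub> s \<and>
             w1' \<cdot>\<^bsub>C\<^esub> u1' \<cdot>\<^bsub>C\<^esub> p \<in> W \<and>
             z \<in> W \<and> z \<in> hom C e' (src C u1) \<and> \<phi>' \<in> hom C e' e \<and> \<phi> \<cdot>\<^bsub>C\<^esub> z = p \<cdot>\<^bsub>C\<^esub> \<phi>'}\<rparr>)"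

definition CW :: "('o, 'a) cat \<Rightarrow> 'a set \<Rightarrow> ('a, 'a ver, 'a hor, 'a cell) dblcat" where
  "CW C W = \<lparr>X0 = CW_X0 C W, X1 = CW_X1 C W,
     d0 = \<lparr>fob = \<lambda>(w, f, w'). w, far = cleft\<rparr>,
     d1 = \<lparr>fob = \<lambda>(w, f, w'). w', far = cright\<rparr>,
     hid = \<lparr>fob = CW_hor_id C, far = CW_cell_hid C W\<rparr>,
     hm = \<lparr>fob = CW_hor_comp C, far = CW_cell_hcomp C W\<rparr>\<rparr>"

section \<open>The data of a bicategory; the bicategory of fractions\<close>

text \<open>All compositions are in the applicative order. The constraint cells are
  \<open>bassoc h g f : (h g) f \<Rightarrow> h (g f)\<close>, \<open>blunit f : 1 f \<Rightarrow> f\<close> and \<open>brunit f : f 1 \<Rightarrow> f\<close>.\<close>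

record ('o, 'a, 'c) bicat =
  BObj :: "'o set"
  BArr :: "'a set"
  bsrc :: "'a \<Rightarrow> 'o"
  btgt :: "'a \<Rightarrow> 'o"
  BCell :: "'c set"
  bdom :: "'c \<Rightarrow> 'a"
  bcod :: "'c \<Rightarrow> 'a"
  bid :: "'o \<Rightarrow> 'a"
  bcomp :: "'a \<Rightarrow> 'a \<Rightarrow> 'a"
  bcid :: "'a \<Rightarrow> 'c"
  bvcomp :: "'c \<Rightarrow> 'c \<Rightarrow> 'c"
  bhcomp :: "'c \<Rightarrow> 'c \<Rightarrow> 'c"
  bassoc :: "'a \<Rightarrow> 'a \<Rightarrow> 'a \<Rightarrow> 'c"
  blunit :: "'a \<Rightarrow> 'c"
  brunit :: "'a \<Rightarrow> 'c"

text \<open>\<open>sq f w = (w', f')\<close> is a chosen square \<open>f w' = w f'\<close> with \<open>w' \<in> W\<close>.\<close>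

definition chosen_squares :: "('o, 'a) cat \<Rightarrow> 'a set \<Rightarrow> ('a \<Rightarrow> 'a \<Rightarrow> 'a \<times> 'a) \<Rightarrow> bool" where
  "chosen_squares C W sq \<longleftrightarrow>
     (\<forall>f \<in> Arr C. \<forall>w \<in> W. tgt C f = tgt C w \<longrightarrow>
        (case sq f w of (w', f') \<Rightarrow>
          (\<exists>d. w' \<in> hom C d (src C f) \<and> f' \<in> hom C d (src C w) \<and> w' \<in> W \<and>
               f \<cdot>\<^bsub>C\<^esub> w' = w \<cdot>\<^bsub>C\<^esub> f')) \<and>
        (f = idn C (src C f) \<longrightarrow> sq f w = (w, idn C (src C w))) \<and>
        (w = idn C (src C w) \<longrightarrow> sq f w = (idn C (src C f), f)))"

text \<open>A span \<open>A \<leftarrow> S \<rightarrow> B\<close> is the pair of its legs. A 2-cell is recorded together with its source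
  and target spans.\<close>

type_synonym 'a span = "'a \<times> 'a"
type_synonym 'a fcell = "'a span \<times> ('a \<times> 'a) set \<times> 'a span"

definition span_comp :: "('o, 'a) cat \<Rightarrow> ('a \<Rightarrow> 'a \<Rightarrow> 'a \<times> 'a) \<Rightarrow> 'a span \<Rightarrow> 'a span \<Rightarrow> 'a span"
  where
  "span_comp C sq = (\<lambda>(w2, f2) (w1, f1). case sq f1 w2 of (w', f') \<Rightarrow>
     (w1 \<cdot>\<^bsub>C\<^esub> w', f2 \<cdot>\<^bsub>C\<^esub> f'))"

definition spans :: "('o, 'a) cat \<Rightarrow> 'a set \<Rightarrow> 'a span set" where
  "spans C W = {(w, f). w \<in> W \<and> f \<in> Arr C \<and> src C f = src C w}"

definition fcell_rep :: "('o, 'a) cat \<Rightarrow> 'a set \<Rightarrow> 'a span \<Rightarrow> 'a span \<Rightarrow> 'a \<times> 'a \<Rightarrow> bool" where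
  "fcell_rep C W = (\<lambda>(w1, f1) (w2, f2) (u1, u2).
     side_rep C W w1 w2 (u1, u2) \<and> f1 \<cdot>\<^bsub>C\<^esub> u1 = f2 \<cdot>\<^bsub>C\<^esub> u2)"

definition fcells :: "('o, 'a) cat \<Rightarrow> 'a set \<Rightarrow> 'a fcell set" where
  "fcells C W = {(a, {q. fcell_rep C W a b q \<and> side_eq C W (fst a) p q}, b) | a b p.
     a \<in> spans C W \<and> b \<in> spans C W \<and> tgt C (fst a) = tgt C (fst b) \<and>
     tgt C (snd a) = tgt C (snd b) \<and> fcell_rep C W a b p}"

definition the_fcell :: "('o, 'a) cat \<Rightarrow> 'a set \<Rightarrow> 'a span \<Rightarrow> 'a span \<Rightarrow> 'a fcell" where
  "the_fcell C W a b = (THE \<alpha>. \<alpha> \<in> fcells C W \<and> fst \<alpha> = a \<and> snd (snd \<alpha>) = b)"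

text \<open>There is at most one 2-cell between two spans, so that the operations on 2-cells and the
  constraint cells are determined by their source and target.\<close>

definition fractions :: "('o, 'a) cat \<Rightarrow> 'a set \<Rightarrow> ('a \<Rightarrow> 'a \<Rightarrow> 'a \<times> 'a) \<Rightarrow>
    ('o, 'a span, 'a fcell) bicat" where
  "fractions C W sq = (let c = span_comp C sq; i = (\<lambda>A. (idn C A, idn C A)) in
    \<lparr>BObj = Obj C,
     BArr = spans C W,
     bsrc = \<lambda>(w, f). tgt C w,
     btgt = \<lambda>(w, f). tgt C f,
     BCell = fcells C W,
     bdom = \<lambda>(a, P, b). a,
     bcod = \<lambda>(a, P, b). b,
     bid = i,
     bcomp = c,
     bcid = \<lambda>a. the_fcell C W a a,
     bvcomp = \<lambda>(_, _, b) (a, _, _). the_fcell C W a b,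
     bhcomp = \<lambda>(a', _, b') (a, _, b). the_fcell C W (c a' a) (c b' b),
     bassoc = \<lambda>h g f. the_fcell C W (c (c h g) f) (c h (c g f)),
     blunit = \<lambda>f. the_fcell C W (c (i (tgt C (snd f))) f) f,
     brunit = \<lambda>f. the_fcell C W (c f (i (tgt C (fst f)))) f\<rparr>)"

section \<open>The double category of marked paths in a bicategory\<close>

text \<open>Formal composites; \<open>Seq s t\<close> is \<open>s\<close> followed by \<open>t\<close>.\<close>

datatype ('o, 'a) word = Unit 'o | Letter 'a | Seq "('o, 'a) word" "('o, 'a) word"

primrec eval_word :: "('o, 'a, 'c) bicat \<Rightarrow> ('o, 'a) word \<Rightarrow> 'a" where
  "eval_word B (Unit A) = bid B A"
| "eval_word B (Letter f) = f"
| "eval_word B (Seq s t) = bcomp B (eval_word B t) (eval_word B s)"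

primrec word_src :: "('o, 'a, 'c) bicat \<Rightarrow> ('o, 'a) word \<Rightarrow> 'o" where
  "word_src B (Unit A) = A"
| "word_src B (Letter f) = bsrc B f"
| "word_src B (Seq s t) = word_src B s"

primrec word_tgt :: "('o, 'a, 'c) bicat \<Rightarrow> ('o, 'a) word \<Rightarrow> 'o" where
  "word_tgt B (Unit A) = A"
| "word_tgt B (Letter f) = btgt B f"
| "word_tgt B (Seq s t) = word_tgt B t"

primrec word_ok :: "('o, 'a, 'c) bicat \<Rightarrow> ('o, 'a) word \<Rightarrow> bool" where
  "word_ok B (Unit A) \<longleftrightarrow> A \<in> BObj B"
| "word_ok B (Letter f) \<longleftrightarrow> f \<in> BArr B"
| "word_ok B (Seq s t) \<longleftrightarrow> word_ok B s \<and> word_ok B t \<and> word_tgt B s = word_src B t"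

primrec unit_free :: "('o, 'a) word \<Rightarrow> bool" where
  "unit_free (Unit A) \<longleftrightarrow> False"
| "unit_free (Letter f) \<longleftrightarrow> True"
| "unit_free (Seq s t) \<longleftrightarrow> unit_free s \<and> unit_free t"

primrec letters :: "('o, 'a) word \<Rightarrow> 'a list" where
  "letters (Unit A) = []"
| "letters (Letter f) = [f]"
| "letters (Seq s t) = letters s @ letters t"

abbreviation bpath :: "('o, 'a, 'c) bicat \<Rightarrow> 'o \<times> 'a list \<Rightarrow> bool" where
  "bpath B \<equiv> is_path (BObj B) (BArr B) (bsrc B) (btgt B)"

text \<open>A choice of a bracketing for each path; for a path of length one the conditions leave
  only \<open>Letter f\<close>.\<close>

definition chosen_composites ::
    "('o, 'a, 'c) bicat \<Rightarrow> ('o \<times> 'a list \<Rightarrow> ('o, 'a) word) \<Rightarrow> bool" where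
  "chosen_composites B br \<longleftrightarrow> (\<forall>A fs. bpath B (A, fs) \<longrightarrow>
     (if fs = [] then br (A, fs) = Unit A
      else unit_free (br (A, fs)) \<and> letters (br (A, fs)) = fs))"

definition inverse_cells :: "('o, 'a, 'c) bicat \<Rightarrow> 'c \<Rightarrow> 'c \<Rightarrow> bool" where
  "inverse_cells B \<alpha> \<beta> \<longleftrightarrow> \<alpha> \<in> BCell B \<and> \<beta> \<in> BCell B \<and>
     bdom B \<beta> = bcod B \<alpha> \<and> bcod B \<beta> = bdom B \<alpha> \<and>
     bvcomp B \<beta> \<alpha> = bcid B (bdom B \<alpha>) \<and> bvcomp B \<alpha> \<beta> = bcid B (bcod B \<alpha>)"

text \<open>The 2-cells built from associativity and unit cells. They are indexed by formal composites
  and not by their values, since uniqueness between given arrows would fail in bicategories in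
  which different formal composites accidentally have equal values.\<close>

inductive coherence :: "('o, 'a, 'c) bicat \<Rightarrow> ('o, 'a) word \<Rightarrow> ('o, 'a) word \<Rightarrow> 'c \<Rightarrow> bool"
  for B where
  coh_id: "word_ok B s \<Longrightarrow> coherence B s s (bcid B (eval_word B s))"
| coh_assoc: "word_ok B (Seq r (Seq s t)) \<Longrightarrow> coherence B (Seq r (Seq s t)) (Seq (Seq r s) t)
    (bassoc B (eval_word B t) (eval_word B s) (eval_word B r))"
| coh_lunit: "word_ok B s \<Longrightarrow>
    coherence B (Seq s (Unit (word_tgt B s))) s (blunit B (eval_word B s))"
| coh_runit: "word_ok B s \<Longrightarrow>
    coherence B (Seq (Unit (word_src B s)) s) s (brunit B (eval_word B s))"
| coh_inv: "coherence B s t \<alpha> \<Longrightarrow> inverse_cells B \<alpha> \<beta> \<Longrightarrow> coherence B t s \<beta>"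
| coh_vcomp: "coherence B r s \<alpha> \<Longrightarrow> coherence B s t \<beta> \<Longrightarrow> coherence B r t (bvcomp B \<beta> \<alpha>)"
| coh_hcomp: "coherence B s s' \<alpha> \<Longrightarrow> coherence B t t' \<beta> \<Longrightarrow> word_tgt B s = word_src B t \<Longrightarrow>
    coherence B (Seq s t) (Seq s' t') (bhcomp B \<beta> \<alpha>)"

text \<open>A marked path is a path with one mark (objects) or two marks (horizontal arrows).\<close>

type_synonym ('o, 'a) mpath1 = "('o \<times> 'a list) \<times> nat"
type_synonym ('o, 'a) mpath2 = "('o \<times> 'a list) \<times> nat \<times> nat"

definition marked1 :: "('o, 'a, 'c) bicat \<Rightarrow> ('o, 'a) mpath1 set" where
  "marked1 B = {(p, i). bpath B p \<and> i \<le> length (snd p)}"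

definition marked2 :: "('o, 'a, 'c) bicat \<Rightarrow> ('o, 'a) mpath2 set" where
  "marked2 B = {(p, i, j). bpath B p \<and> i \<le> j \<and> j \<le> length (snd p)}"

definition mark0 :: "('o, 'a) mpath2 \<Rightarrow> ('o, 'a) mpath1" where
  "mark0 = (\<lambda>(p, i, j). (p, i))"

definition mark1 :: "('o, 'a) mpath2 \<Rightarrow> ('o, 'a) mpath1" where
  "mark1 = (\<lambda>(p, i, j). (p, j))"

definition mobj :: "('o, 'a, 'c) bicat \<Rightarrow> ('o, 'a) mpath1 \<Rightarrow> 'o" where
  "mobj B = (\<lambda>(p, i). vertex (btgt B) p i)"

text \<open>The chosen bracketing of, and the chosen composite along, the part between the marks.\<close>

definition mword :: "('o, 'a, 'c) bicat \<Rightarrow> ('o \<times> 'a list \<Rightarrow> ('o, 'a) word) \<Rightarrow>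
    ('o, 'a) mpath2 \<Rightarrow> ('o, 'a) word" where
  "mword B br = (\<lambda>(p, i, j). br (segment (btgt B) p i j))"

definition mcomp :: "('o, 'a, 'c) bicat \<Rightarrow> ('o \<times> 'a list \<Rightarrow> ('o, 'a) word) \<Rightarrow>
    ('o, 'a) mpath2 \<Rightarrow> 'a" where
  "mcomp B br h = eval_word B (mword B br h)"

definition hor_concat :: "('o, 'a) mpath2 \<times> ('o, 'a) mpath2 \<Rightarrow> ('o, 'a) mpath2" where
  "hor_concat = (\<lambda>((p, i0, i1), (_, _, i2)). (p, i0, i2))"

text \<open>The comparison 2-cell from the composite of the chosen composites of two consecutive
  parts to the chosen composite of the concatenation, and its inverse.\<close>

definition Phi :: "('o, 'a, 'c) bicat \<Rightarrow> ('o \<times> 'a list \<Rightarrow> ('o, 'a) word) \<Rightarrow>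
    ('o, 'a) mpath2 \<times> ('o, 'a) mpath2 \<Rightarrow> 'c" where
  "Phi B br hh = (THE \<alpha>. coherence B (Seq (mword B br (fst hh)) (mword B br (snd hh)))
     (mword B br (hor_concat hh)) \<alpha>)"

definition Phi_inv :: "('o, 'a, 'c) bicat \<Rightarrow> ('o \<times> 'a list \<Rightarrow> ('o, 'a) word) \<Rightarrow>
    ('o, 'a) mpath2 \<times> ('o, 'a) mpath2 \<Rightarrow> 'c" where
  "Phi_inv B br hh = (THE \<beta>. inverse_cells B (Phi B br hh) \<beta>)"

text \<open>A vertical arrow is the pair of its end points. A double cell \<open>(h, \<alpha>, k)\<close> consists of its top
  \<open>h\<close>, its bottom \<open>k\<close> and the 2-cell \<open>\<alpha>\<close>.\<close>

type_synonym ('o, 'a) mver = "('o, 'a) mpath1 \<times> ('o, 'a) mpath1"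
type_synonym ('o, 'a, 'c) mcell = "('o, 'a) mpath2 \<times> 'c \<times> ('o, 'a) mpath2"

definition Dbl_X0 :: "('o, 'a, 'c) bicat \<Rightarrow> (('o, 'a) mpath1, ('o, 'a) mver) cat" where
  "Dbl_X0 B = \<lparr>Obj = marked1 B,
     Arr = {(x, y). x \<in> marked1 B \<and> y \<in> marked1 B \<and> mobj B x = mobj B y},
     src = fst, tgt = snd, idn = \<lambda>x. (x, x), cmp = \<lambda>(_, z) (x, _). (x, z)\<rparr>"

definition Dbl_X1 :: "('o, 'a, 'c) bicat \<Rightarrow> ('o \<times> 'a list \<Rightarrow> ('o, 'a) word) \<Rightarrow>
    (('o, 'a) mpath2, ('o, 'a, 'c) mcell) cat" where
  "Dbl_X1 B br = \<lparr>Obj = marked2 B,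
     Arr = {(h, \<alpha>, k). h \<in> marked2 B \<and> k \<in> marked2 B \<and>
        mobj B (mark0 h) = mobj B (mark0 k) \<and> mobj B (mark1 h) = mobj B (mark1 k) \<and>
        \<alpha> \<in> BCell B \<and> bdom B \<alpha> = mcomp B br h \<and> bcod B \<alpha> = mcomp B br k},
     src = \<lambda>(h, \<alpha>, k). h, tgt = \<lambda>(h, \<alpha>, k). k,
     idn = \<lambda>h. (h, bcid B (mcomp B br h), h),
     cmp = \<lambda>(_, \<beta>, l) (h, \<alpha>, _). (h, bvcomp B \<beta> \<alpha>, l)\<rparr>"

definition Dbl_hcomp :: "('o, 'a, 'c) bicat \<Rightarrow> ('o \<times> 'a list \<Rightarrow> ('o, 'a) word) \<Rightarrow>
    ('o, 'a, 'c) mcell \<times> ('o, 'a, 'c) mcell \<Rightarrow> ('o, 'a, 'c) mcell" where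
  "Dbl_hcomp B br = (\<lambda>((h, \<alpha>, k), (h', \<beta>, k')). (hor_concat (h, h'),
     bvcomp B (Phi B br (k, k')) (bvcomp B (bhcomp B \<beta> \<alpha>) (Phi_inv B br (h, h'))),
     hor_concat (k, k')))"

definition Dbl :: "('o, 'a, 'c) bicat \<Rightarrow> ('o \<times> 'a list \<Rightarrow> ('o, 'a) word) \<Rightarrow>
    (('o, 'a) mpath1, ('o, 'a) mver, ('o, 'a) mpath2, ('o, 'a, 'c) mcell) dblcat" where
  "Dbl B br = \<lparr>X0 = Dbl_X0 B, X1 = Dbl_X1 B br,
     d0 = \<lparr>fob = mark0, far = \<lambda>(h, \<alpha>, k). (mark0 h, mark0 k)\<rparr>,
     d1 = \<lparr>fob = mark1, far = \<lambda>(h, \<alpha>, k). (mark1 h, mark1 k)\<rparr>,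
     hid = \<lparr>fob = \<lambda>(p, i). (p, i, i),
           far = \<lambda>((p, i), (q, j)).
             ((p, i, i), bcid B (bid B (vertex (btgt B) p i)), (q, j, j))\<rparr>,
     hm = \<lparr>fob = hor_concat, far = Dbl_hcomp B br\<rparr>\<rparr>"

end

theory Submission
  imports Defs
begin

text \<open>Both double categories are locally indiscrete: any two objects, horizontal arrows or composable
  strings are joined by at most one invertible vertical arrow or cell, and they are joined exactly
  if they have the same image in the category of fractions \<open>L\<close>. Hence every diagram of vertical
  arrows commutes, and two double categories of this kind over the same \<open>L\<close> are equivalent as soon
  as all strings of arrows of \<open>L\<close> lift to both of them: choose a lift of the image of every string.
  Weak globularity is the same lifting property. To avoid a quotient construction, an arrow of
  \<open>L\<close> is realised as a relation on generalised elements, namely the saturation of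
  \<open>w s \<mapsto> f s\<close> for a span \<open>(w, f)\<close>.\<close>

section \<open>Kernel groupoids\<close>

text \<open>Why strings and not just arrows of \<open>L\<close> have to lift: objects of
  \<open>C{W}\<close> are arrows of \<open>W\<close> and objects of \<open>Dbl\<close> are marked
  paths, so two lifted arrows whose ends agree in \<open>L\<close> are in general not composable on
  the nose. The lifts chosen at different levels of the nerve do not commute with faces and
  degeneracies; the defect is a vertical arrow over an identity, which is exactly the freedom that
  pseudo-naturality grants. That images in \<open>L\<close> decide the existence of cells is where
  the calculus of fractions enters: an Ore square supplies a candidate that satisfies its equations
  only after composition with an arrow of \<open>W\<close>, and CF3 refines it until the equations
  themselves hold. Two features of the definitions shape the rest. The operations of
  \<open>C{W}\<close> are unions over all choices, so each must be shown to range over a nonempty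
  family with a single value. The cells \<open>Phi\<close> are given by an inductive predicate, so
  besides uniqueness an actual coherence cell has to be derived.\<close>

definition graph_map :: "('o, 'a) cat \<Rightarrow> ('p, 'b) cat \<Rightarrow> ('o, 'a, 'p, 'b) ftr \<Rightarrow> bool" where
  "graph_map D K F \<longleftrightarrow> (\<forall>a \<in> Obj D. fob F a \<in> Obj K) \<and>
     (\<forall>f \<in> Arr D. far F f \<in> hom K (fob F (src D f)) (fob F (tgt D f)))"

lemma graph_map_ob: "graph_map D K F \<Longrightarrow> a \<in> Obj D \<Longrightarrow> fob F a \<in> Obj K"
  and graph_map_ar: "graph_map D K F \<Longrightarrow> f \<in> Arr D \<Longrightarrow> far F f \<in> Arr K"
  and graph_map_src: "graph_map D K F \<Longrightarrow> f \<in> Arr D \<Longrightarrow> src K (far F f) = fob F (src D f)"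
  and graph_map_tgt: "graph_map D K F \<Longrightarrow> f \<in> Arr D \<Longrightarrow> tgt K (far F f) = fob F (tgt D f)"
  by (auto simp: graph_map_def hom_def)

lemma graph_map_comp: "graph_map D K F \<Longrightarrow> graph_map K M G \<Longrightarrow> graph_map D M (comp_ftr G F)"
  by (auto simp: graph_map_def hom_def comp_ftr_def)

lemma graph_map_id: "graph_map D D id_ftr"
  if "\<And>f. f \<in> Arr D \<Longrightarrow> src D f \<in> Obj D \<and> tgt D f \<in> Obj D"
  using that by (auto simp: graph_map_def hom_def id_ftr_def)

text \<open>\<open>K\<close> is the groupoid of the equivalence relation \<open>p a = p b\<close>: all diagrams in it commute.\<close>

locale kernel_groupoid =
  fixes K :: "('o, 'a) cat" (structure) and p :: "'o \<Rightarrow> 'l"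
  assumes src_ob: "f \<in> Arr K \<Longrightarrow> src K f \<in> Obj K"
    and tgt_ob: "f \<in> Arr K \<Longrightarrow> tgt K f \<in> Obj K"
    and arr_eq: "f \<in> Arr K \<Longrightarrow> p (src K f) = p (tgt K f)"
    and arr_ex: "a \<in> Obj K \<Longrightarrow> b \<in> Obj K \<Longrightarrow> p a = p b \<Longrightarrow> \<exists>f. f \<in> hom K a b"
    and arr_unique: "f \<in> Arr K \<Longrightarrow> g \<in> Arr K \<Longrightarrow> src K f = src K g \<Longrightarrow> tgt K f = tgt K g \<Longrightarrow> f = g"
    and idn_hom: "a \<in> Obj K \<Longrightarrow> idn K a \<in> hom K a a"
    and cmp_hom: "f \<in> Arr K \<Longrightarrow> g \<in> Arr K \<Longrightarrow> src K g = tgt K f \<Longrightarrow>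
      g \<cdot> f \<in> hom K (src K f) (tgt K g)"

text \<open>A function of \<open>K\<close>, \<open>a\<close> and \<open>b\<close>, so that one
  formula covers a whole family of categories such as the levels of a nerve. Meaningful when
  \<open>a\<close> and \<open>b\<close> have the same image.\<close>

definition arrow :: "('o, 'a) cat \<Rightarrow> 'o \<Rightarrow> 'o \<Rightarrow> 'a" where
  "arrow K a b = (THE f. f \<in> hom K a b)"

context kernel_groupoid
begin

lemma hom_unique: "f \<in> hom K a b \<Longrightarrow> g \<in> hom K a b \<Longrightarrow> f = g"
  using arr_unique by (auto simp: hom_def)

lemma cmp_hom': "f \<in> hom K a b \<Longrightarrow> g \<in> hom K b c \<Longrightarrow> g \<cdot> f \<in> hom K a c"
  using cmp_hom by (auto simp: hom_def)

lemma arrow_hom: "a \<in> Obj K \<Longrightarrow> b \<in> Obj K \<Longrightarrow> p a = p b \<Longrightarrow> arrow K a b \<in> hom K a b"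
  unfolding arrow_def by (rule theI') (use arr_ex hom_unique in blast)

lemma category: "category K"
proof
  show "h \<cdot> (g \<cdot> f) = (h \<cdot> g) \<cdot> f"
    if "f \<in> hom K a b" "g \<in> hom K b c" "h \<in> hom K c d" for f g h a b c d
    using that by (meson cmp_hom' hom_unique)
  show "f \<cdot> idn K a = f" "idn K b \<cdot> f = f" if "f \<in> hom K a b" for f a b
    using that cmp_hom'[of "idn K a" a a f b] cmp_hom'[of f a b "idn K b" b] idn_hom[of a] idn_hom[of b]
      src_ob[of f] tgt_ob[of f] by (auto intro: hom_unique simp: hom_def)
qed (auto simp: src_ob tgt_ob idn_hom intro: cmp_hom')

text \<open>Equality of images is symmetric, so there is an arrow back; both composites are
  endomorphisms and hence identities.\<close>

lemma is_iso: "f \<in> Arr K \<Longrightarrow> is_iso K f"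
proof -
  assume f: "f \<in> Arr K"
  then obtain g where g: "g \<in> hom K (tgt K f) (src K f)"
    using arr_ex arr_eq src_ob tgt_ob by metis
  have f': "f \<in> hom K (src K f) (tgt K f)"
    using f by (simp add: hom_def)
  have "g \<cdot> f = idn K (src K f)" "f \<cdot> g = idn K (tgt K f)"
    using cmp_hom'[OF f' g] cmp_hom'[OF g f'] idn_hom src_ob tgt_ob f hom_unique by blast+
  then show ?thesis
    unfolding is_iso_def using f g by blast
qed

text \<open>The functor laws are equations between parallel arrows of \<open>K\<close> and hold by
  uniqueness. This is why maps are only asked to be graph maps. The conditions on \<open>D\<close>
  say merely that its identities and composites have the expected ends.\<close>

lemma functorI:
  assumes "graph_map D K F"
    and "\<And>a. a \<in> Obj D \<Longrightarrow> idn D a \<in> hom D a a"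
    and "\<And>f g. f \<in> Arr D \<Longrightarrow> g \<in> Arr D \<Longrightarrow> src D g = tgt D f \<Longrightarrow>
      g \<cdot>\<^bsub>D\<^esub> f \<in> hom D (src D f) (tgt D g)"
  shows "is_functor D K F"
  unfolding is_functor_def
proof (intro conjI ballI impI)
  note F = graph_map_ob[OF assms(1)] graph_map_ar[OF assms(1)] graph_map_src[OF assms(1)] graph_map_tgt[OF assms(1)]
  show "fob F a \<in> Obj K" if "a \<in> Obj D" for a
    using F that by blast
  show "far F f \<in> hom K (fob F (src D f)) (fob F (tgt D f))" if "f \<in> Arr D" for f
    using F that by (simp add: hom_def)
  show "far F (idn D a) = idn K (fob F a)" if "a \<in> Obj D" for a
    using F idn_hom[of "fob F a"] assms(2)[OF that] that by (intro arr_unique) (auto simp: hom_def)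
  show "far F (g \<cdot>\<^bsub>D\<^esub> f) = far F g \<cdot> far F f"
    if "f \<in> Arr D" "g \<in> Arr D" "src D g = tgt D f" for f g
    using F cmp_hom[of "far F f" "far F g"] assms(3)[OF that] that by (intro arr_unique) (auto simp: hom_def)
qed

text \<open>Each naturality square consists of parallel arrows and each component is invertible, so
  only the ends of the components matter.\<close>

lemma nat_isoI:
  assumes F: "graph_map D K F" and G: "graph_map D K G"
    and D: "\<And>f. f \<in> Arr D \<Longrightarrow> src D f \<in> Obj D" "\<And>f. f \<in> Arr D \<Longrightarrow> tgt D f \<in> Obj D"
    and t: "\<And>a. a \<in> Obj D \<Longrightarrow> \<tau> a \<in> hom K (fob F a) (fob G a)"
  shows "nat_iso D K F G \<tau>"
  unfolding nat_iso_def nat_trans_def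
proof (intro conjI ballI)
  show "far G f \<cdot> \<tau> (src D f) = \<tau> (tgt D f) \<cdot> far F f" if f: "f \<in> Arr D" for f
  proof (rule hom_unique)
    show "far G f \<cdot> \<tau> (src D f) \<in> hom K (fob F (src D f)) (fob G (tgt D f))"
      using G f t D by (intro cmp_hom'[of _ _ "fob G (src D f)"]) (auto simp: graph_map_def)
    show "\<tau> (tgt D f) \<cdot> far F f \<in> hom K (fob F (src D f)) (fob G (tgt D f))"
      using F f t D by (intro cmp_hom'[of _ _ "fob F (tgt D f)"]) (auto simp: graph_map_def)
  qed
  show "is_iso K (\<tau> a)" if "a \<in> Obj D" for a
    using t[OF that] is_iso by (auto simp: hom_def)
qed (rule t)

lemma graph_map_arrow:
  assumes D: "\<And>f. f \<in> Arr D \<Longrightarrow> src D f \<in> Obj D" "\<And>f. f \<in> Arr D \<Longrightarrow> tgt D f \<in> Obj D"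
    and "\<And>a. a \<in> Obj D \<Longrightarrow> \<phi> a \<in> Obj K"
    and "\<And>f. f \<in> Arr D \<Longrightarrow> p (\<phi> (src D f)) = p (\<phi> (tgt D f))"
  shows "graph_map D K \<lparr>fob = \<phi>, far = \<lambda>f. arrow K (\<phi> (src D f)) (\<phi> (tgt D f))\<rparr>"
  unfolding graph_map_def using assms arrow_hom by auto

text \<open>The zigzags add nothing: images are constant along them, and conversely two objects with
  the same image are joined by a single arrow.\<close>

lemma path_component_eq:
  assumes a: "a \<in> Obj K"
  shows "path_component K a = {b \<in> Obj K. p b = p a}" (is "_ = ?R")
proof
  have "b \<in> ?R" if "(a, b) \<in> ({(src K f, tgt K f) |f. f \<in> Arr K} \<union> {(tgt K f, src K f) |f. f \<in> Arr K})\<^sup>*" for b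
    using that by (induction rule: rtrancl_induct) (auto simp: a src_ob tgt_ob arr_eq)
  then show "path_component K a \<subseteq> ?R"
    unfolding path_component_def by blast
  show "?R \<subseteq> path_component K a"
  proof
    fix b assume "b \<in> ?R"
    then obtain f where "f \<in> hom K a b"
      using arr_ex[of a b] a by auto
    then show "b \<in> path_component K a"
      unfolding path_component_def by (auto simp: hom_def intro!: r_into_rtrancl)
  qed
qed

lemma path_component_eq_iff:
  "a \<in> Obj K \<Longrightarrow> b \<in> Obj K \<Longrightarrow> path_component K a = path_component K b \<longleftrightarrow> p a = p b"
  using path_component_eq by auto

end

section \<open>Equivalences and fibre products of kernel groupoids\<close>

lemma kernel_groupoid_discrete: "kernel_groupoid (discrete S) (\<lambda>a. a)"
  by unfold_locales (auto simp: discrete_def hom_def)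

lemma (in kernel_groupoid) graph_map_gamma: "graph_map K (components K) (gamma K)"
  unfolding graph_map_def components_def gamma_def discrete_def hom_def
  using path_component_eq_iff src_ob tgt_ob arr_eq by auto

text \<open>A kernel groupoid is determined up to equivalence by the set of images of its objects.
  Here \<open>inj\<close> makes \<open>F\<close> full, faithfulness is automatic, and
  \<open>onto\<close> is essential surjectivity; the inverse picks a preimage of each
  object.\<close>

lemma equivalence_of_kernel_groupoids:
  assumes "kernel_groupoid D q" and "kernel_groupoid K p" and F: "graph_map D K F"
    and inj: "\<And>a b. a \<in> Obj D \<Longrightarrow> b \<in> Obj D \<Longrightarrow> p (fob F a) = p (fob F b) \<Longrightarrow> q a = q b"
    and onto: "\<And>x. x \<in> Obj K \<Longrightarrow> \<exists>a \<in> Obj D. p (fob F a) = p x"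
  shows "equivalence_of_categories D K F"
proof -
  interpret D: kernel_groupoid D q by fact
  interpret K: kernel_groupoid K p by fact
  define g where "g x = (SOME a. a \<in> Obj D \<and> p (fob F a) = p x)" for x
  have g: "g x \<in> Obj D" "p (fob F (g x)) = p x" if "x \<in> Obj K" for x
    using someI_ex[of "\<lambda>a. a \<in> Obj D \<and> p (fob F a) = p x"] onto[OF that] unfolding g_def by blast+
  define G where "G = \<lparr>fob = g, far = \<lambda>f. arrow D (g (src K f)) (g (tgt K f))\<rparr>"
  have G: "graph_map K D G"
    unfolding G_def using inj g K.src_ob K.tgt_ob K.arr_eq
    by (intro D.graph_map_arrow) (auto intro!: inj)
  note id = graph_map_id[of D] graph_map_id[of K]
  have "is_functor D K F" "is_functor K D G"
    using F G D.idn_hom D.cmp_hom K.idn_hom K.cmp_hom by (auto intro!: K.functorI D.functorI)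
  moreover have "nat_iso D D id_ftr (comp_ftr G F) (\<lambda>a. arrow D a (g (fob F a)))"
    using g graph_map_ob[OF F] D.src_ob D.tgt_ob
    by (intro D.nat_isoI graph_map_comp[OF F G] id)
      (auto simp: G_def comp_ftr_def id_ftr_def intro!: D.arrow_hom inj)
  moreover have "nat_iso K K (comp_ftr F G) id_ftr (\<lambda>a. arrow K (fob F (g a)) a)"
    using g graph_map_ob[OF F] K.src_ob K.tgt_ob
    by (intro K.nat_isoI graph_map_comp[OF G F] id)
      (auto simp: G_def comp_ftr_def id_ftr_def intro!: K.arrow_hom)
  ultimately show ?thesis
    unfolding equivalence_of_categories_def by blast
qed

lemma (in kernel_groupoid) gamma_equivalence:
  "equivalence_of_categories K (components K) (gamma K)"
proof (rule equivalence_of_kernel_groupoids)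
  show "kernel_groupoid K p"
    by (rule kernel_groupoid_axioms)
  show "kernel_groupoid (components K) (\<lambda>a. a)"
    unfolding components_def by (rule kernel_groupoid_discrete)
qed (use graph_map_gamma path_component_eq_iff in \<open>auto simp: gamma_def components_def discrete_def\<close>)

text \<open>Arrows between composable lists can be chosen entry by entry: the two arrows of
  \<open>B\<close> that must match at a joint have the same ends, since the lists match there, and
  parallel arrows of \<open>B\<close> are equal. The base is arbitrary because both
  \<open>X0\<close> and its discrete category of components are needed.\<close>

lemma fibre_power_kernel_groupoid:
  assumes "kernel_groupoid K p" and "kernel_groupoid B r"
    and s: "graph_map K B s" and t: "graph_map K B t"
  shows "kernel_groupoid (fibre_power K s t n) (map p)"
proof -
  interpret K: kernel_groupoid K p by fact
  interpret B: kernel_groupoid B r by fact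
  note st = graph_map_ar[OF s] graph_map_src[OF s] graph_map_tgt[OF s]
    graph_map_ar[OF t] graph_map_src[OF t] graph_map_tgt[OF t]
  note nth = successively_conv_nth all_set_conv_all_nth subset_eq
  have ob: "hs \<in> Obj (fibre_power K s t n) \<longleftrightarrow> length hs = n \<and> (\<forall>i < n. hs ! i \<in> Obj K) \<and>
      (\<forall>i. Suc i < n \<longrightarrow> fob t (hs ! i) = fob s (hs ! Suc i))" for hs
    unfolding fibre_power_def by (auto simp: nth)
  have ar: "cs \<in> Arr (fibre_power K s t n) \<longleftrightarrow> length cs = n \<and> (\<forall>i < n. cs ! i \<in> Arr K) \<and>
      (\<forall>i. Suc i < n \<longrightarrow> far t (cs ! i) = far s (cs ! Suc i))" for cs
    unfolding fibre_power_def by (auto simp: nth)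
  have sel: "src (fibre_power K s t n) = map (src K)" "tgt (fibre_power K s t n) = map (tgt K)"
    "idn (fibre_power K s t n) = map (idn K)" "cmp (fibre_power K s t n) = map2 (cmp K)"
    by (simp_all add: fibre_power_def)
  show ?thesis
  proof (unfold_locales, goal_cases)
    case (1 f)
    have "fob t (src K (f ! i)) = fob s (src K (f ! Suc i))" if "Suc i < n" for i
      using 1 that st(2)[of "f ! Suc i"] st(5)[of "f ! i"] by (auto simp: ar)
    then show ?case using 1 by (auto simp: ob ar sel K.src_ob)
  next
    case (2 f)
    have "fob t (tgt K (f ! i)) = fob s (tgt K (f ! Suc i))" if "Suc i < n" for i
      using 2 that st(3)[of "f ! Suc i"] st(6)[of "f ! i"] by (auto simp: ar)
    then show ?case using 2 by (auto simp: ob ar sel K.tgt_ob)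
  next
    case (3 f)
    then show ?case
      by (auto simp: ar sel in_set_conv_nth K.arr_eq intro!: nth_equalityI)
  next
    case (4 hs ks)
    have eq: "p (hs ! i) = p (ks ! i)" if "i < n" for i
      using 4 that by (metis ob nth_map)
    define cs where "cs = map2 (arrow K) hs ks"
    have cs: "length cs = n" "\<And>i. i < n \<Longrightarrow> cs ! i \<in> hom K (hs ! i) (ks ! i)"
      using 4 eq by (auto simp: cs_def ob intro!: K.arrow_hom)
    have "far t (cs ! i) = far s (cs ! Suc i)" if "Suc i < n" for i
      using 4 cs(2)[of i] cs(2)[of "Suc i"] that st
      by (intro B.arr_unique) (auto simp: hom_def ob)
    then have "cs \<in> hom (fibre_power K s t n) hs ks"
      using cs 4 by (auto simp: hom_def ar sel ob intro!: nth_equalityI)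
    then show ?case by blast
  next
    case (5 f g)
    have "f ! i = g ! i" if "i < n" for i
      using 5 that by (intro K.arr_unique) (auto simp: ar sel list_eq_iff_nth_eq)
    then show ?case
      using 5 by (auto simp: ar intro!: nth_equalityI)
  next
    case (6 hs)
    then have id: "idn K (hs ! i) \<in> hom K (hs ! i) (hs ! i)" if "i < n" for i
      using that K.idn_hom by (auto simp: ob)
    have "far t (idn K (hs ! i)) = far s (idn K (hs ! Suc i))" if "Suc i < n" for i
      using 6 id[of i] id[of "Suc i"] that st
      by (intro B.arr_unique) (auto simp: hom_def ob)
    then show ?case
      using 6 id by (auto simp: hom_def ar sel ob intro!: nth_equalityI)
  next
    case (7 f g)
    then have c: "g ! i \<cdot>\<^bsub>K\<^esub> f ! i \<in> hom K (src K (f ! i)) (tgt K (g ! i))" if "i < n" for i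
      using that by (intro K.cmp_hom) (auto simp: ar sel list_eq_iff_nth_eq)
    have "far t (g ! i \<cdot>\<^bsub>K\<^esub> f ! i) = far s (g ! Suc i \<cdot>\<^bsub>K\<^esub> f ! Suc i)" if "Suc i < n" for i
    proof -
      have "fob t (src K (f ! i)) = fob s (src K (f ! Suc i))"
        using 7 that st(2)[of "f ! Suc i"] st(5)[of "f ! i"] by (auto simp: ar)
      moreover have "fob t (tgt K (g ! i)) = fob s (tgt K (g ! Suc i))"
        using 7 that st(3)[of "g ! Suc i"] st(6)[of "g ! i"] by (auto simp: ar)
      ultimately show ?thesis
        using c[of i] c[of "Suc i"] that st
        by (intro B.arr_unique) (auto simp: hom_def)
    qed
    then show ?case
      using 7 c by (auto simp: hom_def ar sel intro!: nth_equalityI)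
  qed
qed


section \<open>Strings of arrows\<close>

text \<open>The \<open>k\<close>-simplices of the nerve of \<open>K\<close>; the starting object is
  kept so that \<open>k = 0\<close> gives the objects.\<close>

definition strings :: "('o, 'a) cat \<Rightarrow> nat \<Rightarrow> ('o \<times> 'a list) set" where
  "strings K k = {p. is_path (Obj K) (Arr K) (src K) (tgt K) p \<and> length (snd p) = k}"

text \<open>In nerve terms, the edge of the simplex \<open>p\<close> from vertex \<open>i\<close> to
  vertex \<open>j\<close>.\<close>

definition seg_comp :: "('o, 'a) cat \<Rightarrow> 'o \<times> 'a list \<Rightarrow> nat \<Rightarrow> nat \<Rightarrow> 'a" where
  "seg_comp K p i j = path_comp K (segment (tgt K) p i j)"

lemma vertex_0: "vertex t p 0 = fst p"
  and vertex_Suc: "vertex t p (Suc i) = t (snd p ! i)"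
  by (simp_all add: vertex_def)

text \<open>\<open>vertex\<close> is the starting object at 0 and a target afterwards, so the
  condition on the head and the matching of neighbours merge into one condition per index.\<close>

lemma is_path_iff:
  "is_path Os As s t p \<longleftrightarrow> fst p \<in> Os \<and>
     (\<forall>i < length (snd p). snd p ! i \<in> As \<and> s (snd p ! i) = vertex t p i)"
proof (cases p)
  case (Pair a fs)
  have "(fs \<noteq> [] \<longrightarrow> s (hd fs) = a) \<and> (\<forall>i. Suc i < length fs \<longrightarrow> t (fs ! i) = s (fs ! Suc i)) \<longleftrightarrow>
      (\<forall>i < length fs. s (fs ! i) = vertex t p i)" (is "?l \<longleftrightarrow> ?r")
  proof
    show ?r if ?l
    proof (intro allI impI)
      show "s (fs ! i) = vertex t p i" if "i < length fs" for i
        using \<open>?l\<close> that by (cases i) (auto simp: vertex_def Pair hd_conv_nth)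
    qed
    show ?l if ?r
      using that by (force simp: vertex_def Pair hd_conv_nth)
  qed
  then show ?thesis
    unfolding is_path_def by (auto simp: Pair successively_conv_nth all_set_conv_all_nth subset_eq)
qed

lemma Delta_nth:
  assumes "\<theta> \<in> Delta m k"
  shows "length \<theta> = Suc m" and "i \<le> m \<Longrightarrow> \<theta> ! i \<le> k" and "i \<le> j \<Longrightarrow> j \<le> m \<Longrightarrow> \<theta> ! i \<le> \<theta> ! j"
  using assms unfolding Delta_def by (auto simp: sorted_nth_mono subset_eq)

lemma Delta_comp_in: "\<phi> \<in> Delta l m \<Longrightarrow> \<theta> \<in> Delta m k \<Longrightarrow> Delta_comp \<theta> \<phi> \<in> Delta l k"
  using Delta_nth[of \<phi> l m] Delta_nth[of \<theta> m k]
  unfolding Delta_comp_def Delta_def[of l k]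
  by (auto simp: sorted_iff_nth_mono in_set_conv_nth)

lemma Delta_id_in: "Delta_id k \<in> Delta k k"
  by (auto simp: Delta_id_def Delta_def simp del: upt_Suc)

locale string_in = category K for K :: "('o, 'a) cat" (structure) +
  fixes p :: "'o \<times> 'a list" and k :: nat
  assumes p: "p \<in> strings K k"
begin

abbreviation v where "v \<equiv> vertex (tgt K) p"

lemma length_p: "length (snd p) = k"
  using p by (simp add: strings_def)

lemma fst_p: "fst p \<in> Obj K"
  using p by (simp add: strings_def is_path_iff)

lemma nth_hom: "i < k \<Longrightarrow> snd p ! i \<in> hom K (v i) (v (Suc i))"
  using p by (auto simp: strings_def is_path_iff hom_def vertex_Suc)

lemma v_ob: "i \<le> k \<Longrightarrow> v i \<in> Obj K"
  using fst_p nth_hom tgt_in by (cases i) (auto simp: vertex_0 vertex_Suc hom_def Suc_le_eq)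

lemma seg_comp_refl: "i \<le> k \<Longrightarrow> seg_comp K p i i = idn K (v i)"
  by (simp add: seg_comp_def segment_def path_comp_def)

lemma seg_comp_Suc: "i \<le> j \<Longrightarrow> j < k \<Longrightarrow> seg_comp K p i (Suc j) = snd p ! j \<cdot> seg_comp K p i j"
  by (simp add: seg_comp_def segment_def path_comp_def take_Suc_conv_app_nth length_p)

lemma seg_comp_hom: "i \<le> j \<Longrightarrow> j \<le> k \<Longrightarrow> seg_comp K p i j \<in> hom K (v i) (v j)"
proof (induction j rule: dec_induct)
  case base
  then show ?case by (simp add: seg_comp_refl idn_in v_ob)
next
  case (step j)
  then have "snd p ! j \<cdot> seg_comp K p i j \<in> hom K (v i) (v (Suc j))"
    by (intro cmp_in[of _ _ "v j"] nth_hom) auto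
  with step show ?case by (simp add: seg_comp_Suc)
qed

text \<open>The triangle law for edges, from which the composition law for simplicial operators
  follows.\<close>

lemma seg_comp_trans:
  assumes "i \<le> j"
  shows "j \<le> l \<Longrightarrow> l \<le> k \<Longrightarrow> seg_comp K p i l = seg_comp K p j l \<cdot> seg_comp K p i j"
proof (induction l rule: dec_induct)
  case base
  then show ?case
    using assms idn_left[OF seg_comp_hom[of i j]] by (simp add: seg_comp_refl)
next
  case (step l)
  then show ?case
    using assms cmp_assoc[OF seg_comp_hom[of i j] seg_comp_hom[of j l] nth_hom[of l]]
    by (simp add: seg_comp_Suc)
qed

lemma seg_comp_step: "i < k \<Longrightarrow> seg_comp K p i (Suc i) = snd p ! i"
  using idn_right[OF nth_hom[of i]] by (simp add: seg_comp_Suc seg_comp_refl)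

context
  fixes \<theta> m assumes \<theta>: "\<theta> \<in> Delta m k"
begin

lemma nth_string_act: "i < m \<Longrightarrow> snd (string_act K \<theta> p) ! i = seg_comp K p (\<theta> ! i) (\<theta> ! Suc i)"
  using Delta_nth[OF \<theta>] by (simp add: string_act_def seg_comp_def)

lemma vertex_string_act: "i \<le> m \<Longrightarrow> vertex (tgt K) (string_act K \<theta> p) i = v (\<theta> ! i)"
proof (cases i)
  case 0
  then show ?thesis by (simp add: vertex_0 string_act_def)
next
  case (Suc j)
  then show "i \<le> m \<Longrightarrow> ?thesis"
    using seg_comp_hom[of "\<theta> ! j" "\<theta> ! Suc j"] Delta_nth[OF \<theta>]
    by (simp add: vertex_Suc nth_string_act hom_def)
qed

lemma string_act_in: "string_act K \<theta> p \<in> strings K m"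
proof -
  have "snd (string_act K \<theta> p) ! i \<in> hom K (v (\<theta> ! i)) (v (\<theta> ! Suc i))" if "i < m" for i
    using that seg_comp_hom[of "\<theta> ! i" "\<theta> ! Suc i"] Delta_nth[OF \<theta>] by (simp add: nth_string_act)
  moreover have "length (snd (string_act K \<theta> p)) = m"
    using Delta_nth[OF \<theta>] by (simp add: string_act_def)
  moreover have "fst (string_act K \<theta> p) \<in> Obj K"
    using Delta_nth[OF \<theta>] v_ob[of "\<theta> ! 0"] by (simp add: string_act_def)
  ultimately show ?thesis
    by (auto simp: strings_def is_path_iff hom_def vertex_string_act)
qed

text \<open>An edge of \<open>string_act K \<theta> p\<close> is a chain of edges of
  \<open>p\<close> that telescopes.\<close>

lemma seg_comp_string_act:
  assumes "i \<le> j" "j \<le> m"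
  shows "seg_comp K (string_act K \<theta> p) i j = seg_comp K p (\<theta> ! i) (\<theta> ! j)"
proof -
  interpret q: string_in K "string_act K \<theta> p" m
    by unfold_locales (rule string_act_in)
  show ?thesis
    using assms
  proof (induction j rule: dec_induct)
    case base
    then show ?case
      using Delta_nth[OF \<theta>] by (simp add: q.seg_comp_refl seg_comp_refl vertex_string_act)
  next
    case (step j)
    then show ?case
      using Delta_nth[OF \<theta>] seg_comp_trans[of "\<theta> ! i" "\<theta> ! j" "\<theta> ! Suc j"]
      by (simp add: q.seg_comp_Suc nth_string_act)
  qed
qed

end

text \<open>A string is determined by its first vertex and its edges between neighbours, and both
  sides read these off \<open>p\<close> at the positions
  \<open>\<theta> ! (\<phi> ! i)\<close>.\<close>

lemma string_act_comp:
  assumes "\<phi> \<in> Delta l m" and "\<theta> \<in> Delta m k"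
  shows "string_act K (Delta_comp \<theta> \<phi>) p = string_act K \<phi> (string_act K \<theta> p)"
proof -
  note D = Delta_nth[OF assms(1)] Delta_nth[OF assms(2)]
  interpret q: string_in K "string_act K \<theta> p" m
    by unfold_locales (rule string_act_in[OF assms(2)])
  interpret q': string_in K "string_act K \<phi> (string_act K \<theta> p)" l
    by unfold_locales (rule q.string_act_in[OF assms(1)])
  interpret q'': string_in K "string_act K (Delta_comp \<theta> \<phi>) p" l
    by unfold_locales (rule string_act_in[OF Delta_comp_in[OF assms]])
  have nth: "Delta_comp \<theta> \<phi> ! i = \<theta> ! (\<phi> ! i)" if "i \<le> l" for i
    using D that by (simp add: Delta_comp_def)
  show ?thesis
  proof (rule prod_eqI)
    show "fst (string_act K (Delta_comp \<theta> \<phi>) p) = fst (string_act K \<phi> (string_act K \<theta> p))"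
      using D vertex_string_act[OF assms(2), of "\<phi> ! 0"]
      by (simp add: string_act_def nth)
    show "snd (string_act K (Delta_comp \<theta> \<phi>) p) = snd (string_act K \<phi> (string_act K \<theta> p))"
      by (rule nth_equalityI)
        (use D in \<open>auto simp: q'.length_p q''.length_p nth_string_act[OF Delta_comp_in[OF assms]]
          q.nth_string_act[OF assms(1)] seg_comp_string_act[OF assms(2)] nth\<close>)
  qed
qed

lemma string_act_id: "string_act K (Delta_id k) p = p"
proof (rule prod_eqI)
  have nth: "Delta_id k ! i = i" if "i \<le> k" for i
    using that by (simp add: Delta_id_def nth_append del: upt_Suc)
  show "fst (string_act K (Delta_id k) p) = fst p"
    using nth[of 0] by (simp add: string_act_def vertex_0)
  interpret q: string_in K "string_act K (Delta_id k) p" k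
    by unfold_locales (rule string_act_in[OF Delta_id_in])
  show "snd (string_act K (Delta_id k) p) = snd p"
    by (rule nth_equalityI)
      (auto simp: q.length_p length_p nth_string_act[OF Delta_id_in] nth seg_comp_step)
qed

text \<open>Functors commute with composites along segments. Applied below to the projection onto
  \<open>L\<close> and to the passage from cells to their tops and bottoms.\<close>

lemma
  assumes "category M" and F: "is_functor K M \<lparr>fob = \<phi>, far = \<psi>\<rparr>"
  shows strings_functor: "map_prod \<phi> (map \<psi>) p \<in> strings M k" (is "?F p \<in> _")
    and string_act_functor: "\<theta> \<in> Delta m k \<Longrightarrow>
      string_act M \<theta> (map_prod \<phi> (map \<psi>) p) = map_prod \<phi> (map \<psi>) (string_act K \<theta> p)"
proof -
  interpret M: category M by fact
  have F': "a \<in> Obj K \<Longrightarrow> \<phi> a \<in> Obj M" "f \<in> Arr K \<Longrightarrow> \<psi> f \<in> hom M (\<phi> (src K f)) (\<phi> (tgt K f))"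
    "a \<in> Obj K \<Longrightarrow> \<psi> (idn K a) = idn M (\<phi> a)"
    "f \<in> Arr K \<Longrightarrow> g \<in> Arr K \<Longrightarrow> src K g = tgt K f \<Longrightarrow> \<psi> (g \<cdot> f) = \<psi> g \<cdot>\<^bsub>M\<^esub> \<psi> f" for a f g
    using F by (auto simp: is_functor_def)
  have vF: "vertex (tgt M) (?F p) i = \<phi> (v i)" if "i \<le> k" for i
    using that F'(2) nth_hom[of "i - 1"] length_p by (cases i) (auto simp: vertex_def hom_def)
  show in_M: "?F p \<in> strings M k"
    using F' fst_p nth_hom length_p by (auto simp: strings_def is_path_iff vF hom_def)
  interpret q: string_in M "?F p" k
    by unfold_locales (rule in_M)
  have sF: "seg_comp M (?F p) i j = \<psi> (seg_comp K p i j)" if "i \<le> j" "j \<le> k" for i j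
    using that
  proof (induction j rule: dec_induct)
    case base
    then show ?case
      by (simp add: q.seg_comp_refl seg_comp_refl vF F' v_ob)
  next
    case (step j)
    then show ?case
      using F'(4)[of "seg_comp K p i j" "snd p ! j"] seg_comp_hom[of i j] nth_hom[of j]
      by (simp add: q.seg_comp_Suc seg_comp_Suc length_p hom_def)
  qed
  assume \<theta>: "\<theta> \<in> Delta m k"
  note D = Delta_nth[OF \<theta>]
  interpret r: string_in K "string_act K \<theta> p" m
    by unfold_locales (rule string_act_in[OF \<theta>])
  interpret r': string_in M "string_act M \<theta> (?F p)" m
    by unfold_locales (rule q.string_act_in[OF \<theta>])
  show "string_act M \<theta> (?F p) = ?F (string_act K \<theta> p)"
  proof (rule prod_eqI)
    show "fst (string_act M \<theta> (?F p)) = fst (?F (string_act K \<theta> p))"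
      using D vF[of "\<theta> ! 0"] by (simp add: string_act_def)
    show "snd (string_act M \<theta> (?F p)) = snd (?F (string_act K \<theta> p))"
      by (rule nth_equalityI)
        (use D in \<open>auto simp: r.length_p r'.length_p nth_string_act[OF \<theta>] q.nth_string_act[OF \<theta>] sF\<close>)
  qed
qed

end

section \<open>Levelwise kernel groupoids\<close>

text \<open>A simplicial category all of whose levels are kernel groupoids of a map \<open>\<pi>\<close> onto a
  simplicial set with levels \<open>Q k\<close> and structure maps \<open>A \<theta>\<close>.\<close>

locale kernel_scat =
  fixes S :: "('x, 'y) scat" and \<pi> :: "'x \<Rightarrow> 'q" and A :: "nat list \<Rightarrow> 'q \<Rightarrow> 'q" and Q :: "nat \<Rightarrow> 'q set"
  assumes level: "kernel_groupoid (lev S k) \<pi>"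
    and act: "\<theta> \<in> Delta m k \<Longrightarrow> graph_map (lev S k) (lev S m) (act S \<theta>)"
    and act_id: "x \<in> Obj (lev S k) \<Longrightarrow> fob (act S (Delta_id k)) x = x"
    and act_comp: "\<phi> \<in> Delta l m \<Longrightarrow> \<theta> \<in> Delta m k \<Longrightarrow> x \<in> Obj (lev S k) \<Longrightarrow>
      fob (act S (Delta_comp \<theta> \<phi>)) x = fob (act S \<phi>) (fob (act S \<theta>) x)"
    and act_map: "\<theta> \<in> Delta m k \<Longrightarrow> x \<in> Obj (lev S k) \<Longrightarrow> \<pi> (fob (act S \<theta>) x) = A \<theta> (\<pi> x)"
    and onto: "\<pi> ` Obj (lev S k) = Q k"

sublocale kernel_scat \<subseteq> lev: kernel_groupoid "lev S k" \<pi> for k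
  by (rule level)

text \<open>Pseudo-naturality stripped of its equations, as \<open>graph_map\<close> is
  functoriality stripped of its laws.\<close>

definition pstrans_data :: "('x, 'y) scat \<Rightarrow> ('z, 'w) scat \<Rightarrow> ('x, 'y, 'z, 'w) pstrans \<Rightarrow> bool" where
  "pstrans_data S T F \<longleftrightarrow> (\<forall>k. graph_map (lev S k) (lev T k) (pcmp F k)) \<and>
     (\<forall>m k. \<forall>\<theta> \<in> Delta m k. \<forall>x \<in> Obj (lev S k). pcoh F m k \<theta> x \<in>
        hom (lev T m) (fob (act T \<theta>) (fob (pcmp F k) x)) (fob (pcmp F m) (fob (act S \<theta>) x)))"

text \<open>Sharing \<open>A\<close> and \<open>Q\<close> puts both over the same simplicial set, so
  that an object of \<open>S\<close> and one of \<open>T\<close> can be compared by their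
  images.\<close>

locale kernel_scat_pair =
  S: kernel_scat S \<pi> A Q + T: kernel_scat T \<rho> A Q
  for S :: "('x, 'y) scat" and \<pi> :: "'x \<Rightarrow> 'q" and T :: "('z, 'w) scat" and \<rho> :: "'z \<Rightarrow> 'q" and A Q
begin

text \<open>All axioms equate arrows in a level of \<open>T\<close>, so agreement of ends suffices.
  The ends agree because \<open>S\<close> and \<open>T\<close> obey the simplicial identities
  strictly on objects (\<open>act_id\<close>, \<open>act_comp\<close>).\<close>

lemma pseudo_naturalI:
  assumes F: "pstrans_data S T F"
  shows "pseudo_natural S T F"
proof -
  have F1: "graph_map (lev S k) (lev T k) (pcmp F k)" for k
    using F by (simp add: pstrans_data_def)
  have F2: "pcoh F m k \<theta> x \<in>
      hom (lev T m) (fob (act T \<theta>) (fob (pcmp F k) x)) (fob (pcmp F m) (fob (act S \<theta>) x))"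
    if "\<theta> \<in> Delta m k" "x \<in> Obj (lev S k)" for m k \<theta> x
    using F that by (simp add: pstrans_data_def)
  note ob = graph_map_ob[OF F1] graph_map_ob[OF S.act]
  show ?thesis
    unfolding pseudo_natural_def
  proof (intro conjI allI ballI)
    show "is_functor (lev S k) (lev T k) (pcmp F k)" for k
      using F1 S.lev.idn_hom S.lev.cmp_hom by (intro T.lev.functorI) auto
    show "nat_iso (lev S k) (lev T m) (comp_ftr (act T \<theta>) (pcmp F k))
        (comp_ftr (pcmp F m) (act S \<theta>)) (pcoh F m k \<theta>)" if "\<theta> \<in> Delta m k" for m k \<theta>
      using that F2 S.lev.src_ob S.lev.tgt_ob
      by (intro T.lev.nat_isoI graph_map_comp[OF F1 T.act] graph_map_comp[OF S.act F1])
        (auto simp: comp_ftr_def)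
    show "pcoh F k k (Delta_id k) x = idn (lev T k) (fob (pcmp F k) x)" if "x \<in> Obj (lev S k)" for k x
      using F2[OF Delta_id_in that] T.lev.idn_hom that ob
      by (intro T.lev.hom_unique) (auto simp: S.act_id T.act_id)
    fix l m k \<phi> \<theta> x
    assume \<phi>: "\<phi> \<in> Delta l m" and \<theta>: "\<theta> \<in> Delta m k" and x: "x \<in> Obj (lev S k)"
    have "far (act T \<phi>) (pcoh F m k \<theta> x) \<in> hom (lev T l)
        (fob (act T \<phi>) (fob (act T \<theta>) (fob (pcmp F k) x))) (fob (act T \<phi>) (fob (pcmp F m) (fob (act S \<theta>) x)))"
      using T.act[OF \<phi>] F2[OF \<theta> x] by (auto simp: graph_map_def hom_def)
    moreover have "pcoh F l m \<phi> (fob (act S \<theta>) x) \<in> hom (lev T l)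
        (fob (act T \<phi>) (fob (pcmp F m) (fob (act S \<theta>) x))) (fob (pcmp F l) (fob (act S \<phi>) (fob (act S \<theta>) x)))"
      using F2[OF \<phi>] ob(2)[OF \<theta> x] by blast
    ultimately have "pcoh F l m \<phi> (fob (act S \<theta>) x) \<cdot>\<^bsub>lev T l\<^esub> far (act T \<phi>) (pcoh F m k \<theta> x) \<in> hom (lev T l)
        (fob (act T \<phi>) (fob (act T \<theta>) (fob (pcmp F k) x))) (fob (pcmp F l) (fob (act S \<phi>) (fob (act S \<theta>) x)))"
      by (rule T.lev.cmp_hom')
    then show "pcoh F l k (Delta_comp \<theta> \<phi>) x =
        pcoh F l m \<phi> (fob (act S \<theta>) x) \<cdot>\<^bsub>lev T l\<^esub> far (act T \<phi>) (pcoh F m k \<theta> x)"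
      using F2[OF Delta_comp_in[OF \<phi> \<theta>] x] ob(1)[OF x]
      by (intro T.lev.hom_unique) (auto simp: S.act_comp[OF \<phi> \<theta> x] T.act_comp[OF \<phi> \<theta>])
  qed
qed

lemma modification_arrow:
  assumes F: "pstrans_data S T F" and G: "pstrans_data S T G"
    and eq: "\<And>k x. x \<in> Obj (lev S k) \<Longrightarrow> \<rho> (fob (pcmp F k) x) = \<rho> (fob (pcmp G k) x)"
  shows "modification S T F G (\<lambda>k x. arrow (lev T k) (fob (pcmp F k) x) (fob (pcmp G k) x))"
proof -
  have F1: "graph_map (lev S k) (lev T k) (pcmp F k)" for k
    using F by (simp add: pstrans_data_def)
  have G1: "graph_map (lev S k) (lev T k) (pcmp G k)" for k
    using G by (simp add: pstrans_data_def)
  have arr: "arrow (lev T k) (fob (pcmp F k) x) (fob (pcmp G k) x) \<in>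
      hom (lev T k) (fob (pcmp F k) x) (fob (pcmp G k) x)" if "x \<in> Obj (lev S k)" for k x
    using that graph_map_ob[OF F1] graph_map_ob[OF G1] eq by (intro T.lev.arrow_hom)
  show ?thesis
    unfolding modification_def
  proof (intro conjI allI ballI)
    show "nat_trans (lev S k) (lev T k) (pcmp F k) (pcmp G k)
        (\<lambda>x. arrow (lev T k) (fob (pcmp F k) x) (fob (pcmp G k) x))" for k
      using T.lev.nat_isoI[OF F1 G1 S.lev.src_ob S.lev.tgt_ob arr] by (auto simp: nat_iso_def)
    fix m k \<theta> x
    assume \<theta>: "\<theta> \<in> Delta m k" and x: "x \<in> Obj (lev S k)"
    let ?\<mu> = "\<lambda>k x. arrow (lev T k) (fob (pcmp F k) x) (fob (pcmp G k) x)"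
    have "pcoh F m k \<theta> x \<in> hom (lev T m) (fob (act T \<theta>) (fob (pcmp F k) x))
        (fob (pcmp F m) (fob (act S \<theta>) x))"
      "pcoh G m k \<theta> x \<in> hom (lev T m) (fob (act T \<theta>) (fob (pcmp G k) x))
        (fob (pcmp G m) (fob (act S \<theta>) x))"
      using F G \<theta> x by (auto simp: pstrans_data_def)
    moreover have "far (act T \<theta>) (?\<mu> k x) \<in> hom (lev T m) (fob (act T \<theta>) (fob (pcmp F k) x))
        (fob (act T \<theta>) (fob (pcmp G k) x))"
      using T.act[OF \<theta>] arr[OF x] by (auto simp: graph_map_def hom_def)
    ultimately show "?\<mu> m (fob (act S \<theta>) x) \<cdot>\<^bsub>lev T m\<^esub> pcoh F m k \<theta> x =
        pcoh G m k \<theta> x \<cdot>\<^bsub>lev T m\<^esub> far (act T \<theta>) (?\<mu> k x)"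
      using arr[OF graph_map_ob[OF S.act[OF \<theta>] x]]
      by (intro T.lev.hom_unique[OF T.lev.cmp_hom' T.lev.cmp_hom'])
  qed
qed

text \<open>The hypothesis \<open>eq\<close> is symmetric in \<open>F\<close> and \<open>G\<close>,
  so the construction with the two exchanged gives the inverse.\<close>

lemma invertible_modificationI:
  assumes F: "pstrans_data S T F" and G: "pstrans_data S T G"
    and eq: "\<And>k x. x \<in> Obj (lev S k) \<Longrightarrow> \<rho> (fob (pcmp F k) x) = \<rho> (fob (pcmp G k) x)"
  shows "\<exists>\<mu>. invertible_modification S T F G \<mu>"
proof -
  let ?\<mu> = "\<lambda>F G k x. arrow (lev T k) (fob (pcmp F k) x) (fob (pcmp G k) x)"
  have ob: "fob (pcmp F k) x \<in> Obj (lev T k)" "fob (pcmp G k) x \<in> Obj (lev T k)"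
    if "x \<in> Obj (lev S k)" for k x
    using F G that by (auto simp: pstrans_data_def graph_map_def)
  have "?\<mu> G F k x \<cdot>\<^bsub>lev T k\<^esub> ?\<mu> F G k x = idn (lev T k) (fob (pcmp F k) x) \<and>
      ?\<mu> F G k x \<cdot>\<^bsub>lev T k\<^esub> ?\<mu> G F k x = idn (lev T k) (fob (pcmp G k) x)"
    if x: "x \<in> Obj (lev S k)" for k x
    using T.lev.arrow_hom[OF ob[OF x] eq[OF x]] T.lev.arrow_hom[OF ob(2,1)[OF x] eq[OF x, symmetric]]
      T.lev.idn_hom ob[OF x] T.lev.hom_unique T.lev.cmp_hom'
    by meson
  moreover have "modification S T F G (?\<mu> F G)" "modification S T G F (?\<mu> G F)"
    using F G eq by (simp_all add: modification_arrow)
  ultimately show ?thesis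
    unfolding invertible_modification_def by blast
qed

text \<open>Each object of \<open>S\<close> goes to any object of \<open>T\<close> with the same
  image; \<open>onto\<close> provides one. The choices at different levels are unrelated, but
  \<open>act_map\<close> puts both ways around a naturality square over the same element, and the
  unique arrow between them serves as \<open>pcoh\<close>. A strict transformation would require
  compatible choices.\<close>

lemma exists_lift:
  "\<exists>F. pstrans_data S T F \<and> (\<forall>k. \<forall>x \<in> Obj (lev S k). \<rho> (fob (pcmp F k) x) = \<pi> x)"
proof -
  define \<phi> where "\<phi> k x = (SOME y. y \<in> Obj (lev T k) \<and> \<rho> y = \<pi> x)" for k x
  have \<phi>: "\<phi> k x \<in> Obj (lev T k)" "\<rho> (\<phi> k x) = \<pi> x" if x: "x \<in> Obj (lev S k)" for k x
  proof -
    have "\<exists>y. y \<in> Obj (lev T k) \<and> \<rho> y = \<pi> x"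
      using S.onto[of k] T.onto[of k] x by (metis imageE imageI)
    from someI_ex[OF this] show "\<phi> k x \<in> Obj (lev T k)" "\<rho> (\<phi> k x) = \<pi> x"
      unfolding \<phi>_def by auto
  qed
  define F where "F = \<lparr>pcmp = \<lambda>k. \<lparr>fob = \<phi> k, far = \<lambda>f. arrow (lev T k) (\<phi> k (src (lev S k) f)) (\<phi> k (tgt (lev S k) f))\<rparr>,
    pcoh = \<lambda>m k \<theta> x. arrow (lev T m) (fob (act T \<theta>) (\<phi> k x)) (\<phi> m (fob (act S \<theta>) x))\<rparr>"
  have "pstrans_data S T F"
    unfolding pstrans_data_def F_def pstrans.simps ftr.simps
  proof (intro conjI allI ballI)
    show "graph_map (lev S k) (lev T k)
        \<lparr>fob = \<phi> k, far = \<lambda>f. arrow (lev T k) (\<phi> k (src (lev S k) f)) (\<phi> k (tgt (lev S k) f))\<rparr>" for k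
      using \<phi> S.lev.src_ob S.lev.tgt_ob S.lev.arr_eq by (intro T.lev.graph_map_arrow) auto
    fix m k \<theta> x
    assume \<theta>: "\<theta> \<in> Delta m k" and x: "x \<in> Obj (lev S k)"
    note ob = graph_map_ob[OF S.act[OF \<theta>]] graph_map_ob[OF T.act[OF \<theta>]]
    show "arrow (lev T m) (fob (act T \<theta>) (\<phi> k x)) (\<phi> m (fob (act S \<theta>) x))
        \<in> hom (lev T m) (fob (act T \<theta>) (\<phi> k x)) (\<phi> m (fob (act S \<theta>) x))"
      using x ob \<phi> S.act_map[OF \<theta>] T.act_map[OF \<theta>] by (intro T.lev.arrow_hom) auto
  qed
  then show ?thesis
    using \<phi> by (intro exI[of _ F]) (auto simp: F_def)
qed

end

lemma (in kernel_scat) pstrans_data_id: "pstrans_data S S (id_pstrans S)"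
  unfolding pstrans_data_def id_pstrans_def
  using graph_map_ob[OF act] lev.idn_hom graph_map_id lev.src_ob lev.tgt_ob
  by (auto simp: graph_map_def hom_def id_ftr_def)

lemma pstrans_data_comp:
  assumes "kernel_scat S \<pi> A Q" "kernel_scat U \<rho> A Q"
    and F: "pstrans_data S T F" and G: "pstrans_data T U G"
  shows "pstrans_data S U (comp_pstrans U G F)"
proof -
  interpret S: kernel_scat S \<pi> A Q by fact
  interpret U: kernel_scat U \<rho> A Q by fact
  have F1: "graph_map (lev S k) (lev T k) (pcmp F k)" for k
    using F by (simp add: pstrans_data_def)
  have G1: "graph_map (lev T k) (lev U k) (pcmp G k)" for k
    using G by (simp add: pstrans_data_def)
  show ?thesis
    unfolding pstrans_data_def
  proof (intro conjI allI ballI)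
    show "graph_map (lev S k) (lev U k) (pcmp (comp_pstrans U G F) k)" for k
      by (simp add: comp_pstrans_def graph_map_comp[OF F1 G1])
    fix m k \<theta> x
    assume \<theta>: "\<theta> \<in> Delta m k" and x: "x \<in> Obj (lev S k)"
    have "pcoh F m k \<theta> x \<in> hom (lev T m) (fob (act T \<theta>) (fob (pcmp F k) x))
        (fob (pcmp F m) (fob (act S \<theta>) x))"
      "pcoh G m k \<theta> (fob (pcmp F k) x) \<in> hom (lev U m) (fob (act U \<theta>) (fob (pcmp G k) (fob (pcmp F k) x)))
        (fob (pcmp G m) (fob (act T \<theta>) (fob (pcmp F k) x)))"
      using F G \<theta> x graph_map_ob[OF F1] by (auto simp: pstrans_data_def)
    then show "pcoh (comp_pstrans U G F) m k \<theta> x \<in>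
        hom (lev U m) (fob (act U \<theta>) (fob (pcmp (comp_pstrans U G F) k) x))
          (fob (pcmp (comp_pstrans U G F) m) (fob (act S \<theta>) x))"
      using G1[of m] unfolding comp_pstrans_def comp_ftr_def
      by (auto simp: graph_map_def hom_def intro!: U.lev.cmp_hom')
        (auto simp: graph_map_def hom_def dest!: U.lev.cmp_hom)
  qed
qed

text \<open>The lifts in both directions preserve images, hence so do their composites, and two
  transformations with the same effect on images are isomorphic.\<close>

lemma pseudo_equivalence:
  assumes S: "kernel_scat S \<pi> A Q" and T: "kernel_scat T \<rho> A Q"
  shows "\<exists>F G \<eta> \<epsilon>. pseudo_natural S T F \<and> pseudo_natural T S G \<and>
    invertible_modification S S (id_pstrans S) (comp_pstrans S G F) \<eta> \<and>
    invertible_modification T T (comp_pstrans T F G) (id_pstrans T) \<epsilon>"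
proof -
  interpret S: kernel_scat S \<pi> A Q by fact
  interpret T: kernel_scat T \<rho> A Q by fact
  interpret ST: kernel_scat_pair S \<pi> T \<rho> A Q by unfold_locales
  interpret TS: kernel_scat_pair T \<rho> S \<pi> A Q by unfold_locales
  interpret SS: kernel_scat_pair S \<pi> S \<pi> A Q by unfold_locales
  interpret TT: kernel_scat_pair T \<rho> T \<rho> A Q by unfold_locales
  obtain F where F: "pstrans_data S T F" "\<And>k x. x \<in> Obj (lev S k) \<Longrightarrow> \<rho> (fob (pcmp F k) x) = \<pi> x"
    using ST.exists_lift by blast
  obtain G where G: "pstrans_data T S G" "\<And>k x. x \<in> Obj (lev T k) \<Longrightarrow> \<pi> (fob (pcmp G k) x) = \<rho> x"
    using TS.exists_lift by blast
  have ob: "x \<in> Obj (lev S k) \<Longrightarrow> fob (pcmp F k) x \<in> Obj (lev T k)"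
    "y \<in> Obj (lev T k) \<Longrightarrow> fob (pcmp G k) y \<in> Obj (lev S k)" for k x y
    using F(1) G(1) by (auto simp: pstrans_data_def graph_map_def)
  note data = S.pstrans_data_id T.pstrans_data_id pstrans_data_comp[OF S S F(1) G(1)]
    pstrans_data_comp[OF T T G(1) F(1)]
  obtain \<eta> where "invertible_modification S S (id_pstrans S) (comp_pstrans S G F) \<eta>"
    using SS.invertible_modificationI[OF data(1,3)] ob F(2) G(2)
    by (auto simp: id_pstrans_def comp_pstrans_def id_ftr_def comp_ftr_def)
  moreover obtain \<epsilon> where "invertible_modification T T (comp_pstrans T F G) (id_pstrans T) \<epsilon>"
    using TT.invertible_modificationI[OF data(4,2)] ob F(2) G(2)
    by (auto simp: id_pstrans_def comp_pstrans_def id_ftr_def comp_ftr_def)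
  ultimately show ?thesis
    using ST.pseudo_naturalI[OF F(1)] TS.pseudo_naturalI[OF G(1)] by blast
qed

section \<open>Double categories over a category\<close>

text \<open>What is left to verify for a concrete double category: apart from the two kernel
  groupoids, equations only for horizontal arrows (\<open>hcat\<close>) and their projection, and
  correct ends for everything else. \<open>lift\<close> asks for strings composable in
  \<open>X\<close> itself, not only up to vertical isomorphism.\<close>

locale kernel_dblcat =
  fixes L :: "('l, 'm) cat" and X :: "('o, 'v, 'h, 'c) dblcat" and po :: "'o \<Rightarrow> 'l" and ph :: "'h \<Rightarrow> 'm"
  assumes catL: "category L"
    and X0: "kernel_groupoid (X0 X) po"
    and X1: "kernel_groupoid (X1 X) ph"
    and d0: "graph_map (X1 X) (X0 X) (d0 X)"
    and d1: "graph_map (X1 X) (X0 X) (d1 X)"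
    and hid: "graph_map (X0 X) (X1 X) (hid X)"
    and hm: "graph_map (hpairs X) (X1 X) (hm X)"
    and hcat: "category (hcat_ob X)"
    and proj: "is_functor (hcat_ob X) L \<lparr>fob = po, far = ph\<rparr>"
    and lift: "q \<in> strings L k \<Longrightarrow> \<exists>p \<in> strings (hcat_ob X) k. map_prod po (map ph) p = q"

sublocale kernel_dblcat \<subseteq> L: category L + V: kernel_groupoid "X0 X" po + E: kernel_groupoid "X1 X" ph +
  H: category "hcat_ob X"
  by (rule catL X0 X1 hcat)+

context kernel_dblcat
begin

lemmas d0_simps = graph_map_ob[OF d0] graph_map_ar[OF d0] graph_map_src[OF d0] graph_map_tgt[OF d0]
lemmas d1_simps = graph_map_ob[OF d1] graph_map_ar[OF d1] graph_map_src[OF d1] graph_map_tgt[OF d1]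
lemmas hid_simps = graph_map_ob[OF hid] graph_map_ar[OF hid] graph_map_src[OF hid] graph_map_tgt[OF hid]
lemmas hm_simps = graph_map_ob[OF hm] graph_map_ar[OF hm] graph_map_src[OF hm] graph_map_tgt[OF hm]

lemma hcat_ob_ob: "a \<in> Obj (X0 X) \<Longrightarrow> fob (hid X) a \<in> Obj (X1 X) \<and>
    fob (d0 X) (fob (hid X) a) = a \<and> fob (d1 X) (fob (hid X) a) = a"
  using H.idn_in[of a] by (simp add: hcat_ob_def hom_def)

lemma hcat_ob_cmp: "h \<in> Obj (X1 X) \<Longrightarrow> h' \<in> Obj (X1 X) \<Longrightarrow> fob (d1 X) h = fob (d0 X) h' \<Longrightarrow>
    fob (hm X) (h, h') \<in> Obj (X1 X) \<and> fob (d0 X) (fob (hm X) (h, h')) = fob (d0 X) h \<and>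
    fob (d1 X) (fob (hm X) (h, h')) = fob (d1 X) h'"
  using H.cmp_in[of h "fob (d0 X) h" "fob (d1 X) h" h' "fob (d1 X) h'"]
  by (simp add: hcat_ob_def hom_def)

lemma hpairs_ends:
  assumes "(c, c') \<in> Arr (hpairs X)"
  shows "(src (X1 X) c, src (X1 X) c') \<in> Obj (hpairs X)" "(tgt (X1 X) c, tgt (X1 X) c') \<in> Obj (hpairs X)"
  using assms by (auto simp: hpairs_def E.src_ob E.tgt_ob simp flip: d0_simps d1_simps)

text \<open>\<open>graph_map\<close> controls only the top and bottom of a horizontal composite. Its
  left and right sides are correct because they are vertical arrows with the correct ends.\<close>

lemma hm_cell:
  assumes "c \<in> Arr (X1 X)" "c' \<in> Arr (X1 X)" "far (d1 X) c = far (d0 X) c'"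
  shows "far (hm X) (c, c') \<in> Arr (X1 X)"
    "src (X1 X) (far (hm X) (c, c')) = fob (hm X) (src (X1 X) c, src (X1 X) c')"
    "tgt (X1 X) (far (hm X) (c, c')) = fob (hm X) (tgt (X1 X) c, tgt (X1 X) c')"
    "far (d0 X) (far (hm X) (c, c')) = far (d0 X) c"
    "far (d1 X) (far (hm X) (c, c')) = far (d1 X) c'"
proof -
  have cc: "(c, c') \<in> Arr (hpairs X)"
    using assms by (simp add: hpairs_def)
  show *: "far (hm X) (c, c') \<in> Arr (X1 X)"
    "src (X1 X) (far (hm X) (c, c')) = fob (hm X) (src (X1 X) c, src (X1 X) c')"
    "tgt (X1 X) (far (hm X) (c, c')) = fob (hm X) (tgt (X1 X) c, tgt (X1 X) c')"
    using hm_simps(2-4)[OF cc] by (simp_all add: hpairs_def)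
  have ends: "fob (d1 X) (src (X1 X) c) = fob (d0 X) (src (X1 X) c')"
    "fob (d1 X) (tgt (X1 X) c) = fob (d0 X) (tgt (X1 X) c')"
    using hpairs_ends[OF cc] by (auto simp: hpairs_def)
  show "far (d0 X) (far (hm X) (c, c')) = far (d0 X) c"
    "far (d1 X) (far (hm X) (c, c')) = far (d1 X) c'"
    using * assms ends hcat_ob_cmp[OF E.src_ob E.src_ob] hcat_ob_cmp[OF E.tgt_ob E.tgt_ob]
    by (auto intro!: V.arr_unique simp: d0_simps d1_simps)
qed

lemma hid_cell:
  assumes v: "v \<in> Arr (X0 X)"
  shows "far (hid X) v \<in> Arr (X1 X)" "far (d0 X) (far (hid X) v) = v" "far (d1 X) (far (hid X) v) = v"
  using v hid_simps V.src_ob[OF v] V.tgt_ob[OF v] hcat_ob_ob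
  by (auto intro!: V.arr_unique simp: d0_simps d1_simps)

text \<open>The laws for cells are inherited from those for horizontal arrows: the tops and the
  bottoms of both sides of a law agree by \<open>hcat\<close>, and a cell is determined by its top
  and bottom.\<close>

lemma hcat_ar_category: "category (hcat_ar X)"
proof (unfold_locales, goal_cases)
  case (1 f)
  then show ?case by (simp add: hcat_ar_def d0_simps)
next
  case (2 f)
  then show ?case by (simp add: hcat_ar_def d1_simps)
next
  case (3 v)
  then have v: "v \<in> Arr (X0 X)"
    by (simp add: hcat_ar_def)
  then show ?case
    using hid_cell[OF v] by (simp add: hcat_ar_def hom_def)
next
  case (4 f a b g c)
  then show ?case
    using hm_cell[of f g] by (auto simp: hcat_ar_def hom_def)
next
  case (5 c a b)
  then have c: "c \<in> Arr (X1 X)" "far (d0 X) c = a" "a \<in> Arr (X0 X)"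
    by (auto simp: hcat_ar_def hom_def d0_simps)
  have i: "far (hid X) a \<in> Arr (X1 X)" "far (d1 X) (far (hid X) a) = a"
    using hid_cell[OF c(3)] by simp_all
  have "fob (hm X) (fob (hid X) (fob (d0 X) h), h) = h" if "h \<in> Obj (X1 X)" for h
    using H.idn_right[of h "fob (d0 X) h" "fob (d1 X) h"] that by (simp add: hcat_ob_def hom_def)
  then have "far (hm X) (far (hid X) a, c) = c"
    using i c hm_cell[of "far (hid X) a" c] hid_simps E.src_ob E.tgt_ob
    by (intro E.arr_unique) (auto simp: d0_simps)
  then show ?case by (simp add: hcat_ar_def)
next
  case (6 c a b)
  then have c: "c \<in> Arr (X1 X)" "far (d1 X) c = b" "b \<in> Arr (X0 X)"
    by (auto simp: hcat_ar_def hom_def d1_simps)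
  have i: "far (hid X) b \<in> Arr (X1 X)" "far (d0 X) (far (hid X) b) = b"
    using hid_cell[OF c(3)] by simp_all
  have "fob (hm X) (h, fob (hid X) (fob (d1 X) h)) = h" if "h \<in> Obj (X1 X)" for h
    using H.idn_left[of h "fob (d0 X) h" "fob (d1 X) h"] that by (simp add: hcat_ob_def hom_def)
  then have "far (hm X) (c, far (hid X) b) = c"
    using i c hm_cell[of c "far (hid X) b"] hid_simps E.src_ob E.tgt_ob
    by (intro E.arr_unique) (auto simp: d1_simps)
  then show ?case by (simp add: hcat_ar_def)
next
  case (7 c a b c' a' c'' b')
  then have c: "c \<in> Arr (X1 X)" "c' \<in> Arr (X1 X)" "c'' \<in> Arr (X1 X)"
    "far (d1 X) c = far (d0 X) c'" "far (d1 X) c' = far (d0 X) c''"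
    by (auto simp: hcat_ar_def hom_def)
  have assoc: "fob (hm X) (fob (hm X) (h, h'), h'') = fob (hm X) (h, fob (hm X) (h', h''))"
    if "h \<in> Obj (X1 X)" "h' \<in> Obj (X1 X)" "h'' \<in> Obj (X1 X)"
      "fob (d1 X) h = fob (d0 X) h'" "fob (d1 X) h' = fob (d0 X) h''" for h h' h''
    using H.cmp_assoc[of h "fob (d0 X) h" "fob (d1 X) h" h' "fob (d1 X) h'" h'' "fob (d1 X) h''"] that
    by (simp add: hcat_ob_def hom_def)
  have ends: "fob (d1 X) (src (X1 X) c) = fob (d0 X) (src (X1 X) c')"
    "fob (d1 X) (tgt (X1 X) c) = fob (d0 X) (tgt (X1 X) c')"
    "fob (d1 X) (src (X1 X) c') = fob (d0 X) (src (X1 X) c'')"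
    "fob (d1 X) (tgt (X1 X) c') = fob (d0 X) (tgt (X1 X) c'')"
    using hpairs_ends[of c c'] hpairs_ends[of c' c''] c by (auto simp: hpairs_def)
  have "far (hm X) (far (hm X) (c, c'), c'') = far (hm X) (c, far (hm X) (c', c''))"
    using c ends by (intro E.arr_unique) (simp_all add: hm_cell assoc E.src_ob E.tgt_ob)
  then show ?case by (simp add: hcat_ar_def)
qed

text \<open>Functoriality of \<open>hm\<close>, the interchange law, is again an equation of
  parallel cells. What remains is that identities and vertical composites of matching pairs match,
  which holds by uniqueness in \<open>X0\<close>.\<close>

lemma double_category: "double_category X"
  unfolding double_category_def
proof (intro conjI)
  show "is_functor (X1 X) (X0 X) (d0 X)" "is_functor (X1 X) (X0 X) (d1 X)" "is_functor (X0 X) (X1 X) (hid X)"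
    using d0 d1 hid V.idn_hom V.cmp_hom E.idn_hom E.cmp_hom by (auto intro!: V.functorI E.functorI)
  show "is_functor (hpairs X) (X1 X) (hm X)"
  proof (rule E.functorI[OF hm])
    fix a assume a: "a \<in> Obj (hpairs X)"
    obtain h h' where a': "a = (h, h')" by fastforce
    have "far (d1 X) (idn (X1 X) h) = far (d0 X) (idn (X1 X) h')"
      using a E.idn_hom[of h] E.idn_hom[of h']
      by (intro V.arr_unique) (auto simp: a' hpairs_def hom_def d0_simps d1_simps)
    then show "idn (hpairs X) a \<in> hom (hpairs X) a a"
      using a E.idn_hom[of h] E.idn_hom[of h'] by (auto simp: a' hpairs_def hom_def)
  next
    fix f g assume f: "f \<in> Arr (hpairs X)" and g: "g \<in> Arr (hpairs X)"
      and fg: "src (hpairs X) g = tgt (hpairs X) f"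
    obtain c c' b b' where f': "f = (c, c')" and g': "g = (b, b')" by fastforce
    have *: "b \<cdot>\<^bsub>X1 X\<^esub> c \<in> hom (X1 X) (src (X1 X) c) (tgt (X1 X) b)"
      "b' \<cdot>\<^bsub>X1 X\<^esub> c' \<in> hom (X1 X) (src (X1 X) c') (tgt (X1 X) b')"
      using f g fg by (auto intro!: E.cmp_hom simp: f' g' hpairs_def)
    have "far (d1 X) (b \<cdot>\<^bsub>X1 X\<^esub> c) = far (d0 X) (b' \<cdot>\<^bsub>X1 X\<^esub> c')"
      using * hpairs_ends[OF f[unfolded f']] hpairs_ends[OF g[unfolded g']]
      by (intro V.arr_unique) (auto simp: hpairs_def hom_def d0_simps d1_simps)
    then show "g \<cdot>\<^bsub>hpairs X\<^esub> f \<in> hom (hpairs X) (src (hpairs X) f) (tgt (hpairs X) g)"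
      using * by (auto simp: f' g' hpairs_def hom_def)
  qed
qed (rule V.category E.category hcat hcat_ar_category)+

section \<open>The horizontal nerve and weak globularity\<close>

lemma ob_nerve: "Obj (nerve_level X k) = strings (hcat_ob X) k"
  and ar_nerve: "Arr (nerve_level X k) = strings (hcat_ar X) k"
  by (auto simp: nerve_level_def Let_def fibre_power_def strings_def is_path_def hcat_ob_def hcat_ar_def)

lemma src_nerve: "src (nerve_level X k) = map_prod (src (X0 X)) (map (src (X1 X)))"
  and tgt_nerve: "tgt (nerve_level X k) = map_prod (tgt (X0 X)) (map (tgt (X1 X)))"
  by (simp_all add: nerve_level_def Let_def fibre_power_def)

text \<open>Via \<open>string_act_functor\<close>, these give the top and bottom of the action of a
  simplicial operator on a string of cells.\<close>

lemma src_functor: "is_functor (hcat_ar X) (hcat_ob X) \<lparr>fob = src (X0 X), far = src (X1 X)\<rparr>"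
  and tgt_functor: "is_functor (hcat_ar X) (hcat_ob X) \<lparr>fob = tgt (X0 X), far = tgt (X1 X)\<rparr>"
  by (auto simp: is_functor_def hcat_ar_def hcat_ob_def hom_def V.src_ob V.tgt_ob E.src_ob E.tgt_ob
      d0_simps d1_simps hid_simps hm_cell)

lemma nerve_kernel_groupoid: "kernel_groupoid (nerve_level X k) (map_prod po (map ph))"
proof -
  interpret P: kernel_groupoid "fibre_power (X1 X) (d0 X) (d1 X) k" "map ph"
    by (rule fibre_power_kernel_groupoid[OF X1 X0 d0 d1])
  let ?P = "fibre_power (X1 X) (d0 X) (d1 X) k"
  have set: "hs \<in> Obj ?P \<Longrightarrow> set hs \<subseteq> Obj (X1 X)" "cs \<in> Arr ?P \<Longrightarrow> set cs \<subseteq> Arr (X1 X)" for hs cs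
    by (auto simp: fibre_power_def)
  have sel: "src ?P = map (src (X1 X))" "tgt ?P = map (tgt (X1 X))"
    "idn ?P = map (idn (X1 X))" "cmp ?P = map2 (cmp (X1 X))"
    by (simp_all add: fibre_power_def)
  have hd_in: "cs \<noteq> [] \<Longrightarrow> set cs \<subseteq> A \<Longrightarrow> hd cs \<in> A" for cs :: "'z list" and A
    by auto
  have ob: "(a, hs) \<in> Obj (nerve_level X k) \<longleftrightarrow>
      a \<in> Obj (X0 X) \<and> hs \<in> Obj ?P \<and> (hs \<noteq> [] \<longrightarrow> fob (d0 X) (hd hs) = a)" for a hs
    by (simp add: nerve_level_def Let_def)
  have ar: "(v, cs) \<in> Arr (nerve_level X k) \<longleftrightarrow>
      v \<in> Arr (X0 X) \<and> cs \<in> Arr ?P \<and> (cs \<noteq> [] \<longrightarrow> far (d0 X) (hd cs) = v)" for v cs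
    by (simp add: nerve_level_def Let_def)
  have nsel: "src (nerve_level X k) (v, cs) = (src (X0 X) v, map (src (X1 X)) cs)"
    "tgt (nerve_level X k) (v, cs) = (tgt (X0 X) v, map (tgt (X1 X)) cs)" for v cs
    by (simp_all add: src_nerve tgt_nerve)
  have hom: "(v, cs) \<in> hom (nerve_level X k) (a, hs) (b, ks)"
    if "v \<in> hom (X0 X) a b" "cs \<in> hom ?P hs ks" "(a, hs) \<in> Obj (nerve_level X k)"
      "(b, ks) \<in> Obj (nerve_level X k)" for v cs a hs b ks
  proof -
    \<comment> \<open>The leftmost side of the string of cells has the same ends as
      \<open>v\<close>, so it is \<open>v\<close>.\<close>
    have "far (d0 X) (hd cs) = v" if "cs \<noteq> []"
      using that \<open>v \<in> _\<close> \<open>cs \<in> _\<close> \<open>(a, hs) \<in> _\<close> \<open>(b, ks) \<in> _\<close> set(2)[of cs] hd_in[OF that, of "Arr (X1 X)"]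
      by (intro V.arr_unique) (auto simp: d0_simps hom_def ob sel hd_map)
    then show ?thesis
      using that by (simp add: hom_def ar nsel sel)
  qed
  have ends: "src (nerve_level X k) f \<in> Obj (nerve_level X k)" "tgt (nerve_level X k) f \<in> Obj (nerve_level X k)"
    if "f \<in> Arr (nerve_level X k)" for f
  proof -
    obtain v cs where f: "f = (v, cs)"
      by fastforce
    with that have "(v, cs) \<in> Arr (nerve_level X k)"
      by simp
    with f show "src (nerve_level X k) f \<in> Obj (nerve_level X k)" "tgt (nerve_level X k) f \<in> Obj (nerve_level X k)"
      using P.src_ob[of cs] P.tgt_ob[of cs] set(2)[of cs] hd_in[of cs "Arr (X1 X)"]
      by (auto simp: ob ar nsel V.src_ob V.tgt_ob sel hd_map simp flip: d0_simps)
  qed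
  show ?thesis
  proof (unfold_locales, goal_cases)
    case (1 f)
    then show ?case by (rule ends)
  next
    case (2 f)
    then show ?case by (rule ends)
  next
    case (3 f)
    then show ?case
      using P.arr_eq by (cases f) (auto simp: ar nsel V.arr_eq sel)
  next
    case (4 x y)
    obtain a hs b ks where xy: "x = (a, hs)" "y = (b, ks)" by fastforce
    obtain v where "v \<in> hom (X0 X) a b"
      using V.arr_ex[of a b] 4 by (auto simp: xy ob)
    moreover obtain cs where "cs \<in> hom ?P hs ks"
      using P.arr_ex[of hs ks] 4 by (auto simp: xy ob)
    ultimately show ?case
      using hom 4 unfolding xy by blast
  next
    case (5 f g)
    then show ?case
      by (cases f; cases g) (auto simp: ar nsel sel intro!: V.arr_unique P.arr_unique)
  next
    case (6 x)
    obtain a hs where x: "x = (a, hs)" by fastforce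
    have "idn (nerve_level X k) x = (idn (X0 X) a, idn ?P hs)"
      by (simp add: x nerve_level_def Let_def)
    then show ?case
      using 6 unfolding x by (auto intro!: hom V.idn_hom P.idn_hom simp: ob)
  next
    case (7 f g)
    obtain v cs u bs where fg: "f = (v, cs)" "g = (u, bs)" by fastforce
    have "g \<cdot>\<^bsub>nerve_level X k\<^esub> f = (u \<cdot>\<^bsub>X0 X\<^esub> v, bs \<cdot>\<^bsub>?P\<^esub> cs)"
      by (simp add: fg nerve_level_def Let_def)
    moreover have "src (nerve_level X k) f \<in> Obj (nerve_level X k)" "tgt (nerve_level X k) g \<in> Obj (nerve_level X k)"
      using ends 7 by blast+
    moreover have "u \<cdot>\<^bsub>X0 X\<^esub> v \<in> hom (X0 X) (src (X0 X) v) (tgt (X0 X) u)"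
      "bs \<cdot>\<^bsub>?P\<^esub> cs \<in> hom ?P (map (src (X1 X)) cs) (map (tgt (X1 X)) bs)"
      using 7 V.cmp_hom[of v u] P.cmp_hom[of cs bs] by (simp_all only: fg ar nsel sel prod.inject)
    ultimately show ?case
      unfolding fg nsel by (simp add: hom)
  qed
qed

text \<open>The images form the nerve of \<open>L\<close>: \<open>proj\<close> makes the projection
  simplicial and \<open>lift\<close> makes it onto at every level.\<close>

lemma hnerve_kernel_scat: "kernel_scat (hnerve X) (map_prod po (map ph)) (string_act L) (strings L)"
proof -
  have lev: "lev (hnerve X) = nerve_level X"
    and act: "fob (act (hnerve X) \<theta>) = string_act (hcat_ob X) \<theta>"
    "far (act (hnerve X) \<theta>) = string_act (hcat_ar X) \<theta>" for \<theta>
    by (simp_all add: hnerve_def)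
  have ob: "string_in (hcat_ob X) x k" if "x \<in> Obj (nerve_level X k)" for x k
    using that hcat by (simp add: string_in_def string_in_axioms_def ob_nerve)
  have ar: "string_in (hcat_ar X) f k" if "f \<in> Arr (nerve_level X k)" for f k
    using that hcat_ar_category by (simp add: string_in_def string_in_axioms_def ar_nerve)
  show ?thesis
  proof (rule kernel_scat.intro, unfold lev, goal_cases)
    case (1 k)
    show ?case by (rule nerve_kernel_groupoid)
  next
    case (2 \<theta> m k)
    then show ?case
      using string_in.string_act_in[OF ob 2] string_in.string_act_in[OF ar 2]
        string_in.string_act_functor[OF ar hcat src_functor 2]
        string_in.string_act_functor[OF ar hcat tgt_functor 2]
      by (auto simp: graph_map_def hom_def ob_nerve[of m] ar_nerve[of m] src_nerve tgt_nerve act)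
  next
    case (3 x k)
    then show ?case using string_in.string_act_id[OF ob] by (simp add: act)
  next
    case (4 \<phi> l m \<theta> k x)
    then show ?case using string_in.string_act_comp[OF ob] by (simp add: act)
  next
    case (5 \<theta> m k x)
    then show ?case using string_in.string_act_functor[OF ob catL proj] by (simp add: act)
  next
    case (6 k)
    show ?case
      using lift[of _ k] string_in.strings_functor[OF ob[of _ k] catL proj]
      by (force simp: ob_nerve image_iff)
  qed
qed

text \<open>Neighbours in an object of \<open>?Q\<close> match only up to vertical isomorphism.
  Their images in \<open>L\<close> nevertheless match exactly and form a string, and a lift of that
  string gives an object of \<open>?P\<close> with the same image.\<close>

lemma weakly_globular: "weakly_globular X"
  unfolding weakly_globular_def
proof (intro conjI allI impI)
  show "double_category X"
    by (rule double_category)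
  show "equivalence_of_categories (X0 X) (components (X0 X)) (gamma (X0 X))"
    by (rule V.gamma_equivalence)
  fix n :: nat assume n: "2 \<le> n"
  let ?P = "fibre_power (X1 X) (d0 X) (d1 X) n"
  let ?d0 = "comp_ftr (gamma (X0 X)) (d0 X)" and ?d1 = "comp_ftr (gamma (X0 X)) (d1 X)"
  let ?Q = "fibre_power (X1 X) ?d0 ?d1 n"
  have comp: "kernel_groupoid (components (X0 X)) (\<lambda>a. a)"
    unfolding components_def by (rule kernel_groupoid_discrete)
  have kP: "kernel_groupoid ?P (map ph)"
    by (rule fibre_power_kernel_groupoid[OF X1 X0 d0 d1])
  have kQ: "kernel_groupoid ?Q (map ph)"
    by (rule fibre_power_kernel_groupoid[OF X1 comp graph_map_comp[OF d0 V.graph_map_gamma]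
          graph_map_comp[OF d1 V.graph_map_gamma]])
  have sub: "Obj ?P \<subseteq> Obj ?Q" "Arr ?P \<subseteq> Arr ?Q"
    by (auto simp: fibre_power_def comp_ftr_def gamma_def elim!: successively_mono)
  show "equivalence_of_categories ?P ?Q id_ftr"
  proof (rule equivalence_of_kernel_groupoids[OF kP kQ])
    show "graph_map ?P ?Q id_ftr"
      using sub by (auto simp: graph_map_def id_ftr_def hom_def) (simp_all add: fibre_power_def)
    fix hs assume hs: "hs \<in> Obj ?Q"
    then have hs': "length hs = n" "\<And>i. i < n \<Longrightarrow> hs ! i \<in> Obj (X1 X)"
      "\<And>i. Suc i < n \<Longrightarrow> path_component (X0 X) (fob (d1 X) (hs ! i)) = path_component (X0 X) (fob (d0 X) (hs ! Suc i))"
      by (auto simp: fibre_power_def successively_conv_nth subset_eq comp_ftr_def gamma_def)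
    then have eq: "po (fob (d1 X) (hs ! i)) = po (fob (d0 X) (hs ! Suc i))" if "Suc i < n" for i
      using that V.path_component_eq_iff d0_simps(1) d1_simps(1) by (metis Suc_lessD)
    have proj': "a \<in> Obj (X0 X) \<Longrightarrow> po a \<in> Obj L"
      "h \<in> Obj (X1 X) \<Longrightarrow> ph h \<in> hom L (po (fob (d0 X) h)) (po (fob (d1 X) h))" for a h
      using proj by (auto simp: is_functor_def hcat_ob_def)
    \<comment> \<open>The entry \<open>hs ! 0\<close> exists because \<open>n\<close> is at least
      2.\<close>
    have "(po (fob (d0 X) (hs ! 0)), map ph hs) \<in> strings L n"
      unfolding strings_def mem_Collect_eq is_path_iff
    proof (intro conjI allI impI)
      fix i assume "i < length (snd (po (fob (d0 X) (hs ! 0)), map ph hs))"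
      then show "src L (snd (po (fob (d0 X) (hs ! 0)), map ph hs) ! i) =
          vertex (tgt L) (po (fob (d0 X) (hs ! 0)), map ph hs) i"
        using eq hs' proj'(2)[OF hs'(2)] by (cases i) (auto simp: vertex_def hom_def)
    qed (use hs' proj' d0_simps n in \<open>auto simp: hom_def\<close>)
    from lift[OF this] obtain p where p: "p \<in> strings (hcat_ob X) n" "map ph (snd p) = map ph hs"
      by (metis snd_conv snd_map_prod)
    then have "snd p \<in> Obj ?P"
      by (auto simp: strings_def is_path_def fibre_power_def hcat_ob_def)
    then show "\<exists>ks \<in> Obj ?P. map ph (fob id_ftr ks) = map ph hs"
      using p by (auto simp: id_ftr_def)
  qed (simp add: id_ftr_def)
qed

end

text \<open>The only datum that \<open>X\<close> and \<open>Y\<close> share is \<open>L\<close>;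
  both nerves lie over the simplicial set \<open>strings L\<close>.\<close>

theorem kernel_dblcat_equivalent:
  assumes "kernel_dblcat L X po ph" and "kernel_dblcat L Y qo qh"
  shows "equivalent_in_WGDbl_ps X Y"
  unfolding equivalent_in_WGDbl_ps_def pseudo_functor_def
  using kernel_dblcat.weakly_globular[OF assms(1)] kernel_dblcat.weakly_globular[OF assms(2)]
    pseudo_equivalence[OF kernel_dblcat.hnerve_kernel_scat[OF assms(1)]
      kernel_dblcat.hnerve_kernel_scat[OF assms(2)]]
  by blast

section \<open>The category of fractions\<close>

context category
begin

lemma cmp_arr [simp]: "f \<in> Arr C \<Longrightarrow> g \<in> Arr C \<Longrightarrow> src C g = tgt C f \<Longrightarrow> g \<cdot> f \<in> Arr C"
  and src_cmp [simp]: "f \<in> Arr C \<Longrightarrow> g \<in> Arr C \<Longrightarrow> src C g = tgt C f \<Longrightarrow> src C (g \<cdot> f) = src C f"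
  and tgt_cmp [simp]: "f \<in> Arr C \<Longrightarrow> g \<in> Arr C \<Longrightarrow> src C g = tgt C f \<Longrightarrow> tgt C (g \<cdot> f) = tgt C g"
  using cmp_in[of f "src C f" "tgt C f" g "tgt C g"] by (auto simp: hom_def)

lemma assoc [simp]: "f \<in> Arr C \<Longrightarrow> g \<in> Arr C \<Longrightarrow> h \<in> Arr C \<Longrightarrow> src C g = tgt C f \<Longrightarrow>
    src C h = tgt C g \<Longrightarrow> h \<cdot> g \<cdot> f = h \<cdot> (g \<cdot> f)"
  using cmp_assoc[of f "src C f" "tgt C f" g "tgt C g" h "tgt C h"] by (auto simp: hom_def)

lemma idn_simps [simp]: "a \<in> Obj C \<Longrightarrow> idn C a \<in> Arr C" "a \<in> Obj C \<Longrightarrow> src C (idn C a) = a"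
  "a \<in> Obj C \<Longrightarrow> tgt C (idn C a) = a"
  using idn_in[of a] by (auto simp: hom_def)

lemma idn_cmp [simp]: "f \<in> Arr C \<Longrightarrow> tgt C f = b \<Longrightarrow> idn C b \<cdot> f = f"
  and cmp_idn [simp]: "f \<in> Arr C \<Longrightarrow> src C f = a \<Longrightarrow> f \<cdot> idn C a = f"
  using idn_left[of f a b] idn_left[of f "src C f" b] idn_right[of f a "tgt C f"] by (auto simp: hom_def)

declare src_in [simp] tgt_in [simp]

end

text \<open>The graph of \<open>f\<close> after the inverse of \<open>w\<close>, on the generalised
  elements that factor through \<open>w\<close>. As \<open>w\<close> may fail to be monic, it is
  single-valued only after refinement.\<close>

definition span_rel :: "('o, 'a) cat \<Rightarrow> 'a span \<Rightarrow> ('a \<times> 'a) set" where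
  "span_rel C = (\<lambda>(w, f). {(w \<cdot>\<^bsub>C\<^esub> s, f \<cdot>\<^bsub>C\<^esub> s) | s. s \<in> Arr C \<and> tgt C s = src C w})"

text \<open>Relations between generalised elements that are total and single-valued up to refinement
  along \<open>W\<close>.\<close>

definition frac_rel :: "('o, 'a) cat \<Rightarrow> 'a set \<Rightarrow> 'o \<Rightarrow> 'o \<Rightarrow> ('a \<times> 'a) set \<Rightarrow> bool" where
  "frac_rel C W A B R \<longleftrightarrow>
     (\<forall>(x, y) \<in> R. x \<in> Arr C \<and> y \<in> Arr C \<and> src C x = src C y \<and> tgt C x = A \<and> tgt C y = B) \<and>
     (\<forall>(x, y) \<in> R. \<forall>t \<in> Arr C. tgt C t = src C x \<longrightarrow> (x \<cdot>\<^bsub>C\<^esub> t, y \<cdot>\<^bsub>C\<^esub> t) \<in> R) \<and>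
     (\<forall>x \<in> Arr C. tgt C x = A \<longrightarrow> (\<exists>t \<in> W. \<exists>y. tgt C t = src C x \<and> (x \<cdot>\<^bsub>C\<^esub> t, y) \<in> R)) \<and>
     (\<forall>x y z. (x, y) \<in> R \<longrightarrow> (x, z) \<in> R \<longrightarrow> (\<exists>t \<in> W. tgt C t = src C x \<and> y \<cdot>\<^bsub>C\<^esub> t = z \<cdot>\<^bsub>C\<^esub> t))"

text \<open>Membership becomes local: a pair belongs as soon as its restriction along some arrow of
  \<open>W\<close> does. This erases the choice of the representing span.\<close>

definition sat :: "('o, 'a) cat \<Rightarrow> 'a set \<Rightarrow> ('a \<times> 'a) set \<Rightarrow> ('a \<times> 'a) set" where
  "sat C W R = {(x, y). x \<in> Arr C \<and> y \<in> Arr C \<and> src C x = src C y \<and>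
     (\<exists>t \<in> W. tgt C t = src C x \<and> (x \<cdot>\<^bsub>C\<^esub> t, y \<cdot>\<^bsub>C\<^esub> t) \<in> R)}"

abbreviation fraction :: "('o, 'a) cat \<Rightarrow> 'a set \<Rightarrow> 'a span \<Rightarrow> ('a \<times> 'a) set" where
  "fraction C W s \<equiv> sat C W (span_rel C s)"

section \<open>Saturated relations as fractions\<close>

context calculus_of_fractions
begin

lemma W_Arr [simp]: "w \<in> W \<Longrightarrow> w \<in> Arr C"
  using W_arr by blast

lemma W_cmp [simp]: "f \<in> W \<Longrightarrow> g \<in> W \<Longrightarrow> src C g = tgt C f \<Longrightarrow> g \<cdot> f \<in> W"
  by (rule CF1_comp)

lemma W_idn [simp]: "a \<in> Obj C \<Longrightarrow> idn C a \<in> W"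
  by (rule CF1_iso) (auto simp: is_iso_def hom_def)

lemma ore:
  assumes "f \<in> Arr C" "w \<in> W" "tgt C f = tgt C w"
  obtains t g where "t \<in> W" "g \<in> Arr C" "tgt C t = src C f" "tgt C g = src C w" "src C g = src C t"
    "f \<cdot> t = w \<cdot> g"
  using CF2[OF assms] that by (auto simp: hom_def)

text \<open>CF3 is applied to \<open>w \<cdot> u\<close>. Legs \<open>u\<close> of representatives
  are known to reach \<open>W\<close> only after such a composition.\<close>

lemma cancel:
  assumes "w \<cdot> u \<in> W" "w \<in> Arr C" "u \<in> Arr C" "src C w = tgt C u" "a \<in> Arr C" "b \<in> Arr C"
    "tgt C a = src C u" "tgt C b = src C u" "src C a = src C b" "u \<cdot> a = u \<cdot> b"
  obtains t where "t \<in> W" "tgt C t = src C a" "a \<cdot> t = b \<cdot> t"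
proof -
  have "w \<cdot> u \<cdot> a = w \<cdot> u \<cdot> b"
    using assms by simp
  then show ?thesis
    using CF3[OF assms(1), of a "src C a" b] assms that by (auto simp: hom_def)
qed

lemma cancel_W:
  assumes "w \<in> W" "a \<in> Arr C" "b \<in> Arr C"
    "tgt C a = src C w" "tgt C b = src C w" "src C a = src C b" "w \<cdot> a = w \<cdot> b"
  obtains t where "t \<in> W" "tgt C t = src C a" "a \<cdot> t = b \<cdot> t"
  using CF3[OF assms(1), of a "src C a" b] assms that by (auto simp: hom_def)

lemma frac_relD:
  assumes "frac_rel C W A B R"
  shows "(x, y) \<in> R \<Longrightarrow> x \<in> Arr C" "(x, y) \<in> R \<Longrightarrow> y \<in> Arr C" "(x, y) \<in> R \<Longrightarrow> src C y = src C x"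
    "(x, y) \<in> R \<Longrightarrow> tgt C x = A" "(x, y) \<in> R \<Longrightarrow> tgt C y = B"
  using assms unfolding frac_rel_def by auto

lemma frac_rel_refine:
  "frac_rel C W A B R \<Longrightarrow> (x, y) \<in> R \<Longrightarrow> t \<in> Arr C \<Longrightarrow> tgt C t = src C x \<Longrightarrow> (x \<cdot> t, y \<cdot> t) \<in> R"
  unfolding frac_rel_def by blast

lemma frac_rel_total:
  assumes "frac_rel C W A B R" "x \<in> Arr C" "tgt C x = A"
  obtains t y where "t \<in> W" "tgt C t = src C x" "(x \<cdot> t, y) \<in> R"
  using assms unfolding frac_rel_def by blast

lemma frac_rel_single:
  assumes "frac_rel C W A B R" "(x, y) \<in> R" "(x, z) \<in> R"
  obtains t where "t \<in> W" "tgt C t = src C x" "y \<cdot> t = z \<cdot> t"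
  using assms unfolding frac_rel_def by blast

lemma span_relI: "s \<in> Arr C \<Longrightarrow> tgt C s = src C w \<Longrightarrow> x = w \<cdot> s \<Longrightarrow> y = f \<cdot> s \<Longrightarrow> (x, y) \<in> span_rel C (w, f)"
  unfolding span_rel_def by blast

text \<open>Totality is the Ore condition against \<open>w\<close>, single-valuedness is
  cancellation of \<open>w\<close>.\<close>

lemma frac_rel_span_rel:
  assumes "w \<in> W" "f \<in> Arr C" "src C f = src C w"
  shows "frac_rel C W (tgt C w) (tgt C f) (span_rel C (w, f))"
  unfolding frac_rel_def
proof (intro conjI allI ballI impI)
  show "case p of (x, y) \<Rightarrow> x \<in> Arr C \<and> y \<in> Arr C \<and> src C x = src C y \<and> tgt C x = tgt C w \<and> tgt C y = tgt C f"
    if "p \<in> span_rel C (w, f)" for p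
    using that assms by (auto simp: span_rel_def)
  show "case p of (x, y) \<Rightarrow> \<forall>t \<in> Arr C. tgt C t = src C x \<longrightarrow> (x \<cdot> t, y \<cdot> t) \<in> span_rel C (w, f)"
    if "p \<in> span_rel C (w, f)" for p
  proof -
    obtain s where "p = (w \<cdot> s, f \<cdot> s)" "s \<in> Arr C" "tgt C s = src C w"
      using \<open>p \<in> _\<close> by (auto simp: span_rel_def)
    then show ?thesis
      using assms by (auto intro!: span_relI[OF _ _ refl refl])
  qed
  show "\<exists>t \<in> W. \<exists>y. tgt C t = src C x \<and> (x \<cdot> t, y) \<in> span_rel C (w, f)"
    if x: "x \<in> Arr C" "tgt C x = tgt C w" for x
  proof -
    obtain t g where "t \<in> W" "g \<in> Arr C" "tgt C t = src C x" "tgt C g = src C w" "x \<cdot> t = w \<cdot> g"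
      using ore[OF x(1) assms(1) x(2)] by metis
    then have "(x \<cdot> t, f \<cdot> g) \<in> span_rel C (w, f)"
      by (intro span_relI) auto
    with \<open>t \<in> W\<close> \<open>tgt C t = src C x\<close> show ?thesis
      by blast
  qed
  show "\<exists>t \<in> W. tgt C t = src C x \<and> y \<cdot> t = z \<cdot> t"
    if "(x, y) \<in> span_rel C (w, f)" "(x, z) \<in> span_rel C (w, f)" for x y z
  proof -
    obtain r s where rs: "x = w \<cdot> r" "y = f \<cdot> r" "r \<in> Arr C" "tgt C r = src C w"
      "x = w \<cdot> s" "z = f \<cdot> s" "s \<in> Arr C" "tgt C s = src C w"
      using \<open>(x, y) \<in> _\<close> \<open>(x, z) \<in> _\<close> unfolding span_rel_def by blast
    moreover have "src C r = src C s"
      using rs(1,3-5,7,8) assms(1) src_cmp[of r w] src_cmp[of s w] by auto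
    moreover have "w \<cdot> r = w \<cdot> s"
      using rs by simp
    ultimately obtain t where t: "t \<in> W" "tgt C t = src C r" "r \<cdot> t = s \<cdot> t"
      using cancel_W[OF assms(1) rs(3,7,4,8)] by metis
    have "y \<cdot> t = z \<cdot> t"
      using rs \<open>src C r = src C s\<close> assms t by (simp only: assoc W_Arr)
    then show ?thesis
      using rs(1,3,4) assms t by (intro bexI[of _ t]) auto
  qed
qed

text \<open>For totality, refine once to enter \<open>R\<close> and once more to enter
  \<open>S\<close>, transporting the pair in \<open>R\<close> along the second refinement.
  Single-valuedness also takes one refinement per factor.\<close>

lemma frac_rel_relcomp:
  assumes R: "frac_rel C W A B R" and S: "frac_rel C W B D S"
  shows "frac_rel C W A D (R O S)"
  unfolding frac_rel_def
proof (intro conjI allI ballI impI)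
  show "case p of (x, y) \<Rightarrow> x \<in> Arr C \<and> y \<in> Arr C \<and> src C x = src C y \<and> tgt C x = A \<and> tgt C y = D"
    if "p \<in> R O S" for p
    using that frac_relD[OF R] frac_relD[OF S] by auto
  show "case p of (x, y) \<Rightarrow> \<forall>t \<in> Arr C. tgt C t = src C x \<longrightarrow> (x \<cdot> t, y \<cdot> t) \<in> R O S"
    if "p \<in> R O S" for p
    using that frac_rel_refine[OF R] frac_rel_refine[OF S] frac_relD(3)[OF R] by (auto intro!: relcompI)
  show "\<exists>t \<in> W. \<exists>y. tgt C t = src C x \<and> (x \<cdot> t, y) \<in> R O S" if x: "x \<in> Arr C" "tgt C x = A" for x
  proof -
    obtain t y where t: "t \<in> W" "tgt C t = src C x" "(x \<cdot> t, y) \<in> R"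
      using frac_rel_total[OF R x] .
    obtain t' z where t': "t' \<in> W" "tgt C t' = src C y" "(y \<cdot> t', z) \<in> S"
      using frac_rel_total[OF S, of y] frac_relD[OF R t(3)] by metis
    have "src C y = src C t"
      using frac_relD[OF R t(3)] t x by simp
    then have "(x \<cdot> (t \<cdot> t'), y \<cdot> t') \<in> R"
      using frac_rel_refine[OF R t(3), of t'] t t' x by simp
    then show ?thesis
      using t t' x \<open>src C y = src C t\<close> by (intro bexI[of _ "t \<cdot> t'"]) auto
  qed
  show "\<exists>t \<in> W. tgt C t = src C x \<and> y \<cdot> t = z \<cdot> t" if "(x, y) \<in> R O S" "(x, z) \<in> R O S" for x y z
  proof -
    obtain y' z' where y': "(x, y') \<in> R" "(y', y) \<in> S" and z': "(x, z') \<in> R" "(z', z) \<in> S"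
      using \<open>(x, y) \<in> _\<close> \<open>(x, z) \<in> _\<close> by blast
    obtain t where t: "t \<in> W" "tgt C t = src C x" "y' \<cdot> t = z' \<cdot> t"
      using frac_rel_single[OF R y'(1) z'(1)] .
    note src = frac_relD(3)[OF R y'(1)] frac_relD(3)[OF R z'(1)] frac_relD(3)[OF S y'(2)] frac_relD(3)[OF S z'(2)]
    have "(y' \<cdot> t, y \<cdot> t) \<in> S" "(y' \<cdot> t, z \<cdot> t) \<in> S"
      using frac_rel_refine[OF S y'(2), of t] frac_rel_refine[OF S z'(2), of t] t src by auto
    then obtain r where "r \<in> W" "tgt C r = src C (y' \<cdot> t)" "y \<cdot> t \<cdot> r = z \<cdot> t \<cdot> r"
      using frac_rel_single[OF S] by blast
    then show ?thesis
      using t src frac_relD(1,2)[OF R y'(1)] frac_relD(2)[OF R z'(1)] frac_relD(2)[OF S y'(2)] frac_relD(2)[OF S z'(2)]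
      by (intro bexI[of _ "t \<cdot> r"]) auto
  qed
qed

lemma frac_rel_subset_sat:
  assumes R: "frac_rel C W A B R"
  shows "R \<subseteq> sat C W R"
proof (clarify)
  fix x y assume "(x, y) \<in> R"
  then show "(x, y) \<in> sat C W R"
    using frac_relD[OF R] unfolding sat_def by (auto intro!: bexI[of _ "idn C (src C x)"])
qed

text \<open>The refinements that witness membership differ from pair to pair. Ore squares pull one
  back along a restriction, or bring two of them to a common one, before the properties of
  \<open>R\<close> are used.\<close>

lemma frac_rel_sat:
  assumes R: "frac_rel C W A B R"
  shows "frac_rel C W A B (sat C W R)"
  unfolding frac_rel_def
proof (intro conjI allI ballI impI)
  have sat: "(x, y) \<in> sat C W R \<Longrightarrow> x \<in> Arr C \<and> y \<in> Arr C \<and> src C y = src C x \<and> tgt C x = A \<and> tgt C y = B" for x y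
  proof -
    assume "(x, y) \<in> sat C W R"
    then obtain t where "x \<in> Arr C" "y \<in> Arr C" "src C x = src C y" "t \<in> W" "tgt C t = src C x"
      "(x \<cdot> t, y \<cdot> t) \<in> R"
      unfolding sat_def by blast
    then show ?thesis
      using frac_relD(4,5)[OF R, of "x \<cdot> t" "y \<cdot> t"] by simp
  qed
  then show "case p of (x, y) \<Rightarrow> x \<in> Arr C \<and> y \<in> Arr C \<and> src C x = src C y \<and> tgt C x = A \<and> tgt C y = B"
    if "p \<in> sat C W R" for p
    using that by auto
  show "case p of (x, y) \<Rightarrow> \<forall>t \<in> Arr C. tgt C t = src C x \<longrightarrow> (x \<cdot> t, y \<cdot> t) \<in> sat C W R"
    if p: "p \<in> sat C W R" for p
  proof -
    obtain x y where xy: "p = (x, y)" "(x, y) \<in> sat C W R"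
      using p by (cases p) auto
    then obtain r where r: "r \<in> W" "tgt C r = src C x" "(x \<cdot> r, y \<cdot> r) \<in> R"
      unfolding sat_def by auto
    have "(x \<cdot> t, y \<cdot> t) \<in> sat C W R" if t: "t \<in> Arr C" "tgt C t = src C x" for t
    proof -
      obtain q g where q: "q \<in> W" "g \<in> Arr C" "tgt C q = src C t" "tgt C g = src C r" "src C g = src C q" "t \<cdot> q = r \<cdot> g"
        using ore[of t r] t r by metis
      have "(x \<cdot> r \<cdot> g, y \<cdot> r \<cdot> g) \<in> R"
        using frac_rel_refine[OF R r(3)] q r sat[OF xy(2)] by simp
      then show ?thesis
        using q r t sat[OF xy(2)] unfolding sat_def by (auto intro!: bexI[of _ q])
    qed
    then show ?thesis
      by (simp add: xy)
  qed
  show "\<exists>t \<in> W. \<exists>y. tgt C t = src C x \<and> (x \<cdot> t, y) \<in> sat C W R" if x: "x \<in> Arr C" "tgt C x = A" for x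
    using frac_rel_total[OF R x] frac_rel_subset_sat[OF R] by blast
  show "\<exists>t \<in> W. tgt C t = src C x \<and> y \<cdot> t = z \<cdot> t"
    if xy: "(x, y) \<in> sat C W R" and xz: "(x, z) \<in> sat C W R" for x y z
  proof -
    obtain r where r: "r \<in> W" "tgt C r = src C x" "(x \<cdot> r, y \<cdot> r) \<in> R"
      using xy unfolding sat_def by auto
    obtain s where s: "s \<in> W" "tgt C s = src C x" "(x \<cdot> s, z \<cdot> s) \<in> R"
      using xz unfolding sat_def by auto
    obtain q g where q: "q \<in> W" "g \<in> Arr C" "tgt C q = src C r" "tgt C g = src C s" "src C g = src C q" "r \<cdot> q = s \<cdot> g"
      using ore[of r s] r s W_Arr by metis
    define p where "p = r \<cdot> q"
    have p: "p \<in> W" "tgt C p = src C x"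
      unfolding p_def using q(1,3) r(1,2) by simp_all
    have "(x \<cdot> (r \<cdot> q), y \<cdot> (r \<cdot> q)) \<in> R" "(x \<cdot> (r \<cdot> q), z \<cdot> (r \<cdot> q)) \<in> R"
      using frac_rel_refine[OF R r(3), of q] frac_rel_refine[OF R s(3), of g] q r s sat[OF xy] sat[OF xz] by auto
    then obtain t where t: "t \<in> W" "tgt C t = src C (x \<cdot> p)" "y \<cdot> p \<cdot> t = z \<cdot> p \<cdot> t"
      using frac_rel_single[OF R] unfolding p_def by blast
    then show ?thesis
      using p sat[OF xy] sat[OF xz] by (intro bexI[of _ "p \<cdot> t"]) auto
  qed
qed

text \<open>As for functions: a total relation inside a single-valued one exhausts it, here up to
  refinement. Equalities of fractions thus reduce to inclusions.\<close>

lemma sat_eqI: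
  assumes R: "frac_rel C W A B R" and S: "frac_rel C W A B S" and sub: "R \<subseteq> S"
  shows "sat C W R = sat C W S"
proof
  show "sat C W R \<subseteq> sat C W S"
    using sub unfolding sat_def by blast
  show "sat C W S \<subseteq> sat C W R"
  proof clarify
    fix x y assume xy: "(x, y) \<in> sat C W S"
    then obtain t where t: "t \<in> W" "tgt C t = src C x" "(x \<cdot> t, y \<cdot> t) \<in> S" and
      x: "x \<in> Arr C" "y \<in> Arr C" "src C x = src C y"
      unfolding sat_def by auto
    have "x \<cdot> t \<in> Arr C" "tgt C (x \<cdot> t) = A"
      using frac_relD[OF S t(3)] by auto
    then obtain r z where r: "r \<in> W" "tgt C r = src C (x \<cdot> t)" "(x \<cdot> t \<cdot> r, z) \<in> R"
      using frac_rel_total[OF R] by blast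
    have "(x \<cdot> t \<cdot> r, y \<cdot> t \<cdot> r) \<in> S"
      using frac_rel_refine[OF S t(3)] r by simp
    then obtain q where q: "q \<in> W" "tgt C q = src C (x \<cdot> t \<cdot> r)" "z \<cdot> q = y \<cdot> t \<cdot> r \<cdot> q"
      using frac_rel_single[OF S subsetD[OF sub r(3)]] by blast
    have "(x \<cdot> t \<cdot> r \<cdot> q, y \<cdot> t \<cdot> r \<cdot> q) \<in> R"
      using frac_rel_refine[OF R r(3), of q] q by simp
    then show "(x, y) \<in> sat C W R"
      using x t r q unfolding sat_def by (auto intro!: bexI[of _ "t \<cdot> (r \<cdot> q)"])
  qed
qed

text \<open>Saturating before composing changes nothing in the end, so that composition of fractions
  inherits associativity from \<open>O\<close>.\<close>

lemma sat_relcomp: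
  assumes "frac_rel C W A B R" "frac_rel C W B D S"
  shows "sat C W (sat C W R O sat C W S) = sat C W (R O S)"
  using sat_eqI[OF frac_rel_relcomp[OF assms] frac_rel_relcomp[OF frac_rel_sat frac_rel_sat, OF assms]
      relcomp_mono[OF frac_rel_subset_sat frac_rel_subset_sat, OF assms]] by simp

lemma frac_rel_span: "s \<in> spans C W \<Longrightarrow> frac_rel C W (tgt C (fst s)) (tgt C (snd s)) (span_rel C s)"
  using frac_rel_span_rel by (auto simp: spans_def)

text \<open>One pair of \<open>R\<close> whose first component lies in \<open>W\<close> generates
  \<open>R\<close> up to saturation. Most identifications of fractions below come down to exhibiting
  such a pair.\<close>

lemma span_rel_common:
  assumes R: "frac_rel C W A B R" and xy: "(x, y) \<in> R" "x \<in> W"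
  shows "sat C W (span_rel C (x, y)) = sat C W R"
proof (rule sat_eqI[OF _ R])
  show "frac_rel C W A B (span_rel C (x, y))"
    using frac_rel_span_rel[of x y] xy frac_relD[OF R xy(1)] by simp
  show "span_rel C (x, y) \<subseteq> R"
    using frac_rel_refine[OF R xy(1)] by (auto simp: span_rel_def)
qed

text \<open>A representative of a 2-cell amounts to a pair, with first component in
  \<open>W\<close>, that is common to both relations. If the saturations agree, such a pair is found
  by starting at the identity of the domain and refining.\<close>

lemma fraction_eq_iff:
  assumes a: "a \<in> spans C W" and b: "b \<in> spans C W"
    and "tgt C (fst a) = tgt C (fst b)" "tgt C (snd a) = tgt C (snd b)"
  shows "fraction C W a = fraction C W b \<longleftrightarrow> (\<exists>p. fcell_rep C W a b p)"
proof
  note Ra = frac_rel_span[OF a]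
  have Rb: "frac_rel C W (tgt C (fst a)) (tgt C (snd a)) (span_rel C b)"
    using frac_rel_span[OF b] assms by simp
  obtain w f v g where ab: "a = (w, f)" "b = (v, g)" by fastforce
  have W: "w \<in> W" "v \<in> W" "f \<in> Arr C" "g \<in> Arr C" "src C f = src C w" "src C g = src C v"
    using a b by (auto simp: ab spans_def)
  {
    assume eq: "fraction C W a = fraction C W b"
    obtain t y where t: "t \<in> W" "tgt C t = tgt C w" "(idn C (tgt C w) \<cdot> t, y) \<in> span_rel C a"
      using frac_rel_total[OF Ra, of "idn C (tgt C w)"] W by (auto simp: ab)
    then have ty: "(t, y) \<in> span_rel C a"
      by simp
    then have "(t, y) \<in> fraction C W b"
      using frac_rel_subset_sat[OF Ra] eq by blast
    then obtain r where r: "r \<in> W" "tgt C r = src C t" "(t \<cdot> r, y \<cdot> r) \<in> span_rel C b"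
      unfolding sat_def by auto
    have "(t \<cdot> r, y \<cdot> r) \<in> span_rel C a"
      using frac_rel_refine[OF Ra ty] r by simp
    then obtain u1 where u1: "u1 \<in> Arr C" "tgt C u1 = src C w" "t \<cdot> r = w \<cdot> u1" "y \<cdot> r = f \<cdot> u1"
      by (auto simp: span_rel_def ab)
    obtain u2 where u2: "u2 \<in> Arr C" "tgt C u2 = src C v" "t \<cdot> r = v \<cdot> u2" "y \<cdot> r = g \<cdot> u2"
      using r by (auto simp: span_rel_def ab)
    have "src C u1 = src C u2"
      using u1 u2 W by (metis src_cmp W_Arr)
    moreover have "w \<cdot> u1 \<in> W"
      using t r u1(3) W_cmp by metis
    ultimately have "fcell_rep C W a b (u1, u2)"
      using u1 u2 by (auto simp: fcell_rep_def side_rep_def ab hom_def)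
    then show "\<exists>p. fcell_rep C W a b p" ..
  }
  assume "\<exists>p. fcell_rep C W a b p"
  then obtain u1 u2 where u: "u1 \<in> Arr C" "u2 \<in> Arr C" "src C u1 = src C u2" "tgt C u1 = src C w"
    "tgt C u2 = src C v" "w \<cdot> u1 = v \<cdot> u2" "w \<cdot> u1 \<in> W" "f \<cdot> u1 = g \<cdot> u2"
    by (auto simp: fcell_rep_def side_rep_def ab hom_def)
  have "(w \<cdot> u1, f \<cdot> u1) \<in> span_rel C a" "(w \<cdot> u1, f \<cdot> u1) \<in> span_rel C b"
    using u by (auto simp: ab intro: span_relI)
  then show "fraction C W a = fraction C W b"
    using span_rel_common[OF Ra] span_rel_common[OF Rb] u by metis
qed

end

definition fraction_arr :: "('o, 'a) cat \<Rightarrow> 'a set \<Rightarrow> 'a span \<Rightarrow> 'o \<times> ('a \<times> 'a) set \<times> 'o" where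
  "fraction_arr C W s = (tgt C (fst s), fraction C W s, tgt C (snd s))"

text \<open>The category \<open>C[W^-1]\<close> in relational form. \<open>R O S\<close> follows
  \<open>R\<close> by \<open>S\<close>, and the composite of saturated relations is saturated
  anew.\<close>

definition fraction_cat :: "('o, 'a) cat \<Rightarrow> 'a set \<Rightarrow> ('o, 'o \<times> ('a \<times> 'a) set \<times> 'o) cat" where
  "fraction_cat C W = \<lparr>Obj = Obj C,
     Arr = fraction_arr C W ` spans C W,
     src = \<lambda>(A, R, B). A, tgt = \<lambda>(A, R, B). B,
     idn = \<lambda>A. (A, fraction C W (idn C A, idn C A), A),
     cmp = \<lambda>(B, S, D) (A, R, B'). (A, sat C W (R O S), D)\<rparr>"

section \<open>Composition of fractions\<close>

context calculus_of_fractions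
begin

text \<open>The Ore square yields the pair \<open>(w \<cdot> q, g \<cdot> h)\<close> of the
  composite relation, which generates it by \<open>span_rel_common\<close>.\<close>

lemma exists_span_comp:
  assumes s: "s \<in> spans C W" and t: "t \<in> spans C W" and st: "tgt C (snd s) = tgt C (fst t)"
  shows "\<exists>r \<in> spans C W. tgt C (fst r) = tgt C (fst s) \<and> tgt C (snd r) = tgt C (snd t) \<and>
    sat C W (span_rel C s O span_rel C t) = fraction C W r"
proof -
  note R = frac_rel_relcomp[OF frac_rel_span[OF s] frac_rel_span[OF t, folded st]]
  obtain w f v g where [simp]: "s = (w, f)" "t = (v, g)" by fastforce
  obtain q h where q: "q \<in> W" "h \<in> Arr C" "tgt C q = src C f" "tgt C h = src C v" "src C h = src C q" "f \<cdot> q = v \<cdot> h"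
    using ore[of f v] s t st by (auto simp: spans_def)
  have "(w \<cdot> q, f \<cdot> q) \<in> span_rel C s" "(f \<cdot> q, g \<cdot> h) \<in> span_rel C t"
    using q s t by (auto simp: spans_def intro: span_relI[of q] span_relI[of h])
  then have "(w \<cdot> q, g \<cdot> h) \<in> span_rel C s O span_rel C t"
    by blast
  then show ?thesis
    using span_rel_common[OF R] q s t by (intro bexI[of _ "(w \<cdot> q, g \<cdot> h)"]) (auto simp: spans_def)
qed

lemma idn_span_rel: "A \<in> Obj C \<Longrightarrow> span_rel C (idn C A, idn C A) = {(x, x) | x. x \<in> Arr C \<and> tgt C x = A}"
  by (simp add: span_rel_def cong: rev_conj_cong)

lemma idn_span [simp]: "A \<in> Obj C \<Longrightarrow> (idn C A, idn C A) \<in> spans C W"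
  by (simp add: spans_def)

lemma fraction_arr_comp:
  assumes s: "s \<in> spans C W" and t: "t \<in> spans C W" and st: "tgt C (snd s) = tgt C (fst t)"
  shows "fraction_arr C W t \<cdot>\<^bsub>fraction_cat C W\<^esub> fraction_arr C W s =
    (tgt C (fst s), sat C W (span_rel C s O span_rel C t), tgt C (snd t))"
  using sat_relcomp[OF frac_rel_span[OF s] frac_rel_span[OF t, folded st]]
  by (simp add: fraction_arr_def fraction_cat_def)

text \<open>With inner saturations removed by \<open>sat_relcomp\<close>, associativity and the unit
  laws are those of relational composition.\<close>

lemma fraction_cat_category: "category (fraction_cat C W)"
proof -
  let ?L = "fraction_cat C W"
  have arr: "f \<in> Arr ?L \<longleftrightarrow> (\<exists>s \<in> spans C W. f = fraction_arr C W s)" for f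
    by (auto simp: fraction_cat_def)
  have ends: "src ?L (fraction_arr C W s) = tgt C (fst s)" "tgt ?L (fraction_arr C W s) = tgt C (snd s)" for s
    by (simp_all add: fraction_cat_def fraction_arr_def)
  have hom: "f \<in> hom ?L A B \<longleftrightarrow> (\<exists>s \<in> spans C W. f = fraction_arr C W s \<and> tgt C (fst s) = A \<and> tgt C (snd s) = B)" for f A B
    by (auto simp: hom_def arr ends)
  have idn: "idn ?L A = fraction_arr C W (idn C A, idn C A)" if "A \<in> Obj C" for A
    using that by (simp add: fraction_cat_def fraction_arr_def)
  have Obj: "Obj ?L = Obj C"
    by (simp add: fraction_cat_def)
  note cmp = fraction_arr_comp
  have id: "sat C W (span_rel C (idn C A, idn C A) O R) = sat C W R"
    "sat C W (R O span_rel C (idn C B, idn C B)) = sat C W R"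
    if "frac_rel C W A B R" "A \<in> Obj C" "B \<in> Obj C" for A B R
  proof -
    have "span_rel C (idn C A, idn C A) O R = R" "R O span_rel C (idn C B, idn C B) = R"
      using that frac_relD[OF that(1)] by (auto simp: idn_span_rel)
    then show "sat C W (span_rel C (idn C A, idn C A) O R) = sat C W R"
      "sat C W (R O span_rel C (idn C B, idn C B)) = sat C W R"
      by simp_all
  qed
  show ?thesis
  proof (unfold_locales, unfold Obj, goal_cases)
    case (1 f) then show ?case by (auto simp: arr ends spans_def)
  next
    case (2 f) then show ?case by (auto simp: arr ends spans_def)
  next
    case (3 A) then show ?case by (auto simp: hom idn intro!: bexI[of _ "(idn C A, idn C A)"])
  next
    case (4 f A B g D)
    then obtain s t where st: "s \<in> spans C W" "t \<in> spans C W" "f = fraction_arr C W s" "g = fraction_arr C W t"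
      "tgt C (fst s) = A" "tgt C (snd s) = B" "tgt C (fst t) = B" "tgt C (snd t) = D"
      by (auto simp: hom)
    then obtain r where "r \<in> spans C W" "tgt C (fst r) = A" "tgt C (snd r) = D"
      "sat C W (span_rel C s O span_rel C t) = fraction C W r"
      using exists_span_comp[of s t] by auto
    then show ?case
      using st cmp[of s t] by (auto simp: hom fraction_arr_def)
  next
    case (5 f A B)
    then obtain s where "s \<in> spans C W" "f = fraction_arr C W s" "tgt C (fst s) = A" "tgt C (snd s) = B"
      by (auto simp: hom)
    then show ?case
      using id(1)[of A B] frac_rel_span[of s] cmp[of "(idn C A, idn C A)" s] idn[of A]
      by (auto simp: fraction_arr_def spans_def)
  next
    case (6 f A B)
    then obtain s where "s \<in> spans C W" "f = fraction_arr C W s" "tgt C (fst s) = A" "tgt C (snd s) = B"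
      by (auto simp: hom)
    then show ?case
      using id(2)[of A B] frac_rel_span[of s] cmp[of s "(idn C B, idn C B)"] idn[of B]
      by (auto simp: fraction_arr_def spans_def)
  next
    case (7 f A B g D h E)
    then obtain r s t where st: "r \<in> spans C W" "s \<in> spans C W" "t \<in> spans C W"
      "f = fraction_arr C W r" "g = fraction_arr C W s" "h = fraction_arr C W t"
      "tgt C (fst r) = A" "tgt C (snd r) = B" "tgt C (fst s) = B" "tgt C (snd s) = D"
      "tgt C (fst t) = D" "tgt C (snd t) = E"
      by (auto simp: hom)
    note R = frac_rel_span[OF st(1), unfolded st(7,8)] frac_rel_span[OF st(2), unfolded st(9,10)]
      frac_rel_span[OF st(3), unfolded st(11,12)]
    have "sat C W (fraction C W r O sat C W (span_rel C s O span_rel C t)) =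
        sat C W (sat C W (span_rel C r O span_rel C s) O fraction C W t)"
      using sat_relcomp[OF R(1) frac_rel_relcomp[OF R(2,3)]] sat_relcomp[OF frac_rel_relcomp[OF R(1,2)] R(3)]
      by (simp add: O_assoc)
    then show ?case
      using st cmp[of r s] cmp[of s t] by (simp add: fraction_arr_def) (simp add: fraction_cat_def)
  qed
qed

end

section \<open>The double category of arrows in \<open>W\<close>\<close>

text \<open>A vertical arrow given by the set of all its representatives. That these form one class
  is \<open>ver_class_eq\<close>; the vertical arrow becomes a function of its two ends.\<close>

definition side :: "('o, 'a) cat \<Rightarrow> 'a set \<Rightarrow> 'a \<Rightarrow> 'a \<Rightarrow> 'a ver" where
  "side C W w1 w2 = (w1, {p. side_rep C W w1 w2 p}, w2)"

text \<open>As for \<open>side\<close>, all representatives form one class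
  (\<open>cell_class_eq\<close>) as soon as there are any.\<close>

definition full_cell :: "('o, 'a) cat \<Rightarrow> 'a set \<Rightarrow> 'a hor \<Rightarrow> 'a hor \<Rightarrow> 'a cell" where
  "full_cell C W = (\<lambda>(w1, f1, w1') (w2, f2, w2').
     \<lparr>ctop = (w1, f1, w1'), cbot = (w2, f2, w2'), cleft = side C W w1 w2, cright = side C W w1' w2',
      creps = {p. cell_rep C (w1, f1, w1') (w2, f2, w2') (side C W w1 w2) (side C W w1' w2') p}\<rparr>)"

text \<open>An object \<open>w\<close> of \<open>C{W}\<close> lies over its codomain, so an arrow
  \<open>f\<close> between the domains is read as the fraction of \<open>w' \<cdot> f\<close> by
  \<open>w\<close>.\<close>

definition hor_fraction :: "('o, 'a) cat \<Rightarrow> 'a set \<Rightarrow> 'a hor \<Rightarrow> 'o \<times> ('a \<times> 'a) set \<times> 'o" where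
  "hor_fraction C W = (\<lambda>(w, f, w'). fraction_arr C W (w, w' \<cdot>\<^bsub>C\<^esub> f))"

text \<open>For the operations of \<open>C{W}\<close> that are unions over all choices: the first
  premise asks for one admissible choice, the second for independence of it.\<close>

lemma Union_constant: "B \<in> A \<Longrightarrow> (\<And>X. X \<in> A \<Longrightarrow> X = S) \<Longrightarrow> \<Union> A = S"
  by blast

section \<open>Vertical arrows of \<open>C{W}\<close>\<close>

context calculus_of_fractions
begin

text \<open>Composites are kept associated to the right, where \<open>f \<cdot> a\<close> no longer
  occurs as a subterm; a commuting square is therefore used in this extended form.\<close>

lemma square_ext: "f \<cdot> a = g \<cdot> b \<Longrightarrow> f \<in> Arr C \<Longrightarrow> a \<in> Arr C \<Longrightarrow> g \<in> Arr C \<Longrightarrow> b \<in> Arr C \<Longrightarrow>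
    x \<in> Arr C \<Longrightarrow> src C f = tgt C a \<Longrightarrow> src C g = tgt C b \<Longrightarrow> tgt C x = src C a \<Longrightarrow> src C b = src C a \<Longrightarrow>
    f \<cdot> (a \<cdot> x) = g \<cdot> (b \<cdot> x)"
  by (metis assoc)

lemma side_rep_iff: "side_rep C W w1 w2 (u1, u2) \<longleftrightarrow> u1 \<in> Arr C \<and> u2 \<in> Arr C \<and> src C u2 = src C u1 \<and>
    tgt C u1 = src C w1 \<and> tgt C u2 = src C w2 \<and> w1 \<cdot> u1 = w2 \<cdot> u2 \<and> w1 \<cdot> u1 \<in> W"
  by (auto simp: side_rep_def hom_def)

lemma side_rep_arr:
  assumes "side_rep C W w1 w2 (u1, u2)"
  shows "u1 \<in> Arr C" "u2 \<in> Arr C" "src C u2 = src C u1" "tgt C u1 = src C w1" "tgt C u2 = src C w2"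
  using assms by (auto simp: side_rep_iff)

lemma side_rep_eq:
  assumes "side_rep C W w1 w2 (u1, u2)"
  shows "w1 \<cdot> u1 = w2 \<cdot> u2" "w1 \<cdot> u1 \<in> W" "w2 \<cdot> u2 \<in> W"
  using assms by (auto simp: side_rep_iff)

lemma side_rep_ext:
  assumes "side_rep C W w1 w2 (u1, u2)" "w1 \<in> W" "w2 \<in> W" "x \<in> Arr C" "tgt C x = src C u1"
  shows "w1 \<cdot> (u1 \<cdot> x) = w2 \<cdot> (u2 \<cdot> x)"
  using square_ext[OF side_rep_eq(1)[OF assms(1)]] side_rep_arr[OF assms(1)] assms(2-) by simp

lemma W_cmp_assoc:
  assumes "w \<cdot> u \<in> W" "t \<in> W" "w \<in> Arr C" "u \<in> Arr C" "src C w = tgt C u" "tgt C t = src C u"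
  shows "w \<cdot> (u \<cdot> t) \<in> W"
  using CF1_comp[OF assms(2,1)] assms(2-) by simp

lemma side_rep_W:
  assumes "side_rep C W w1 w2 (u1, u2)" "w1 \<in> W" "w2 \<in> W" "t \<in> W" "tgt C t = src C u1"
  shows "w1 \<cdot> u1 \<cdot> t \<in> W" "w2 \<cdot> u2 \<cdot> t \<in> W"
  using CF1_comp[OF assms(4) side_rep_eq(2)[OF assms(1)]] CF1_comp[OF assms(4) side_rep_eq(3)[OF assms(1)]]
    side_rep_arr[OF assms(1)] assms(2-) by auto

text \<open>An Ore square against an arrow \<open>b\<close> of which only \<open>w \<cdot> b\<close>
  is known to lie in \<open>W\<close>: complete the square for \<open>w \<cdot> a\<close> and
  \<open>w \<cdot> b\<close>, then cancel \<open>w\<close> by one more refinement.\<close>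

lemma ore_cancel:
  assumes "w \<in> W" "w \<cdot> b \<in> W" "a \<in> Arr C" "b \<in> Arr C" "tgt C a = src C w" "tgt C b = src C w"
  obtains t g where "t \<in> W" "g \<in> Arr C" "tgt C t = src C a" "tgt C g = src C b" "src C g = src C t" "a \<cdot> t = b \<cdot> g"
proof -
  obtain t g where t: "t \<in> W" "g \<in> Arr C" "tgt C t = src C a" "tgt C g = src C b" "src C g = src C t"
    "w \<cdot> a \<cdot> t = w \<cdot> b \<cdot> g"
    using ore[of "w \<cdot> a" "w \<cdot> b"] assms by auto
  obtain r where r: "r \<in> W" "tgt C r = src C t" "a \<cdot> t \<cdot> r = b \<cdot> g \<cdot> r"
    using cancel_W[of w "a \<cdot> t" "b \<cdot> g"] assms t by auto
  show ?thesis
    using that[of "t \<cdot> r" "g \<cdot> r"] assms t r by simp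
qed

lemma side_rep_refine:
  assumes "side_rep C W w1 w2 (u1, u2)" "w1 \<in> W" "w2 \<in> W" "t \<in> W" "tgt C t = src C u1"
  shows "side_rep C W w1 w2 (u1 \<cdot> t, u2 \<cdot> t)"
  unfolding side_rep_iff
  using side_rep_arr[OF assms(1)] assms(2-) side_rep_ext[OF assms(1-3), of t]
    W_cmp_assoc[OF side_rep_eq(2)[OF assms(1)], of t] by simp

lemma side_rep_ex:
  assumes "w1 \<in> W" "w2 \<in> W" "tgt C w1 = tgt C w2"
  obtains u1 u2 where "side_rep C W w1 w2 (u1, u2)"
proof -
  obtain t g where "t \<in> W" "g \<in> Arr C" "tgt C t = src C w1" "tgt C g = src C w2" "src C g = src C t" "w1 \<cdot> t = w2 \<cdot> g"
    using ore[OF W_Arr[OF assms(1)] assms(2,3)] .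
  then show ?thesis
    using that[of t g] assms W_cmp[of t w1] by (simp add: side_rep_iff)
qed

text \<open>First match the first legs. The second legs then agree after composition with
  \<open>w2\<close>, and cancelling it costs one more refinement. This is why there is only one
  vertical arrow between given ends.\<close>

lemma side_rep_common_refinement:
  assumes w: "w1 \<in> W" "w2 \<in> W"
    and u: "side_rep C W w1 w2 (u1, u2)" and v: "side_rep C W w1 w2 (v1, v2)"
  obtains r s where "r \<in> W" "s \<in> Arr C" "src C s = src C r" "tgt C r = src C u1" "tgt C s = src C v1"
    "u1 \<cdot> r = v1 \<cdot> s" "u2 \<cdot> r = v2 \<cdot> s"
proof -
  note uv = side_rep_arr[OF u] side_rep_arr[OF v]
  obtain t g where t: "t \<in> W" "g \<in> Arr C" "tgt C t = src C u1" "tgt C g = src C v1" "src C g = src C t"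
    "u1 \<cdot> t = v1 \<cdot> g"
    using ore_cancel[of w1 v1 u1] uv w side_rep_eq(2)[OF v] by auto
  have "w2 \<cdot> (u2 \<cdot> t) = w2 \<cdot> (v2 \<cdot> g)"
    using side_rep_ext[OF u w, of t] side_rep_ext[OF v w, of g] t by simp
  then obtain q where q: "q \<in> W" "tgt C q = src C t" "u2 \<cdot> t \<cdot> q = v2 \<cdot> g \<cdot> q"
    using cancel_W[of w2 "u2 \<cdot> t" "v2 \<cdot> g"] uv w t(1-5) by auto
  show ?thesis
  proof (rule that)
    show "u1 \<cdot> (t \<cdot> q) = v1 \<cdot> (g \<cdot> q)"
      using square_ext[of u1 t v1 g q] uv t q by simp
    show "u2 \<cdot> (t \<cdot> q) = v2 \<cdot> (g \<cdot> q)"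
      using uv t q by simp
  qed (use uv t q in auto)
qed

lemma side_eq_all:
  assumes "w1 \<in> W" "w2 \<in> W" "side_rep C W w1 w2 p" "side_rep C W w1 w2 q"
  shows "side_eq C W w1 p q"
proof -
  obtain u1 u2 v1 v2 where pq: "p = (u1, u2)" "q = (v1, v2)" by fastforce
  obtain r s where "r \<in> W" "s \<in> Arr C" "src C s = src C r" "tgt C r = src C u1" "tgt C s = src C v1"
    "u1 \<cdot> r = v1 \<cdot> s" "u2 \<cdot> r = v2 \<cdot> s"
    using side_rep_common_refinement[OF assms[unfolded pq]] .
  moreover from this have "w1 \<cdot> u1 \<cdot> r \<in> W"
    using side_rep_W assms by (simp add: pq)
  moreover from calculation have "r \<in> hom C (src C r) (src C u1)" "s \<in> hom C (src C r) (src C v1)"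
    by (simp_all add: hom_def)
  ultimately show ?thesis
    unfolding pq side_eq_def prod.case by blast
qed

lemma ver_class_eq:
  "w1 \<in> W \<Longrightarrow> w2 \<in> W \<Longrightarrow> side_rep C W w1 w2 p \<Longrightarrow> ver_class C W w1 w2 p = {q. side_rep C W w1 w2 q}"
  unfolding ver_class_def using side_eq_all by blast

lemma CW_ver_iff: "v \<in> CW_ver C W \<longleftrightarrow> (\<exists>w1 \<in> W. \<exists>w2 \<in> W. tgt C w1 = tgt C w2 \<and> v = side C W w1 w2)"
proof
  assume "v \<in> CW_ver C W"
  then show "\<exists>w1 \<in> W. \<exists>w2 \<in> W. tgt C w1 = tgt C w2 \<and> v = side C W w1 w2"
    by (auto simp: CW_ver_def side_def ver_class_eq)
next
  assume "\<exists>w1 \<in> W. \<exists>w2 \<in> W. tgt C w1 = tgt C w2 \<and> v = side C W w1 w2"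
  then obtain w1 w2 where w: "w1 \<in> W" "w2 \<in> W" "tgt C w1 = tgt C w2" "v = side C W w1 w2"
    by blast
  then obtain u1 u2 where u: "side_rep C W w1 w2 (u1, u2)"
    using side_rep_ex by blast
  with w show "v \<in> CW_ver C W"
    unfolding CW_ver_def side_def using ver_class_eq[OF w(1,2) u] by blast
qed

lemma CW_ver_id_eq: "w \<in> W \<Longrightarrow> CW_ver_id C W w = side C W w w"
  by (simp add: CW_ver_id_def side_def ver_class_eq side_rep_iff)

lemma side_rep_comp:
  assumes w: "w1 \<in> W" "w2 \<in> W" "w3 \<in> W"
    and u: "side_rep C W w1 w2 (u1, u2)" and v: "side_rep C W w2 w3 (v1, v2)"
    and x: "x \<in> Arr C" "y \<in> Arr C" "src C y = src C x" "tgt C x = src C u1" "tgt C y = src C v1"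
    and eq: "u2 \<cdot> x = v1 \<cdot> y" and W: "w2 \<cdot> u2 \<cdot> x \<in> W"
  shows "side_rep C W w1 w3 (u1 \<cdot> x, v2 \<cdot> y)"
  unfolding side_rep_iff
  using side_rep_arr[OF u] side_rep_arr[OF v] side_rep_ext[OF u w(1,2), of x] side_rep_ext[OF v w(2,3), of y]
    w x eq W by simp

lemma side_rep_comp_ex:
  assumes w: "w1 \<in> W" "w2 \<in> W" "w3 \<in> W"
    and u: "side_rep C W w1 w2 (u1, u2)" and v: "side_rep C W w2 w3 (v1, v2)"
  obtains x y where "x \<in> W" "y \<in> Arr C" "src C y = src C x" "tgt C x = src C u1" "tgt C y = src C v1"
    "u2 \<cdot> x = v1 \<cdot> y" "w2 \<cdot> u2 \<cdot> x \<in> W"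
proof -
  note uv = side_rep_arr[OF u] side_rep_arr[OF v]
  obtain t g where t: "t \<in> W" "g \<in> Arr C" "tgt C t = src C u2" "tgt C g = src C v1" "src C g = src C t" "u2 \<cdot> t = v1 \<cdot> g"
    using ore_cancel[of w2 v1 u2] uv w side_rep_eq(2)[OF v] by auto
  have "w2 \<cdot> u2 \<cdot> t \<in> W"
    using side_rep_W(2)[OF u w(1,2)] uv t by simp
  then show ?thesis
    using that[of t g] uv t by simp
qed

text \<open>Every admissible choice yields a representative of a vertical arrow from
  \<open>w1\<close> to \<open>w3\<close>, and all of these form one class; CF2 provides a
  choice.\<close>

lemma CW_ver_comp_eq:
  assumes w: "w1 \<in> W" "w2 \<in> W" "w3 \<in> W" "tgt C w1 = tgt C w2" "tgt C w2 = tgt C w3"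
  shows "CW_ver_comp C W (side C W w2 w3) (side C W w1 w2) = side C W w1 w3"
proof -
  let ?A = "{ver_class C W w1 w3 (u1 \<cdot> x, v2 \<cdot> y) | u1 u2 v1 v2 x y e.
        (u1, u2) \<in> {p. side_rep C W w1 w2 p} \<and> (v1, v2) \<in> {p. side_rep C W w2 w3 p} \<and>
        x \<in> hom C e (src C u1) \<and> y \<in> hom C e (src C v1) \<and> u2 \<cdot> x = v1 \<cdot> y \<and> w2 \<cdot> u2 \<cdot> x \<in> W}"
  obtain u1 u2 where u: "side_rep C W w1 w2 (u1, u2)"
    using side_rep_ex w by blast
  obtain v1 v2 where v: "side_rep C W w2 w3 (v1, v2)"
    using side_rep_ex w by blast
  obtain x y where x: "x \<in> W" "y \<in> Arr C" "src C y = src C x" "tgt C x = src C u1" "tgt C y = src C v1"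
    "u2 \<cdot> x = v1 \<cdot> y" "w2 \<cdot> u2 \<cdot> x \<in> W"
    using side_rep_comp_ex[OF w(1-3) u v] .
  then have "x \<in> hom C (src C x) (src C u1)" "y \<in> hom C (src C x) (src C v1)"
    by (simp_all add: hom_def)
  then have "ver_class C W w1 w3 (u1 \<cdot> x, v2 \<cdot> y) \<in> ?A"
    using u v x(6,7) by blast
  moreover have "X = {p. side_rep C W w1 w3 p}" if X: "X \<in> ?A" for X
  proof -
    obtain u1 u2 v1 v2 x y e where "X = ver_class C W w1 w3 (u1 \<cdot> x, v2 \<cdot> y)"
      and "side_rep C W w1 w2 (u1, u2)" "side_rep C W w2 w3 (v1, v2)"
      "x \<in> hom C e (src C u1)" "y \<in> hom C e (src C v1)" "u2 \<cdot> x = v1 \<cdot> y" "w2 \<cdot> u2 \<cdot> x \<in> W"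
      using X by blast
    then show ?thesis
      using side_rep_comp[OF w(1-3), of u1 u2 v1 v2 x y] by (simp add: hom_def ver_class_eq w)
  qed
  ultimately have "\<Union> ?A = {p. side_rep C W w1 w3 p}"
    by (rule Union_constant)
  then show ?thesis
    by (simp add: CW_ver_comp_def side_def)
qed

lemma CW_X0_kernel_groupoid: "kernel_groupoid (CW_X0 C W) (tgt C)"
proof -
  have hom: "side C W w1 w2 \<in> hom (CW_X0 C W) w1 w2" if "w1 \<in> W" "w2 \<in> W" "tgt C w1 = tgt C w2" for w1 w2
    using that CW_ver_iff[of "side C W w1 w2"] by (auto simp: CW_X0_def hom_def) (auto simp: side_def)
  have ar: "v \<in> Arr (CW_X0 C W) \<longleftrightarrow> (\<exists>w1 \<in> W. \<exists>w2 \<in> W. tgt C w1 = tgt C w2 \<and> v = side C W w1 w2)" for v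
    by (simp add: CW_X0_def CW_ver_iff)
  have sel: "Obj (CW_X0 C W) = W" "src (CW_X0 C W) (side C W w1 w2) = w1" "tgt (CW_X0 C W) (side C W w1 w2) = w2"
    "cmp (CW_X0 C W) = CW_ver_comp C W" "idn (CW_X0 C W) = CW_ver_id C W" for w1 w2
    by (simp_all add: CW_X0_def side_def)
  show ?thesis
  proof (unfold_locales, goal_cases)
    case (1 f) then show ?case by (auto simp: ar sel)
  next
    case (2 f) then show ?case by (auto simp: ar sel)
  next
    case (3 f) then show ?case by (auto simp: ar sel)
  next
    case (4 a b) then show ?case using hom[of a b] unfolding sel by blast
  next
    case (5 f g) then show ?case by (auto simp: ar sel)
  next
    case (6 a) then show ?case using hom[of a a] by (simp add: sel CW_ver_id_eq)
  next
    case (7 f g)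
    then show ?case
      by (auto simp: ar sel CW_ver_comp_eq intro!: hom)
  qed
qed

section \<open>Double cells of \<open>C{W}\<close>\<close>

lemma cell_rep_iff:
  "cell_rep C (w1, f1, w1') (w2, f2, w2') (side C W w1 w2) (side C W w1' w2') (u1, u2, u1', u2', \<phi>) \<longleftrightarrow>
    side_rep C W w1 w2 (u1, u2) \<and> side_rep C W w1' w2' (u1', u2') \<and> \<phi> \<in> Arr C \<and>
    src C \<phi> = src C u1 \<and> tgt C \<phi> = src C u1' \<and> f1 \<cdot> u1 = u1' \<cdot> \<phi> \<and> f2 \<cdot> u2 = u2' \<cdot> \<phi>"
  by (auto simp: cell_rep_def side_def hom_def)

lemma CW_hor_iff: "(w, f, w') \<in> CW_hor C W \<longleftrightarrow> w \<in> W \<and> w' \<in> W \<and> f \<in> Arr C \<and> src C f = src C w \<and> tgt C f = src C w'"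
  by (auto simp: CW_hor_def hom_def)

lemma hor_span: "(w, f, w') \<in> CW_hor C W \<Longrightarrow> (w, w' \<cdot> f) \<in> spans C W"
  by (simp add: spans_def CW_hor_iff)

text \<open>A 2-cell representative only equates the composites into the common codomain. To obtain
  a cell, take any representative of the right side, factor \<open>f1 \<cdot> u1\<close> through its
  first leg after a refinement, and cancel \<open>w2'\<close> to make the same factor work for the
  second leg. Conversely \<open>\<phi>\<close> is simply forgotten.\<close>

lemma cell_rep_ex_iff:
  assumes h: "(w1, f1, w1') \<in> CW_hor C W" and k: "(w2, f2, w2') \<in> CW_hor C W"
  shows "hor_fraction C W (w1, f1, w1') = hor_fraction C W (w2, f2, w2') \<longleftrightarrow>
    tgt C w1 = tgt C w2 \<and> tgt C w1' = tgt C w2' \<and>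
    (\<exists>p. cell_rep C (w1, f1, w1') (w2, f2, w2') (side C W w1 w2) (side C W w1' w2') p)"
proof -
  note hk = h[unfolded CW_hor_iff] k[unfolded CW_hor_iff]
  have "(\<exists>p. fcell_rep C W (w1, w1' \<cdot> f1) (w2, w2' \<cdot> f2) p) \<longleftrightarrow>
      (\<exists>p. cell_rep C (w1, f1, w1') (w2, f2, w2') (side C W w1 w2) (side C W w1' w2') p)" (is "?l \<longleftrightarrow> ?r")
    if eq: "tgt C w1' = tgt C w2'"
  proof
    assume ?l
    then obtain u1 u2 where u: "side_rep C W w1 w2 (u1, u2)" "w1' \<cdot> f1 \<cdot> u1 = w2' \<cdot> f2 \<cdot> u2"
      by (auto simp: fcell_rep_def)
    obtain u1' u2' where v: "side_rep C W w1' w2' (u1', u2')"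
      using side_rep_ex[of w1' w2'] hk eq by blast
    note uv = side_rep_arr[OF u(1)] side_rep_arr[OF v]
    obtain t \<phi> where t: "t \<in> W" "\<phi> \<in> Arr C" "tgt C t = src C (f1 \<cdot> u1)" "tgt C \<phi> = src C u1'" "src C \<phi> = src C t"
      "f1 \<cdot> u1 \<cdot> t = u1' \<cdot> \<phi>"
      using ore_cancel[of w1' u1' "f1 \<cdot> u1"] uv hk side_rep_eq(2)[OF v] by auto
    then have t3: "tgt C t = src C u1"
      using uv hk by simp
    have "w2' \<cdot> (f2 \<cdot> (u2 \<cdot> t)) = w1' \<cdot> (f1 \<cdot> (u1 \<cdot> t))"
      using square_ext[OF u(2), of t] uv hk t(1) t3 by simp
    also have "\<dots> = w1' \<cdot> (u1' \<cdot> \<phi>)"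
      using uv hk t(1,2,4-6) t3 by simp
    also have "\<dots> = w2' \<cdot> (u2' \<cdot> \<phi>)"
      using side_rep_ext[OF v] hk t(2,4) by simp
    finally obtain q where q: "q \<in> W" "tgt C q = src C t" "f2 \<cdot> (u2 \<cdot> t) \<cdot> q = u2' \<cdot> \<phi> \<cdot> q"
      using cancel_W[of w2' "f2 \<cdot> (u2 \<cdot> t)" "u2' \<cdot> \<phi>"] uv hk t(1,2,4,5) t3 by auto
    have "side_rep C W w1 w2 (u1 \<cdot> (t \<cdot> q), u2 \<cdot> (t \<cdot> q))"
      using u(1) t(1) t3 q hk by (intro side_rep_refine) auto
    moreover have "f1 \<cdot> (u1 \<cdot> (t \<cdot> q)) = u1' \<cdot> (\<phi> \<cdot> q)"
      using square_ext[OF t(6), of q] uv hk t(1,2,4,5) t3 q(1,2) by simp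
    moreover have "f2 \<cdot> (u2 \<cdot> (t \<cdot> q)) = u2' \<cdot> (\<phi> \<cdot> q)"
      using uv hk t(1,2,4,5) t3 q by simp
    ultimately have "cell_rep C (w1, f1, w1') (w2, f2, w2') (side C W w1 w2) (side C W w1' w2')
        (u1 \<cdot> (t \<cdot> q), u2 \<cdot> (t \<cdot> q), u1', u2', \<phi> \<cdot> q)"
      using v uv t(1,2,4,5) t3 q(1,2) by (simp add: cell_rep_iff)
    then show ?r ..
  next
    assume ?r
    then obtain u1 u2 u1' u2' \<phi> where
      c: "cell_rep C (w1, f1, w1') (w2, f2, w2') (side C W w1 w2) (side C W w1' w2') (u1, u2, u1', u2', \<phi>)"
      by auto
    note c' = c[unfolded cell_rep_iff]
    then have v: "side_rep C W w1' w2' (u1', u2')"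
      by blast
    have "w1' \<cdot> (f1 \<cdot> u1) = w2' \<cdot> (f2 \<cdot> u2)"
      using side_rep_ext[OF v, of \<phi>] c' hk by simp
    then have "fcell_rep C W (w1, w1' \<cdot> f1) (w2, w2' \<cdot> f2) (u1, u2)"
      using c' hk side_rep_arr[of w1 w2 u1 u2] by (simp add: fcell_rep_def)
    then show ?l ..
  qed
  then show ?thesis
    using fraction_eq_iff[OF hor_span[OF h] hor_span[OF k]] hk
    by (auto simp: hor_fraction_def fraction_arr_def)
qed

text \<open>Refine the left sides and the right sides to common ones. An Ore square for
  \<open>\<phi> \<cdot> r\<close> and \<open>r'\<close> gives \<open>\<chi>\<close>; the equation
  for \<open>\<psi>\<close> then holds after composition with \<open>v1'\<close>, which can be
  cancelled because \<open>w1' \<cdot> v1'\<close> lies in \<open>W\<close>.\<close>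

lemma cell_eq_all:
  assumes h: "(w1, f1, w1') \<in> CW_hor C W" and k: "(w2, f2, w2') \<in> CW_hor C W"
    and p: "cell_rep C (w1, f1, w1') (w2, f2, w2') (side C W w1 w2) (side C W w1' w2') p"
    and q: "cell_rep C (w1, f1, w1') (w2, f2, w2') (side C W w1 w2) (side C W w1' w2') q"
  shows "cell_eq C W (w1, f1, w1') p q"
proof -
  obtain u1 u2 u1' u2' \<phi> v1 v2 v1' v2' \<psi> where pq: "p = (u1, u2, u1', u2', \<phi>)" "q = (v1, v2, v1', v2', \<psi>)"
    by (metis surj_pair)
  note hk = h[unfolded CW_hor_iff] k[unfolded CW_hor_iff]
  have u: "side_rep C W w1 w2 (u1, u2)" "side_rep C W w1' w2' (u1', u2')"
    and v: "side_rep C W w1 w2 (v1, v2)" "side_rep C W w1' w2' (v1', v2')"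
    and c: "\<phi> \<in> Arr C" "src C \<phi> = src C u1" "tgt C \<phi> = src C u1'"
      "\<psi> \<in> Arr C" "src C \<psi> = src C v1" "tgt C \<psi> = src C v1'"
    and ce: "f1 \<cdot> u1 = u1' \<cdot> \<phi>" "f1 \<cdot> v1 = v1' \<cdot> \<psi>"
    using p q by (auto simp: pq cell_rep_iff)
  note uv = side_rep_arr[OF u(1)] side_rep_arr[OF u(2)] side_rep_arr[OF v(1)] side_rep_arr[OF v(2)] hk c
  obtain r s where r: "r \<in> W" "s \<in> Arr C" "src C s = src C r" "tgt C r = src C u1" "tgt C s = src C v1"
    and re: "u1 \<cdot> r = v1 \<cdot> s" "u2 \<cdot> r = v2 \<cdot> s"
    using side_rep_common_refinement[OF _ _ u(1) v(1)] hk by blast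
  obtain r' s' where r': "r' \<in> W" "s' \<in> Arr C" "src C s' = src C r'" "tgt C r' = src C u1'" "tgt C s' = src C v1'"
    and re': "u1' \<cdot> r' = v1' \<cdot> s'" "u2' \<cdot> r' = v2' \<cdot> s'"
    using side_rep_common_refinement[OF _ _ u(2) v(2)] hk by blast
  obtain t \<chi> where t: "t \<in> W" "\<chi> \<in> Arr C" "tgt C t = src C r" "tgt C \<chi> = src C r'" "src C \<chi> = src C t"
    and te: "\<phi> \<cdot> r \<cdot> t = r' \<cdot> \<chi>"
    using ore[of "\<phi> \<cdot> r" r'] r r' uv by auto
  have te': "\<phi> \<cdot> (r \<cdot> t) = r' \<cdot> \<chi>"
    using te uv r r' t by simp
  \<comment> \<open>The two arrows are compared through \<open>f1\<close> on the common left
    leg.\<close>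
  have "v1' \<cdot> (\<psi> \<cdot> (s \<cdot> t)) = f1 \<cdot> (v1 \<cdot> (s \<cdot> t))"
    using square_ext[OF ce(2), of "s \<cdot> t"] uv r t by simp
  also have "\<dots> = f1 \<cdot> (u1 \<cdot> (r \<cdot> t))"
    using square_ext[OF re(1), of t] uv r t by simp
  also have "\<dots> = u1' \<cdot> (\<phi> \<cdot> (r \<cdot> t))"
    using square_ext[OF ce(1), of "r \<cdot> t"] uv r t by simp
  also have "\<dots> = v1' \<cdot> (s' \<cdot> \<chi>)"
    using square_ext[OF re'(1), of \<chi>] uv r' t by (simp add: te')
  finally obtain y where y: "y \<in> W" "tgt C y = src C t" and ye: "\<psi> \<cdot> (s \<cdot> t) \<cdot> y = s' \<cdot> \<chi> \<cdot> y"
    using cancel[OF side_rep_eq(2)[OF v(2)], of "\<psi> \<cdot> (s \<cdot> t)" "s' \<cdot> \<chi>"] uv r r' t by auto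
  \<comment> \<open>\<open>z\<close> collects the two refinements of the left side; the right side
    stays as it is.\<close>
  define z where "z = t \<cdot> y"
  have z: "z \<in> W" "tgt C z = src C r" "src C z = src C y"
    using t y by (simp_all add: z_def)
  have eqs: "\<phi> \<cdot> (r \<cdot> z) = r' \<cdot> (\<chi> \<cdot> y)" "\<psi> \<cdot> (s \<cdot> z) = s' \<cdot> (\<chi> \<cdot> y)"
    using square_ext[OF te', of y] ye uv r r' t y by (simp_all add: z_def)
  show ?thesis
    unfolding pq cell_eq_def prod.case
  proof (intro exI bexI conjI)
    show "w1 \<cdot> u1 \<cdot> (r \<cdot> z) \<in> W"
      using hk r z by (intro side_rep_W(1)[OF u(1)]) auto
    show "w1' \<cdot> u1' \<cdot> r' \<in> W"
      using hk r' by (intro side_rep_W(1)[OF u(2)]) auto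
    show "\<phi> \<cdot> (r \<cdot> z) = r' \<cdot> (\<chi> \<cdot> y)" "\<psi> \<cdot> (s \<cdot> z) = s' \<cdot> (\<chi> \<cdot> y)"
      by (rule eqs)+
    show "u1 \<cdot> (r \<cdot> z) = v1 \<cdot> (s \<cdot> z)" "u2 \<cdot> (r \<cdot> z) = v2 \<cdot> (s \<cdot> z)"
      using square_ext[OF re(1), of z] square_ext[OF re(2), of z] uv r z by simp_all
    show "u1' \<cdot> r' = v1' \<cdot> s'" "u2' \<cdot> r' = v2' \<cdot> s'"
      by (rule re')+
    show "r \<cdot> z \<in> hom C (src C z) (src C u1)" "s \<cdot> z \<in> hom C (src C z) (src C v1)"
      "r' \<in> hom C (src C r') (src C u1')" "s' \<in> hom C (src C r') (src C v1')"
      using r r' z by (auto simp: hom_def)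
    show "\<chi> \<cdot> y \<in> hom C (src C z) (src C r')"
      using t y z by (simp add: hom_def)
  qed
qed

lemma cell_class_eq:
  assumes "(w1, f1, w1') \<in> CW_hor C W" "(w2, f2, w2') \<in> CW_hor C W"
    "cell_rep C (w1, f1, w1') (w2, f2, w2') (side C W w1 w2) (side C W w1' w2') p"
  shows "cell_class C W (w1, f1, w1') (w2, f2, w2') (side C W w1 w2) (side C W w1' w2') p =
    {q. cell_rep C (w1, f1, w1') (w2, f2, w2') (side C W w1 w2) (side C W w1' w2') q}"
  using cell_eq_all[OF assms] by (auto simp: cell_class_def)

lemma CW_cell_iff: "c \<in> CW_cell C W \<longleftrightarrow>
    (\<exists>h \<in> CW_hor C W. \<exists>k \<in> CW_hor C W. hor_fraction C W h = hor_fraction C W k \<and> c = full_cell C W h k)"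
proof
  assume "c \<in> CW_cell C W"
  then obtain w1 f1 w1' w2 f2 w2' U U' p where
    hk: "(w1, f1, w1') \<in> CW_hor C W" "(w2, f2, w2') \<in> CW_hor C W"
    and U: "(w1, U, w2) \<in> CW_ver C W" "(w1', U', w2') \<in> CW_ver C W"
    and p: "cell_rep C (w1, f1, w1') (w2, f2, w2') (w1, U, w2) (w1', U', w2') p"
    and c: "c = \<lparr>ctop = (w1, f1, w1'), cbot = (w2, f2, w2'), cleft = (w1, U, w2), cright = (w1', U', w2'),
       creps = cell_class C W (w1, f1, w1') (w2, f2, w2') (w1, U, w2) (w1', U', w2') p\<rparr>"
    unfolding CW_cell_def by blast
  have s: "(w1, U, w2) = side C W w1 w2" "tgt C w1 = tgt C w2"
    "(w1', U', w2') = side C W w1' w2'" "tgt C w1' = tgt C w2'"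
    using U by (auto simp: CW_ver_iff side_def)
  have p': "cell_rep C (w1, f1, w1') (w2, f2, w2') (side C W w1 w2) (side C W w1' w2') p"
    using p unfolding s(1,3) .
  have "hor_fraction C W (w1, f1, w1') = hor_fraction C W (w2, f2, w2')"
    using cell_rep_ex_iff[OF hk] p' s(2,4) by blast
  moreover have "c = full_cell C W (w1, f1, w1') (w2, f2, w2')"
    using c[unfolded s(1,3)] cell_class_eq[OF hk p'] by (simp add: full_cell_def)
  ultimately show "\<exists>h \<in> CW_hor C W. \<exists>k \<in> CW_hor C W. hor_fraction C W h = hor_fraction C W k \<and> c = full_cell C W h k"
    using hk by blast
next
  assume "\<exists>h \<in> CW_hor C W. \<exists>k \<in> CW_hor C W. hor_fraction C W h = hor_fraction C W k \<and> c = full_cell C W h k"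
  then obtain h k where "h \<in> CW_hor C W" "k \<in> CW_hor C W" "hor_fraction C W h = hor_fraction C W k" "c = full_cell C W h k"
    by blast
  moreover obtain w1 f1 w1' w2 f2 w2' where hk: "h = (w1, f1, w1')" "k = (w2, f2, w2')"
    by (metis surj_pair)
  ultimately have *: "(w1, f1, w1') \<in> CW_hor C W" "(w2, f2, w2') \<in> CW_hor C W"
    "hor_fraction C W (w1, f1, w1') = hor_fraction C W (w2, f2, w2')" "c = full_cell C W (w1, f1, w1') (w2, f2, w2')"
    by auto
  then obtain p where p: "cell_rep C (w1, f1, w1') (w2, f2, w2') (side C W w1 w2) (side C W w1' w2') p"
    and t: "tgt C w1 = tgt C w2" "tgt C w1' = tgt C w2'"
    using cell_rep_ex_iff by blast
  have U: "side C W w1 w2 \<in> CW_ver C W" "side C W w1' w2' \<in> CW_ver C W"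
    using * t by (auto simp: CW_ver_iff CW_hor_iff)
  have "c = \<lparr>ctop = (w1, f1, w1'), cbot = (w2, f2, w2'), cleft = side C W w1 w2, cright = side C W w1' w2',
       creps = cell_class C W (w1, f1, w1') (w2, f2, w2') (side C W w1 w2) (side C W w1' w2') p\<rparr>"
    using *(4) cell_class_eq[OF *(1,2) p] by (simp add: full_cell_def)
  then show "c \<in> CW_cell C W"
    unfolding CW_cell_def using *(1,2) U p unfolding side_def by blast
qed

lemma full_cell_sel [simp]: "ctop (full_cell C W h k) = h" "cbot (full_cell C W h k) = k"
  "cleft (full_cell C W h k) = side C W (fst h) (fst k)"
  "cright (full_cell C W h k) = side C W (snd (snd h)) (snd (snd k))"
  by (cases h; cases k; simp add: full_cell_def)+

lemma CW_cell_vid_eq: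
  assumes "h \<in> CW_hor C W"
  shows "CW_cell_vid C W h = full_cell C W h h"
proof -
  obtain w f w' where h: "h = (w, f, w')"
    by (metis surj_pair)
  note hw = assms[unfolded h CW_hor_iff]
  have "cell_rep C (w, f, w') (w, f, w') (side C W w w) (side C W w' w')
      (idn C (src C w), idn C (src C w), idn C (src C w'), idn C (src C w'), f)"
    using hw by (simp add: cell_rep_iff side_rep_iff)
  then show ?thesis
    using assms hw by (simp add: h CW_cell_vid_def Let_def CW_ver_id_eq cell_class_eq full_cell_def)
qed

lemma CW_cell_hid_eq:
  assumes "w1 \<in> W" "w2 \<in> W" "tgt C w1 = tgt C w2"
  shows "CW_cell_hid C W (side C W w1 w2) = full_cell C W (CW_hor_id C w1) (CW_hor_id C w2)"
proof -
  have hor: "(w1, idn C (src C w1), w1) \<in> CW_hor C W" "(w2, idn C (src C w2), w2) \<in> CW_hor C W"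
    using assms by (simp_all add: CW_hor_iff)
  let ?rep = "cell_rep C (w1, idn C (src C w1), w1) (w2, idn C (src C w2), w2) (side C W w1 w2) (side C W w1 w2)"
  let ?A = "{cell_class C W (w1, idn C (src C w1), w1) (w2, idn C (src C w2), w2) (side C W w1 w2) (side C W w1 w2)
      (u1, u2, u1, u2, idn C (src C u1)) | u1 u2. (u1, u2) \<in> {p. side_rep C W w1 w2 p}}"
  obtain u1 u2 where u: "side_rep C W w1 w2 (u1, u2)"
    using side_rep_ex assms by blast
  have rep: "?rep (u1, u2, u1, u2, idn C (src C u1))" if "side_rep C W w1 w2 (u1, u2)" for u1 u2
    using that side_rep_arr[OF that] by (simp add: cell_rep_iff)
  have "cell_class C W (w1, idn C (src C w1), w1) (w2, idn C (src C w2), w2) (side C W w1 w2) (side C W w1 w2)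
      (u1, u2, u1, u2, idn C (src C u1)) \<in> ?A"
    using u by blast
  moreover have "X = {p. ?rep p}" if "X \<in> ?A" for X
    using that cell_class_eq[OF hor rep] by blast
  ultimately have "\<Union> ?A = {p. ?rep p}"
    by (rule Union_constant)
  then show ?thesis
    by (simp add: CW_cell_hid_def side_def full_cell_def CW_hor_id_def Let_def)
qed


text \<open>Constancy is bookkeeping. A choice exists because an Ore square builds
  \<open>\<xi>\<close> from the upper cell; the condition for the lower cell then holds after
  composition with \<open>v1'\<close> and is made exact by a further refinement.\<close>

lemma CW_cell_vcomp_eq:
  assumes h: "h \<in> CW_hor C W" and k: "k \<in> CW_hor C W" and l: "l \<in> CW_hor C W"
    and hk: "hor_fraction C W h = hor_fraction C W k" and kl: "hor_fraction C W k = hor_fraction C W l"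
  shows "CW_cell_vcomp C W (full_cell C W k l) (full_cell C W h k) = full_cell C W h l"
proof -
  obtain w1 f1 w1' w2 f2 w2' w3 f3 w3' where e: "h = (w1, f1, w1')" "k = (w2, f2, w2')" "l = (w3, f3, w3')"
    by (metis surj_pair)
  note hor = h[unfolded e] k[unfolded e] l[unfolded e]
  note ty = hor[unfolded CW_hor_iff]
  let ?R = "\<lambda>p. cell_rep C (w1, f1, w1') (w2, f2, w2') (side C W w1 w2) (side C W w1' w2') p"
  let ?S = "\<lambda>p. cell_rep C (w2, f2, w2') (w3, f3, w3') (side C W w2 w3) (side C W w2' w3') p"
  let ?T = "\<lambda>p. cell_rep C (w1, f1, w1') (w3, f3, w3') (side C W w1 w3) (side C W w1' w3') p"
  let ?cl = "cell_class C W (w1, f1, w1') (w3, f3, w3') (side C W w1 w3) (side C W w1' w3')"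
  let ?A = "{?cl (u1 \<cdot> x \<cdot> q, v2 \<cdot> y \<cdot> q, u1' \<cdot> x', v2' \<cdot> y', \<xi>)
            | u1 u2 u1' u2' \<phi> v1 v2 v1' v2' \<psi> x y x' y' q \<xi> e e' e0.
              (u1, u2, u1', u2', \<phi>) \<in> {p. ?R p} \<and> (v1, v2, v1', v2', \<psi>) \<in> {p. ?S p} \<and>
              x \<in> hom C e (src C u1) \<and> y \<in> hom C e (src C v1) \<and>
              u2 \<cdot> x = v1 \<cdot> y \<and> w2 \<cdot> u2 \<cdot> x \<in> W \<and>
              x' \<in> hom C e' (src C u1') \<and> y' \<in> hom C e' (src C v1') \<and>
              u2' \<cdot> x' = v1' \<cdot> y' \<and> w2' \<cdot> u2' \<cdot> x' \<in> W \<and>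
              q \<in> W \<and> q \<in> hom C e0 e \<and> \<xi> \<in> hom C e0 e' \<and>
              x' \<cdot> \<xi> = \<phi> \<cdot> x \<cdot> q \<and> y' \<cdot> \<xi> = \<psi> \<cdot> y \<cdot> q}"
  have tgts: "tgt C w1 = tgt C w2" "tgt C w2 = tgt C w3" "tgt C w1' = tgt C w2'" "tgt C w2' = tgt C w3'"
    using hk kl cell_rep_ex_iff[OF hor(1,2)] cell_rep_ex_iff[OF hor(2,3)] by (simp_all add: e)
  obtain u1 u2 u1' u2' \<phi> where p: "?R (u1, u2, u1', u2', \<phi>)"
    using hk cell_rep_ex_iff[OF hor(1,2)] by (auto simp: e)
  obtain v1 v2 v1' v2' \<psi> where q: "?S (v1, v2, v1', v2', \<psi>)"
    using kl cell_rep_ex_iff[OF hor(2,3)] by (auto simp: e)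
  have u: "side_rep C W w1 w2 (u1, u2)" "side_rep C W w1' w2' (u1', u2')"
    and v: "side_rep C W w2 w3 (v1, v2)" "side_rep C W w2' w3' (v1', v2')"
    and c: "\<phi> \<in> Arr C" "src C \<phi> = src C u1" "tgt C \<phi> = src C u1'"
      "\<psi> \<in> Arr C" "src C \<psi> = src C v1" "tgt C \<psi> = src C v1'"
    and ce: "f2 \<cdot> u2 = u2' \<cdot> \<phi>" "f2 \<cdot> v1 = v1' \<cdot> \<psi>"
    using p q by (auto simp: cell_rep_iff)
  note uv = side_rep_arr[OF u(1)] side_rep_arr[OF u(2)] side_rep_arr[OF v(1)] side_rep_arr[OF v(2)] ty c
  obtain x y where x: "x \<in> W" "y \<in> Arr C" "src C y = src C x" "tgt C x = src C u1" "tgt C y = src C v1"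
    and xe: "u2 \<cdot> x = v1 \<cdot> y" and xW: "w2 \<cdot> u2 \<cdot> x \<in> W"
    using side_rep_comp_ex[OF _ _ _ u(1) v(1)] ty by metis
  obtain x' y' where x': "x' \<in> W" "y' \<in> Arr C" "src C y' = src C x'" "tgt C x' = src C u1'" "tgt C y' = src C v1'"
    and xe': "u2' \<cdot> x' = v1' \<cdot> y'" and xW': "w2' \<cdot> u2' \<cdot> x' \<in> W"
    using side_rep_comp_ex[OF _ _ _ u(2) v(2)] ty by metis
  obtain t \<xi> where t: "t \<in> W" "\<xi> \<in> Arr C" "tgt C t = src C x" "tgt C \<xi> = src C x'" "src C \<xi> = src C t"
    and te: "\<phi> \<cdot> x \<cdot> t = x' \<cdot> \<xi>"
    using ore[of "\<phi> \<cdot> x" x'] uv x x' by auto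
  have te': "\<phi> \<cdot> (x \<cdot> t) = x' \<cdot> \<xi>"
    using te uv x t by simp
  \<comment> \<open>The middle horizontal arrow \<open>f2\<close> links the two cells.\<close>
  have "v1' \<cdot> (y' \<cdot> \<xi>) = u2' \<cdot> (\<phi> \<cdot> (x \<cdot> t))"
    using square_ext[OF xe', of \<xi>] uv x' t by (simp add: te')
  also have "\<dots> = f2 \<cdot> (u2 \<cdot> (x \<cdot> t))"
    using square_ext[OF ce(1), of "x \<cdot> t"] uv x t by simp
  also have "\<dots> = f2 \<cdot> (v1 \<cdot> (y \<cdot> t))"
    using square_ext[OF xe, of t] uv x t by simp
  also have "\<dots> = v1' \<cdot> (\<psi> \<cdot> (y \<cdot> t))"
    using square_ext[OF ce(2), of "y \<cdot> t"] uv x t by simp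
  finally obtain r where r: "r \<in> W" "tgt C r = src C t" and re: "y' \<cdot> \<xi> \<cdot> r = \<psi> \<cdot> (y \<cdot> t) \<cdot> r"
    using cancel[OF side_rep_eq(2)[OF v(2)], of "y' \<cdot> \<xi>" "\<psi> \<cdot> (y \<cdot> t)"] uv x x' t by auto
  have "x' \<cdot> (\<xi> \<cdot> r) = \<phi> \<cdot> x \<cdot> (t \<cdot> r)" "y' \<cdot> (\<xi> \<cdot> r) = \<psi> \<cdot> y \<cdot> (t \<cdot> r)"
    using square_ext[OF te', of r] re uv x x' t r by simp_all
  moreover have "x \<in> hom C (src C x) (src C u1)" "y \<in> hom C (src C x) (src C v1)"
    "x' \<in> hom C (src C x') (src C u1')" "y' \<in> hom C (src C x') (src C v1')"
    "t \<cdot> r \<in> W" "t \<cdot> r \<in> hom C (src C r) (src C x)" "\<xi> \<cdot> r \<in> hom C (src C r) (src C x')"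
    using x x' t r by (simp_all add: hom_def)
  ultimately have "?cl (u1 \<cdot> x \<cdot> (t \<cdot> r), v2 \<cdot> y \<cdot> (t \<cdot> r), u1' \<cdot> x', v2' \<cdot> y', \<xi> \<cdot> r) \<in> ?A"
    using p q xe xW xe' xW' by blast
  moreover have "X = {p. ?T p}" if X: "X \<in> ?A" for X
  proof -
    obtain u1 u2 u1' u2' \<phi> v1 v2 v1' v2' \<psi> x y x' y' q \<xi> e e' e0 where
      X: "X = ?cl (u1 \<cdot> x \<cdot> q, v2 \<cdot> y \<cdot> q, u1' \<cdot> x', v2' \<cdot> y', \<xi>)"
      and R: "?R (u1, u2, u1', u2', \<phi>)" and S: "?S (v1, v2, v1', v2', \<psi>)"
      and x: "x \<in> hom C e (src C u1)" "y \<in> hom C e (src C v1)"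
      and xe: "u2 \<cdot> x = v1 \<cdot> y" and xW: "w2 \<cdot> u2 \<cdot> x \<in> W"
      and x': "x' \<in> hom C e' (src C u1')" "y' \<in> hom C e' (src C v1')"
      and xe': "u2' \<cdot> x' = v1' \<cdot> y'" and xW': "w2' \<cdot> u2' \<cdot> x' \<in> W"
      and q: "q \<in> W" "q \<in> hom C e0 e" "\<xi> \<in> hom C e0 e'"
      and qe: "x' \<cdot> \<xi> = \<phi> \<cdot> x \<cdot> q" "y' \<cdot> \<xi> = \<psi> \<cdot> y \<cdot> q"
      using X by blast
    have u: "side_rep C W w1 w2 (u1, u2)" "side_rep C W w1' w2' (u1', u2')"
      and v: "side_rep C W w2 w3 (v1, v2)" "side_rep C W w2' w3' (v1', v2')"
      and c: "\<phi> \<in> Arr C" "src C \<phi> = src C u1" "tgt C \<phi> = src C u1'"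
        "\<psi> \<in> Arr C" "src C \<psi> = src C v1" "tgt C \<psi> = src C v1'"
      and ce: "f1 \<cdot> u1 = u1' \<cdot> \<phi>" "f3 \<cdot> v2 = v2' \<cdot> \<psi>"
      using R S by (auto simp: cell_rep_iff)
    note uv = side_rep_arr[OF u(1)] side_rep_arr[OF u(2)] side_rep_arr[OF v(1)] side_rep_arr[OF v(2)] ty c
    note xs = x[unfolded hom_def mem_Collect_eq] x'[unfolded hom_def mem_Collect_eq] q(1) q(2,3)[unfolded hom_def mem_Collect_eq]
    have s: "side_rep C W w1 w3 (u1 \<cdot> x, v2 \<cdot> y)" "side_rep C W w1' w3' (u1' \<cdot> x', v2' \<cdot> y')"
      using ty xs xe xW xe' xW' side_rep_comp[OF _ _ _ u(1) v(1)] side_rep_comp[OF _ _ _ u(2) v(2)] by auto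
    have "side_rep C W w1 w3 (u1 \<cdot> x \<cdot> q, v2 \<cdot> y \<cdot> q)"
      using ty xs uv by (intro side_rep_refine[OF s(1)]) auto
    moreover have "f1 \<cdot> (u1 \<cdot> x \<cdot> q) = u1' \<cdot> x' \<cdot> \<xi>"
      using square_ext[OF ce(1), of "x \<cdot> q"] xs uv by (simp add: qe)
    moreover have "f3 \<cdot> (v2 \<cdot> y \<cdot> q) = v2' \<cdot> y' \<cdot> \<xi>"
      using square_ext[OF ce(2), of "y \<cdot> q"] xs uv by (simp add: qe)
    ultimately have "?T (u1 \<cdot> x \<cdot> q, v2 \<cdot> y \<cdot> q, u1' \<cdot> x', v2' \<cdot> y', \<xi>)"
      using s xs uv by (simp add: cell_rep_iff)
    then show ?thesis
      using cell_class_eq[OF hor(1,3)] X by blast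
  qed
  ultimately have A: "\<Union> ?A = {p. ?T p}"
    by (rule Union_constant)
  have "CW_ver_comp C W (side C W w2 w3) (side C W w1 w2) = side C W w1 w3"
    "CW_ver_comp C W (side C W w2' w3') (side C W w1' w2') = side C W w1' w3'"
    using ty tgts by (simp_all add: CW_ver_comp_eq)
  then show ?thesis
    using A by (simp add: CW_cell_vcomp_def e full_cell_def Let_def)
qed

text \<open>The two cells come with different representatives of their shared side. The arrows
  \<open>p\<close> and \<open>s\<close> reconcile them, and the refinement \<open>z\<close> lets
  \<open>\<phi>\<close> factor through \<open>p\<close>.\<close>

lemma CW_cell_hcomp_eq:
  assumes h: "(w1, f1, w1') \<in> CW_hor C W" and k: "(w2, f2, w2') \<in> CW_hor C W"
    and h': "(w1', g1, w1'') \<in> CW_hor C W" and k': "(w2', g2, w2'') \<in> CW_hor C W"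
    and hk: "hor_fraction C W (w1, f1, w1') = hor_fraction C W (w2, f2, w2')"
    and hk': "hor_fraction C W (w1', g1, w1'') = hor_fraction C W (w2', g2, w2'')"
  shows "CW_cell_hcomp C W (full_cell C W (w1, f1, w1') (w2, f2, w2'), full_cell C W (w1', g1, w1'') (w2', g2, w2'')) =
    full_cell C W (w1, g1 \<cdot> f1, w1'') (w2, g2 \<cdot> f2, w2'')"
proof -
  note ty = h[unfolded CW_hor_iff] k[unfolded CW_hor_iff] h'[unfolded CW_hor_iff] k'[unfolded CW_hor_iff]
  have hor: "(w1, g1 \<cdot> f1, w1'') \<in> CW_hor C W" "(w2, g2 \<cdot> f2, w2'') \<in> CW_hor C W"
    using ty by (simp_all add: CW_hor_iff)
  let ?R = "\<lambda>p. cell_rep C (w1, f1, w1') (w2, f2, w2') (side C W w1 w2) (side C W w1' w2') p"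
  let ?S = "\<lambda>p. cell_rep C (w1', g1, w1'') (w2', g2, w2'') (side C W w1' w2') (side C W w1'' w2'') p"
  let ?T = "\<lambda>p. cell_rep C (w1, g1 \<cdot> f1, w1'') (w2, g2 \<cdot> f2, w2'') (side C W w1 w2) (side C W w1'' w2'') p"
  let ?cl = "cell_class C W (w1, g1 \<cdot> f1, w1'') (w2, g2 \<cdot> f2, w2'') (side C W w1 w2) (side C W w1'' w2'')"
  let ?A = "{?cl (u1 \<cdot> z, u2 \<cdot> z, v1', v2', \<psi> \<cdot> s \<cdot> \<phi>')
           | u1 u2 u1' u2' \<phi> v1 v2 v1' v2' \<psi> p s z \<phi>' e e'.
             (u1, u2, u1', u2', \<phi>) \<in> {p. ?R p} \<and> (v1, v2, v1', v2', \<psi>) \<in> {p. ?S p} \<and>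
             p \<in> hom C e (src C u1') \<and> s \<in> hom C e (src C v1) \<and>
             u1' \<cdot> p = v1 \<cdot> s \<and> u2' \<cdot> p = v2 \<cdot> s \<and> w1' \<cdot> u1' \<cdot> p \<in> W \<and>
             z \<in> W \<and> z \<in> hom C e' (src C u1) \<and> \<phi>' \<in> hom C e' e \<and> \<phi> \<cdot> z = p \<cdot> \<phi>'}"
  obtain u1 u2 u1' u2' \<phi> where R: "?R (u1, u2, u1', u2', \<phi>)"
    using hk cell_rep_ex_iff[OF h k] by auto
  obtain v1 v2 v1' v2' \<psi> where S: "?S (v1, v2, v1', v2', \<psi>)"
    using hk' cell_rep_ex_iff[OF h' k'] by auto
  have u: "side_rep C W w1 w2 (u1, u2)" "side_rep C W w1' w2' (u1', u2')"
    and v: "side_rep C W w1' w2' (v1, v2)"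
    and c: "\<phi> \<in> Arr C" "src C \<phi> = src C u1" "tgt C \<phi> = src C u1'"
    using R S by (auto simp: cell_rep_iff)
  obtain p s where p: "p \<in> W" "s \<in> Arr C" "src C s = src C p" "tgt C p = src C u1'" "tgt C s = src C v1"
    and pe: "u1' \<cdot> p = v1 \<cdot> s" "u2' \<cdot> p = v2 \<cdot> s"
    using side_rep_common_refinement[OF _ _ u(2) v] ty by blast
  obtain z \<phi>' where z: "z \<in> W" "\<phi>' \<in> Arr C" "tgt C z = src C \<phi>" "tgt C \<phi>' = src C p" "src C \<phi>' = src C z"
    and ze: "\<phi> \<cdot> z = p \<cdot> \<phi>'"
    using ore[of \<phi> p] c p by auto
  have "w1' \<cdot> u1' \<cdot> p \<in> W"
    using side_rep_W(1)[OF u(2)] ty p by simp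
  moreover have "p \<in> hom C (src C p) (src C u1')" "s \<in> hom C (src C p) (src C v1)"
    "z \<in> hom C (src C z) (src C u1)" "\<phi>' \<in> hom C (src C z) (src C p)"
    using p z c by (simp_all add: hom_def)
  ultimately have "?cl (u1 \<cdot> z, u2 \<cdot> z, v1', v2', \<psi> \<cdot> s \<cdot> \<phi>') \<in> ?A"
    using R S pe z(1) ze by blast
  moreover have "X = {p. ?T p}" if X: "X \<in> ?A" for X
  proof -
    obtain u1 u2 u1' u2' \<phi> v1 v2 v1' v2' \<psi> p s z \<phi>' e e' where
      X: "X = ?cl (u1 \<cdot> z, u2 \<cdot> z, v1', v2', \<psi> \<cdot> s \<cdot> \<phi>')"
      and R: "?R (u1, u2, u1', u2', \<phi>)" and S: "?S (v1, v2, v1', v2', \<psi>)"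
      and p: "p \<in> hom C e (src C u1')" "s \<in> hom C e (src C v1)"
      and pe: "u1' \<cdot> p = v1 \<cdot> s" "u2' \<cdot> p = v2 \<cdot> s"
      and z: "z \<in> W" "z \<in> hom C e' (src C u1)" "\<phi>' \<in> hom C e' e" and ze: "\<phi> \<cdot> z = p \<cdot> \<phi>'"
      using X by blast
    have u: "side_rep C W w1 w2 (u1, u2)" "side_rep C W w1' w2' (u1', u2')"
      and v: "side_rep C W w1' w2' (v1, v2)" "side_rep C W w1'' w2'' (v1', v2')"
      and c: "\<phi> \<in> Arr C" "src C \<phi> = src C u1" "tgt C \<phi> = src C u1'"
        "\<psi> \<in> Arr C" "src C \<psi> = src C v1" "tgt C \<psi> = src C v1'"
      and ce: "f1 \<cdot> u1 = u1' \<cdot> \<phi>" "f2 \<cdot> u2 = u2' \<cdot> \<phi>" "g1 \<cdot> v1 = v1' \<cdot> \<psi>" "g2 \<cdot> v2 = v2' \<cdot> \<psi>"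
      using R S by (auto simp: cell_rep_iff)
    note uv = side_rep_arr[OF u(1)] side_rep_arr[OF u(2)] side_rep_arr[OF v(1)] side_rep_arr[OF v(2)] ty c
    note ps = p[unfolded hom_def mem_Collect_eq] z(1) z(2,3)[unfolded hom_def mem_Collect_eq]
    have "side_rep C W w1 w2 (u1 \<cdot> z, u2 \<cdot> z)"
      using ty ps uv by (intro side_rep_refine[OF u(1)]) auto
    moreover have "g1 \<cdot> (f1 \<cdot> (u1 \<cdot> z)) = v1' \<cdot> (\<psi> \<cdot> (s \<cdot> \<phi>'))"
    proof -
      have "f1 \<cdot> (u1 \<cdot> z) = v1 \<cdot> (s \<cdot> \<phi>')"
        using square_ext[OF ce(1), of z] square_ext[OF pe(1), of \<phi>'] ps uv by (simp add: ze)
      then show ?thesis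
        using square_ext[OF ce(3), of "s \<cdot> \<phi>'"] ps uv by simp
    qed
    moreover have "g2 \<cdot> (f2 \<cdot> (u2 \<cdot> z)) = v2' \<cdot> (\<psi> \<cdot> (s \<cdot> \<phi>'))"
    proof -
      have "f2 \<cdot> (u2 \<cdot> z) = v2 \<cdot> (s \<cdot> \<phi>')"
        using square_ext[OF ce(2), of z] square_ext[OF pe(2), of \<phi>'] ps uv by (simp add: ze)
      then show ?thesis
        using square_ext[OF ce(4), of "s \<cdot> \<phi>'"] ps uv by simp
    qed
    ultimately have "?T (u1 \<cdot> z, u2 \<cdot> z, v1', v2', \<psi> \<cdot> s \<cdot> \<phi>')"
      using v ps uv by (simp add: cell_rep_iff)
    then show ?thesis
      using cell_class_eq[OF hor] X by blast
  qed
  ultimately have "\<Union> ?A = {p. ?T p}"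
    by (rule Union_constant)
  then show ?thesis
    by (simp add: CW_cell_hcomp_def full_cell_def Let_def CW_hor_comp_def)
qed

lemma CW_X1_kernel_groupoid: "kernel_groupoid (CW_X1 C W) (hor_fraction C W)"
proof -
  have ar: "c \<in> Arr (CW_X1 C W) \<longleftrightarrow>
      (\<exists>h \<in> CW_hor C W. \<exists>k \<in> CW_hor C W. hor_fraction C W h = hor_fraction C W k \<and> c = full_cell C W h k)" for c
    by (simp add: CW_X1_def CW_cell_iff)
  have sel: "Obj (CW_X1 C W) = CW_hor C W" "src (CW_X1 C W) = ctop" "tgt (CW_X1 C W) = cbot"
    "cmp (CW_X1 C W) = CW_cell_vcomp C W" "idn (CW_X1 C W) = CW_cell_vid C W"
    by (simp_all add: CW_X1_def)
  have hom: "full_cell C W h k \<in> hom (CW_X1 C W) h k"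
    if "h \<in> CW_hor C W" "k \<in> CW_hor C W" "hor_fraction C W h = hor_fraction C W k" for h k
    using that ar unfolding hom_def sel by auto
  show ?thesis
  proof (unfold_locales, goal_cases)
    case (1 f) then show ?case unfolding ar sel by auto
  next
    case (2 f) then show ?case unfolding ar sel by auto
  next
    case (3 f) then show ?case unfolding ar sel by auto
  next
    case (4 a b) then show ?case using hom[of a b] unfolding sel by blast
  next
    case (5 f g) then show ?case unfolding ar sel by auto
  next
    case (6 a) then show ?case using hom[of a a] by (simp add: sel CW_cell_vid_eq)
  next
    case (7 f g)
    then obtain h k l where "h \<in> CW_hor C W" "k \<in> CW_hor C W" "l \<in> CW_hor C W"
      "hor_fraction C W h = hor_fraction C W k" "hor_fraction C W k = hor_fraction C W l"
      "f = full_cell C W h k" "g = full_cell C W k l"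
      unfolding ar sel by auto
    then show ?case
      by (auto simp: sel CW_cell_vcomp_eq intro!: hom)
  qed
qed

section \<open>Lifting strings to \<open>C{W}\<close> and projecting it to fractions\<close>

lemma fraction_arr_hom: "s \<in> spans C W \<Longrightarrow> fraction_arr C W s \<in> hom (fraction_cat C W) (tgt C (fst s)) (tgt C (snd s))"
  by (auto simp: fraction_cat_def fraction_arr_def hom_def)

text \<open>The tail is lifted first. The Ore square against its starting object \<open>v\<close>
  refines the source of the span \<open>(w, f)\<close>, and a refined source can be absorbed only
  where the string begins; lifting from the left would disturb objects already fixed.\<close>

lemma CW_string_lift:
  assumes "is_path (Obj (fraction_cat C W)) (Arr (fraction_cat C W)) (src (fraction_cat C W)) (tgt (fraction_cat C W)) (A, ms)"
  shows "\<exists>v hs. is_path W (CW_hor C W) fst (\<lambda>h. snd (snd h)) (v, hs) \<and> tgt C v = A \<and> map (hor_fraction C W) hs = ms"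
  using assms
proof (induction ms arbitrary: A)
  case Nil
  then show ?case
    by (intro exI[of _ "idn C A"] exI[of _ "[]"]) (simp add: is_path_def fraction_cat_def)
next
  case (Cons m ms)
  interpret L: category "fraction_cat C W"
    by (rule fraction_cat_category)
  have m: "m \<in> Arr (fraction_cat C W)" "src (fraction_cat C W) m = A"
    using Cons.prems by (auto simp: is_path_def)
  then obtain w f where wf: "(w, f) \<in> spans C W" "m = fraction_arr C W (w, f)"
    by (auto simp: fraction_cat_def)
  have A: "A = tgt C w" "tgt (fraction_cat C W) m = tgt C f"
    using m wf by (simp_all add: fraction_cat_def fraction_arr_def)
  have "is_path (Obj (fraction_cat C W)) (Arr (fraction_cat C W)) (src (fraction_cat C W)) (tgt (fraction_cat C W)) (tgt C f, ms)"
    using Cons.prems L.tgt_in[OF m(1)] by (auto simp: is_path_def successively_Cons A)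
  from Cons.IH[OF this] obtain v hs where v: "is_path W (CW_hor C W) fst (\<lambda>h. snd (snd h)) (v, hs)"
    "tgt C v = tgt C f" "map (hor_fraction C W) hs = ms"
    by blast
  then have vW: "v \<in> W"
    by (simp add: is_path_def)
  have wf': "w \<in> W" "f \<in> Arr C" "src C f = src C w"
    using wf by (auto simp: spans_def)
  obtain t g where t: "t \<in> W" "g \<in> Arr C" "tgt C t = src C f" "tgt C g = src C v" "src C g = src C t"
    and te: "f \<cdot> t = v \<cdot> g"
    using ore[OF wf'(2) vW v(2)[symmetric]] .
  have "(w \<cdot> t, g, v) \<in> CW_hor C W"
    using t wf' vW by (simp add: CW_hor_iff)
  moreover from this have "is_path W (CW_hor C W) fst (\<lambda>h. snd (snd h)) (w \<cdot> t, (w \<cdot> t, g, v) # hs)"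
    using v(1) t wf' by (cases hs) (auto simp: is_path_def successively_Cons)
  \<comment> \<open>By \<open>te\<close> the span in question is
    \<open>(w \<cdot> t, f \<cdot> t)\<close>, a refinement of \<open>(w, f)\<close>.\<close>
  moreover have "hor_fraction C W (w \<cdot> t, g, v) = m"
  proof -
    have "(w \<cdot> t, f \<cdot> t) \<in> span_rel C (w, f)"
      using t wf' by (intro span_relI) auto
    then have "fraction C W (w \<cdot> t, f \<cdot> t) = fraction C W (w, f)"
      using span_rel_common[OF frac_rel_span[OF wf(1)]] t wf' by simp
    then show ?thesis
      using t wf wf' by (simp add: hor_fraction_def fraction_arr_def flip: te)
  qed
  ultimately show ?case
    using v t wf' by (intro exI[of _ "w \<cdot> t"] exI[of _ "(w \<cdot> t, g, v) # hs"]) (simp add: A)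
qed

lemma CW_kernel_dblcat: "kernel_dblcat (fraction_cat C W) (CW C W) (tgt C) (hor_fraction C W)"
proof -
  have d: "fob (d0 (CW C W)) = fst" "far (d0 (CW C W)) = cleft" "fob (d1 (CW C W)) = (\<lambda>h. snd (snd h))"
    "far (d1 (CW C W)) = cright" "X0 (CW C W) = CW_X0 C W" "X1 (CW C W) = CW_X1 C W"
    "hid (CW C W) = \<lparr>fob = CW_hor_id C, far = CW_cell_hid C W\<rparr>"
    "hm (CW C W) = \<lparr>fob = CW_hor_comp C, far = CW_cell_hcomp C W\<rparr>"
    by (auto simp: CW_def)
  have sel: "Obj (CW_X1 C W) = CW_hor C W" "src (CW_X1 C W) = ctop" "tgt (CW_X1 C W) = cbot"
    "Obj (CW_X0 C W) = W" "src (CW_X0 C W) (side C W w1 w2) = w1" "tgt (CW_X0 C W) (side C W w1 w2) = w2" for w1 w2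
    by (simp_all add: CW_X1_def CW_X0_def side_def)
  have ar0: "v \<in> Arr (CW_X0 C W) \<longleftrightarrow> (\<exists>w1 \<in> W. \<exists>w2 \<in> W. tgt C w1 = tgt C w2 \<and> v = side C W w1 w2)" for v
    by (simp add: CW_X0_def CW_ver_iff)
  have ar1: "c \<in> Arr (CW_X1 C W) \<longleftrightarrow>
      (\<exists>h \<in> CW_hor C W. \<exists>k \<in> CW_hor C W. hor_fraction C W h = hor_fraction C W k \<and> c = full_cell C W h k)" for c
    by (simp add: CW_X1_def CW_cell_iff)
  have hf_tgt: "tgt C (fst h) = tgt C (fst k) \<and> tgt C (snd (snd h)) = tgt C (snd (snd k))"
    if "hor_fraction C W h = hor_fraction C W k" "h \<in> CW_hor C W" "k \<in> CW_hor C W" for h k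
    using that by (cases h; cases k) (simp add: hor_fraction_def fraction_arr_def CW_hor_iff)
  have hor_id: "CW_hor_id C w \<in> CW_hor C W" "hor_fraction C W (CW_hor_id C w) = idn (fraction_cat C W) (tgt C w)"
    if "w \<in> W" for w
  proof -
    show "CW_hor_id C w \<in> CW_hor C W"
      using that by (simp add: CW_hor_id_def CW_hor_iff)
    \<comment> \<open>A pair of the identity relation with first component in \<open>W\<close>,
      hence a generator of it.\<close>
    have "(w, w) \<in> span_rel C (idn C (tgt C w), idn C (tgt C w))"
      using that by (intro span_relI[of w]) auto
    then have "fraction C W (w, w) = fraction C W (idn C (tgt C w), idn C (tgt C w))"
      using span_rel_common[OF frac_rel_span[OF idn_span]] that by (metis W_Arr tgt_in)
    then show "hor_fraction C W (CW_hor_id C w) = idn (fraction_cat C W) (tgt C w)"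
      using that by (simp add: hor_fraction_def CW_hor_id_def fraction_arr_def fraction_cat_def)
  qed
  have hor_comp: "(w, g \<cdot> f, w'') \<in> CW_hor C W"
    "hor_fraction C W (w, g \<cdot> f, w'') = hor_fraction C W (w', g, w'') \<cdot>\<^bsub>fraction_cat C W\<^esub> hor_fraction C W (w, f, w')"
    if h: "(w, f, w') \<in> CW_hor C W" and k: "(w', g, w'') \<in> CW_hor C W" for w f w' g w''
  proof -
    note ty = h[unfolded CW_hor_iff] k[unfolded CW_hor_iff]
    show "(w, g \<cdot> f, w'') \<in> CW_hor C W"
      using ty by (simp add: CW_hor_iff)
    have t: "tgt C (snd (w, w' \<cdot> f)) = tgt C (fst (w', w'' \<cdot> g))"
      using ty by simp
    note R = frac_rel_relcomp[OF frac_rel_span[OF hor_span[OF h]] frac_rel_span[OF hor_span[OF k], folded t]]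
    \<comment> \<open>The intermediate element \<open>w' \<cdot> f\<close> links the two
      relations.\<close>
    have "(w, w' \<cdot> f) \<in> span_rel C (w, w' \<cdot> f)"
      using ty by (intro span_relI[of "idn C (src C w)"]) auto
    moreover have "(w' \<cdot> f, w'' \<cdot> (g \<cdot> f)) \<in> span_rel C (w', w'' \<cdot> g)"
      using ty by (intro span_relI[of f]) auto
    ultimately have "(w, w'' \<cdot> (g \<cdot> f)) \<in> span_rel C (w, w' \<cdot> f) O span_rel C (w', w'' \<cdot> g)"
      by blast
    then have "fraction C W (w, w'' \<cdot> (g \<cdot> f)) = sat C W (span_rel C (w, w' \<cdot> f) O span_rel C (w', w'' \<cdot> g))"
      using span_rel_common[OF R] ty by simp
    then show "hor_fraction C W (w, g \<cdot> f, w'') = hor_fraction C W (w', g, w'') \<cdot>\<^bsub>fraction_cat C W\<^esub> hor_fraction C W (w, f, w')"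
      using fraction_arr_comp[OF hor_span[OF h] hor_span[OF k] t] ty
      by (simp add: hor_fraction_def) (simp add: fraction_arr_def)
  qed
  have hcat: "Obj (hcat_ob (CW C W)) = W" "Arr (hcat_ob (CW C W)) = CW_hor C W" "src (hcat_ob (CW C W)) = fst"
    "tgt (hcat_ob (CW C W)) = (\<lambda>h. snd (snd h))" "idn (hcat_ob (CW C W)) = CW_hor_id C"
    "cmp (hcat_ob (CW C W)) = (\<lambda>k h. CW_hor_comp C (h, k))"
    by (simp_all add: hcat_ob_def d sel)
  show ?thesis
  proof (rule kernel_dblcat.intro)
    show "category (fraction_cat C W)"
      by (rule fraction_cat_category)
    show "kernel_groupoid (X0 (CW C W)) (tgt C)" "kernel_groupoid (X1 (CW C W)) (hor_fraction C W)"
      by (simp_all add: d CW_X0_kernel_groupoid CW_X1_kernel_groupoid)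
    have side_hom: "side C W w1 w2 \<in> hom (CW_X0 C W) w1 w2" if "w1 \<in> W" "w2 \<in> W" "tgt C w1 = tgt C w2" for w1 w2
      using that unfolding hom_def ar0 by (auto simp: sel ar0)
    have full_hom: "full_cell C W h k \<in> hom (CW_X1 C W) h k"
      if "h \<in> CW_hor C W" "k \<in> CW_hor C W" "hor_fraction C W h = hor_fraction C W k" for h k
      using that unfolding hom_def by (auto simp: sel ar1)
    have hor_W: "fst h \<in> W" "snd (snd h) \<in> W" if "h \<in> CW_hor C W" for h
      using that by (cases h; simp add: CW_hor_iff)+
    have cellE: thesis
      if "c \<in> Arr (CW_X1 C W)"
        "\<And>h k. h \<in> CW_hor C W \<Longrightarrow> k \<in> CW_hor C W \<Longrightarrow> hor_fraction C W h = hor_fraction C W k \<Longrightarrow>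
          c = full_cell C W h k \<Longrightarrow> thesis" for c thesis
      using that unfolding ar1 by blast
    show "graph_map (X1 (CW C W)) (X0 (CW C W)) (d0 (CW C W))"
      unfolding graph_map_def d sel
    proof (intro conjI ballI)
      fix c assume "c \<in> Arr (CW_X1 C W)"
      then obtain h k where "h \<in> CW_hor C W" "k \<in> CW_hor C W" "hor_fraction C W h = hor_fraction C W k" "c = full_cell C W h k"
        by (rule cellE)
      then show "cleft c \<in> hom (CW_X0 C W) (fst (ctop c)) (fst (cbot c))"
        using hf_tgt[of h k] hor_W by (simp add: side_hom)
    qed (rule hor_W)
    show "graph_map (X1 (CW C W)) (X0 (CW C W)) (d1 (CW C W))"
      unfolding graph_map_def d sel
    proof (intro conjI ballI)
      fix c assume "c \<in> Arr (CW_X1 C W)"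
      then obtain h k where "h \<in> CW_hor C W" "k \<in> CW_hor C W" "hor_fraction C W h = hor_fraction C W k" "c = full_cell C W h k"
        by (rule cellE)
      then show "cright c \<in> hom (CW_X0 C W) (snd (snd (ctop c))) (snd (snd (cbot c)))"
        using hf_tgt[of h k] hor_W by (simp add: side_hom)
    qed (rule hor_W)
    show "graph_map (X0 (CW C W)) (X1 (CW C W)) (hid (CW C W))"
      unfolding graph_map_def d sel(4) ftr.simps
    proof (intro conjI ballI)
      fix v assume "v \<in> Arr (CW_X0 C W)"
      then obtain w1 w2 where w: "w1 \<in> W" "w2 \<in> W" "tgt C w1 = tgt C w2" "v = side C W w1 w2"
        unfolding ar0 by blast
      then have "hor_fraction C W (CW_hor_id C w1) = hor_fraction C W (CW_hor_id C w2)"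
        by (simp add: hor_id)
      then show "CW_cell_hid C W v \<in> hom (CW_X1 C W) (CW_hor_id C (src (CW_X0 C W) v)) (CW_hor_id C (tgt (CW_X0 C W) v))"
        using w by (simp add: CW_cell_hid_eq sel full_hom hor_id)
    qed (simp add: sel hor_id)
    show "graph_map (hpairs (CW C W)) (X1 (CW C W)) (hm (CW C W))"
      unfolding graph_map_def
    proof (intro conjI ballI)
      fix a assume "a \<in> Obj (hpairs (CW C W))"
      then show "fob (hm (CW C W)) a \<in> Obj (X1 (CW C W))"
        using hor_comp(1) by (cases a) (auto simp: hpairs_def d sel CW_hor_comp_def)
    next
      fix c assume "c \<in> Arr (hpairs (CW C W))"
      then obtain h k h' k' where c: "c = (full_cell C W h k, full_cell C W h' k')"
        "h \<in> CW_hor C W" "k \<in> CW_hor C W" "hor_fraction C W h = hor_fraction C W k"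
        "h' \<in> CW_hor C W" "k' \<in> CW_hor C W" "hor_fraction C W h' = hor_fraction C W k'"
        "side C W (snd (snd h)) (snd (snd k)) = side C W (fst h') (fst k')"
        by (auto simp: hpairs_def d ar1)
      obtain w1 f1 w1' w2 f2 w2' v1 g1 w1'' v2 g2 w2'' where
        e: "h = (w1, f1, w1')" "k = (w2, f2, w2')" "h' = (v1, g1, w1'')" "k' = (v2, g2, w2'')"
        by (metis surj_pair)
      \<comment> \<open>A vertical arrow carries its ends, so equality of the shared sides forces
        the middle objects to agree.\<close>
      have v: "v1 = w1'" "v2 = w2'"
        using c(8) by (auto simp: e side_def)
      have "hor_fraction C W (w1, g1 \<cdot> f1, w1'') = hor_fraction C W (w2, g2 \<cdot> f2, w2'')"
        using hor_comp(2)[of w1 f1 w1' g1 w1''] hor_comp(2)[of w2 f2 w2' g2 w2''] c(2-7) by (simp add: e v)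
      then have "full_cell C W (w1, g1 \<cdot> f1, w1'') (w2, g2 \<cdot> f2, w2'') \<in>
          hom (CW_X1 C W) (w1, g1 \<cdot> f1, w1'') (w2, g2 \<cdot> f2, w2'')"
        using hor_comp(1) c(2-7) by (intro full_hom) (auto simp: e v)
      moreover have "CW_cell_hcomp C W c = full_cell C W (w1, g1 \<cdot> f1, w1'') (w2, g2 \<cdot> f2, w2'')"
        using c by (simp add: e v CW_cell_hcomp_eq)
      ultimately show "far (hm (CW C W)) c \<in> hom (X1 (CW C W)) (fob (hm (CW C W)) (src (hpairs (CW C W)) c))
          (fob (hm (CW C W)) (tgt (hpairs (CW C W)) c))"
        by (simp add: d) (simp add: c(1) hpairs_def d sel e v CW_hor_comp_def)
    qed
    show "category (hcat_ob (CW C W))"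
      by unfold_locales (auto simp: hcat hom_def CW_hor_iff CW_hor_comp_def CW_hor_id_def)
    show "is_functor (hcat_ob (CW C W)) (fraction_cat C W) \<lparr>fob = tgt C, far = hor_fraction C W\<rparr>"
      unfolding is_functor_def hcat ftr.simps
    proof (intro conjI ballI impI)
      fix h assume h: "h \<in> CW_hor C W"
      obtain w f w' where e: "h = (w, f, w')"
        by (metis surj_pair)
      show "hor_fraction C W h \<in> hom (fraction_cat C W) (tgt C (fst h)) (tgt C (snd (snd h)))"
        using fraction_arr_hom[OF hor_span] h by (simp add: e hor_fraction_def CW_hor_iff)
      fix k assume k: "k \<in> CW_hor C W" "fst k = snd (snd h)"
      obtain g w'' where e': "k = (w', g, w'')"
        using k by (cases k) (auto simp: e)
      show "hor_fraction C W (CW_hor_comp C (h, k)) =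
          hor_fraction C W k \<cdot>\<^bsub>fraction_cat C W\<^esub> hor_fraction C W h"
        using hor_comp(2) h k by (simp add: e e' CW_hor_comp_def)
    qed (simp_all add: hor_id fraction_cat_def)
    fix q k assume q: "q \<in> strings (fraction_cat C W) k"
    obtain A ms where "q = (A, ms)"
      by fastforce
    then show "\<exists>p \<in> strings (hcat_ob (CW C W)) k. map_prod (tgt C) (map (hor_fraction C W)) p = q"
      using CW_string_lift[of A ms] q by (auto simp: strings_def hcat) force
  qed
qed

end

section \<open>Marked paths in the bicategory of fractions\<close>

lemma (in category) path_comp_append:
  assumes "is_path (Obj C) (Arr C) (src C) (tgt C) (a, fs @ gs)"
  shows "path_comp C (a, fs @ gs) = path_comp C (vertex (tgt C) (a, fs) (length fs), gs) \<cdot> path_comp C (a, fs)"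
proof -
  let ?k = "length fs + length gs"
  interpret s: string_in C "(a, fs @ gs)" ?k
    using assms by unfold_locales (simp add: strings_def)
  have v: "vertex (tgt C) (a, fs @ gs) (length fs) = vertex (tgt C) (a, fs) (length fs)"
    by (simp add: vertex_def nth_append)
  have eqs: "seg_comp C (a, fs @ gs) 0 ?k = path_comp C (a, fs @ gs)"
    "seg_comp C (a, fs @ gs) 0 (length fs) = path_comp C (a, fs)"
    "seg_comp C (a, fs @ gs) (length fs) ?k = path_comp C (vertex (tgt C) (a, fs) (length fs), gs)"
    by (simp_all add: seg_comp_def segment_def v vertex_0)
  show ?thesis
    using s.seg_comp_trans[of 0 "length fs" ?k] by (simp add: eqs)
qed

lemma vertex_append:
  "i \<le> length fs \<Longrightarrow> vertex t (a, fs @ gs) i = vertex t (a, fs) i"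
  "vertex t (a, fs @ gs) (length fs + i) = vertex t (vertex t (a, fs) (length fs), gs) i"
  by (auto simp: vertex_def nth_append)

lemma is_path_append:
  assumes "\<And>f. f \<in> As \<Longrightarrow> t f \<in> Os"
  shows "is_path Os As s t (a, fs @ gs) \<longleftrightarrow>
    is_path Os As s t (a, fs) \<and> is_path Os As s t (vertex t (a, fs) (length fs), gs)"
proof -
  have all: "(\<forall>i < m + n. P i) \<longleftrightarrow> (\<forall>i < m. P i) \<and> (\<forall>i < n. P (m + i))" for m n :: nat and P
    by (metis add_less_cancel_left less_diff_conv2 le_add_diff_inverse nat_le_linear not_less trans_less_add1)
  have "vertex t (a, fs) (length fs) \<in> Os" if "is_path Os As s t (a, fs)"
    using that assms by (cases fs rule: rev_cases) (auto simp: is_path_iff vertex_def)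
  then show ?thesis
    by (auto simp: is_path_iff all nth_append vertex_append)
qed

lemma is_path_segment:
  assumes p: "is_path Os As s t p" and t: "\<And>f. f \<in> As \<Longrightarrow> t f \<in> Os" and "i \<le> j" "j \<le> length (snd p)"
  shows "is_path Os As s t (segment t p i j)"
    and "fst (segment t p i j) = vertex t p i" and "length (snd (segment t p i j)) = j - i"
    and "vertex t (segment t p i j) (j - i) = vertex t p j"
proof -
  have v: "vertex t (segment t p i j) n = vertex t p (i + n)" if "n \<le> j - i" for n
    using that assms by (cases n) (auto simp: segment_def vertex_def)
  show "vertex t (segment t p i j) (j - i) = vertex t p j"
    using v[of "j - i"] assms by simp
  have "vertex t p i \<in> Os"
    using assms by (cases i) (auto simp: is_path_iff vertex_def)
  then show "is_path Os As s t (segment t p i j)"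
    using assms v by (auto simp: is_path_iff) (auto simp: segment_def)
qed (use assms in \<open>auto simp: segment_def\<close>)

section \<open>Composites and 2-cells in the bicategory of fractions\<close>

locale chosen_fractions = calculus_of_fractions C W
  for C :: "('o, 'a) cat" (structure) and W :: "'a set" +
  fixes sq :: "'a \<Rightarrow> 'a \<Rightarrow> 'a \<times> 'a"
  assumes sq: "chosen_squares C W sq"
begin

abbreviation B where "B \<equiv> fractions C W sq"
abbreviation L where "L \<equiv> fraction_cat C W"

lemma fractions_sel [simp]: "BObj B = Obj C" "BArr B = spans C W" "bsrc B = (\<lambda>s. tgt C (fst s))"
  "btgt B = (\<lambda>s. tgt C (snd s))" "BCell B = fcells C W" "bdom B \<alpha> = fst \<alpha>" "bcod B \<alpha> = snd (snd \<alpha>)"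
  "bid B A = (idn C A, idn C A)" "bcomp B = span_comp C sq" "bcid B s = the_fcell C W s s"
  "bvcomp B \<beta> \<alpha> = the_fcell C W (fst \<alpha>) (snd (snd \<beta>))"
  "bhcomp B \<beta> \<alpha> = the_fcell C W (span_comp C sq (fst \<beta>) (fst \<alpha>))
    (span_comp C sq (snd (snd \<beta>)) (snd (snd \<alpha>)))"
  "bassoc B s t r = the_fcell C W (span_comp C sq (span_comp C sq s t) r) (span_comp C sq s (span_comp C sq t r))"
  "blunit B s = the_fcell C W (span_comp C sq (idn C (tgt C (snd s)), idn C (tgt C (snd s))) s) s"
  "brunit B s = the_fcell C W (span_comp C sq s (idn C (tgt C (fst s)), idn C (tgt C (fst s)))) s"
  by (simp_all add: fractions_def Let_def split_beta fun_eq_iff)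

text \<open>By \<open>side_eq_all\<close> the class of any representative is the set of all of them,
  so the definite description in \<open>the_fcell\<close> is met exactly once.\<close>

lemma the_fcell_eq:
  assumes s: "s \<in> spans C W" and t: "t \<in> spans C W" and "fraction_arr C W s = fraction_arr C W t"
  shows "the_fcell C W s t \<in> fcells C W" "fst (the_fcell C W s t) = s" "snd (snd (the_fcell C W s t)) = t"
    and "\<And>\<alpha>. \<alpha> \<in> fcells C W \<Longrightarrow> fst \<alpha> = s \<Longrightarrow> snd (snd \<alpha>) = t \<Longrightarrow> \<alpha> = the_fcell C W s t"
proof -
  have eq: "tgt C (fst s) = tgt C (fst t)" "tgt C (snd s) = tgt C (snd t)" "fraction C W s = fraction C W t"
    using assms(3) by (simp_all add: fraction_arr_def)
  have W: "fst s \<in> W" "fst t \<in> W"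
    using s t by (auto simp: spans_def)
  have side: "side_rep C W (fst s) (fst t) p" if "fcell_rep C W s t p" for p
    using that by (cases s; cases t; cases p) (simp add: fcell_rep_def)
  have cls: "{q. fcell_rep C W s t q \<and> side_eq C W (fst s) p q} = {q. fcell_rep C W s t q}"
    if "fcell_rep C W s t p" for p
    using side_eq_all[OF W side[OF that] side] by blast
  obtain p where p: "fcell_rep C W s t p"
    using fraction_eq_iff[OF s t eq(1,2)] eq(3) by blast
  have ex: "(s, {q. fcell_rep C W s t q}, t) \<in> fcells C W"
    unfolding fcells_def using s t eq p cls[OF p, symmetric] by blast
  have uniq: "\<alpha> = (s, {q. fcell_rep C W s t q}, t)"
    if \<alpha>: "\<alpha> \<in> fcells C W" "fst \<alpha> = s" "snd (snd \<alpha>) = t" for \<alpha>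
  proof -
    obtain s' t' p where "\<alpha> = (s', {q. fcell_rep C W s' t' q \<and> side_eq C W (fst s') p q}, t')" "fcell_rep C W s' t' p"
      using \<alpha>(1) unfolding fcells_def by blast
    then show ?thesis
      using \<alpha>(2,3) cls[of p] by simp
  qed
  have the: "the_fcell C W s t = (s, {q. fcell_rep C W s t q}, t)"
    unfolding the_fcell_def
  proof (rule the_equality)
    show "\<alpha> = (s, {q. fcell_rep C W s t q}, t)" if "\<alpha> \<in> fcells C W \<and> fst \<alpha> = s \<and> snd (snd \<alpha>) = t" for \<alpha>
      using uniq that by blast
  qed (simp add: ex)
  show "the_fcell C W s t \<in> fcells C W" "fst (the_fcell C W s t) = s" "snd (snd (the_fcell C W s t)) = t"
    using ex by (simp_all add: the)
  show "\<And>\<alpha>. \<alpha> \<in> fcells C W \<Longrightarrow> fst \<alpha> = s \<Longrightarrow> snd (snd \<alpha>) = t \<Longrightarrow> \<alpha> = the_fcell C W s t"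
    using uniq by (simp add: the)
qed

lemma fcells_ends:
  assumes "\<alpha> \<in> fcells C W"
  shows "fst \<alpha> \<in> spans C W" "snd (snd \<alpha>) \<in> spans C W" "fraction_arr C W (fst \<alpha>) = fraction_arr C W (snd (snd \<alpha>))"
proof -
  obtain s t p where \<alpha>: "\<alpha> = (s, {q. fcell_rep C W s t q \<and> side_eq C W (fst s) p q}, t)"
    and st: "s \<in> spans C W" "t \<in> spans C W" "tgt C (fst s) = tgt C (fst t)" "tgt C (snd s) = tgt C (snd t)"
      "fcell_rep C W s t p"
    using assms unfolding fcells_def by blast
  then show "fst \<alpha> \<in> spans C W" "snd (snd \<alpha>) \<in> spans C W"
    by simp_all
  show "fraction_arr C W (fst \<alpha>) = fraction_arr C W (snd (snd \<alpha>))"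
    using fraction_eq_iff[OF st(1-4)] st(3-5) unfolding fraction_arr_def \<alpha> fst_conv snd_conv by blast
qed

text \<open>Whatever square \<open>sq\<close> provides, it produces a generating pair of the
  composite relation, so the fraction of the composite is independent of \<open>sq\<close>.\<close>

lemma span_comp_fraction:
  assumes s: "s \<in> spans C W" and t: "t \<in> spans C W" and st: "tgt C (snd s) = tgt C (fst t)"
  shows "span_comp C sq t s \<in> spans C W" "tgt C (fst (span_comp C sq t s)) = tgt C (fst s)"
    "tgt C (snd (span_comp C sq t s)) = tgt C (snd t)"
    "fraction_arr C W (span_comp C sq t s) = fraction_arr C W t \<cdot>\<^bsub>L\<^esub> fraction_arr C W s"
proof -
  note R = frac_rel_relcomp[OF frac_rel_span[OF s] frac_rel_span[OF t, folded st]]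
  obtain w f v g where [simp]: "s = (w, f)" "t = (v, g)" by fastforce
  obtain q h where sq': "sq f v = (q, h)" by fastforce
  have "f \<in> Arr C" "v \<in> W" "tgt C f = tgt C v"
    using s t st by (auto simp: spans_def)
  then have q: "q \<in> W" "h \<in> Arr C" "tgt C q = src C f" "tgt C h = src C v" "src C h = src C q" "f \<cdot> q = v \<cdot> h"
    using sq sq' unfolding chosen_squares_def by (fastforce simp: hom_def)+
  have comp: "span_comp C sq (v, g) (w, f) = (w \<cdot> q, g \<cdot> h)"
    by (simp add: span_comp_def sq')
  have "(w \<cdot> q, f \<cdot> q) \<in> span_rel C s" "(f \<cdot> q, g \<cdot> h) \<in> span_rel C t"
    using q s t by (auto simp: spans_def intro: span_relI[of q] span_relI[of h])
  then have "(w \<cdot> q, g \<cdot> h) \<in> span_rel C s O span_rel C t"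
    by blast
  then have "sat C W (span_rel C s O span_rel C t) = fraction C W (w \<cdot> q, g \<cdot> h)"
    using span_rel_common[OF R] q s by (simp add: spans_def)
  moreover show "span_comp C sq t s \<in> spans C W" "tgt C (fst (span_comp C sq t s)) = tgt C (fst s)"
    "tgt C (snd (span_comp C sq t s)) = tgt C (snd t)"
    using q s t by (auto simp: comp spans_def)
  ultimately show "fraction_arr C W (span_comp C sq t s) = fraction_arr C W t \<cdot>\<^bsub>L\<^esub> fraction_arr C W s"
    using fraction_arr_comp[OF s t st] by (simp only: fraction_arr_def prod.sel) (simp add: comp)
qed

lemma fraction_cat_sel [simp]: "Obj L = Obj C" "Arr L = fraction_arr C W ` spans C W"
  "src L (fraction_arr C W s) = tgt C (fst s)" "tgt L (fraction_arr C W s) = tgt C (snd s)"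
  by (simp_all add: fraction_cat_def fraction_arr_def)

lemma fraction_cat_idn: "A \<in> Obj C \<Longrightarrow> idn L A = fraction_arr C W (idn C A, idn C A)"
  by (simp add: fraction_cat_def fraction_arr_def)

sublocale L: category L
  by (rule fraction_cat_category)

abbreviation fpath :: "'o \<times> 'a span list \<Rightarrow> 'o \<times> ('o \<times> ('a \<times> 'a) set \<times> 'o) list" where
  "fpath \<equiv> map_prod (\<lambda>A. A) (map (fraction_arr C W))"

lemma vertex_fpath: "i \<le> length (snd p) \<Longrightarrow> vertex (tgt L) (fpath p) i = vertex (btgt B) p i"
  by (auto simp: vertex_def)

lemma btgt_in: "s \<in> BArr B \<Longrightarrow> btgt B s \<in> BObj B"
  by (auto simp: spans_def)

lemmas bpath_append = is_path_append[of "BArr B" "btgt B" "BObj B", OF btgt_in, simplified]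

lemma fpath_strings: "bpath B p \<Longrightarrow> fpath p \<in> strings L (length (snd p))"
  by (auto simp: strings_def is_path_iff vertex_fpath)

lemma word_ends: "word_ok B s \<Longrightarrow> word_src B s \<in> Obj C" "word_ok B s \<Longrightarrow> word_tgt B s \<in> Obj C"
  by (induction s) (auto simp: spans_def)

text \<open>In \<open>L\<close> bracketing and units disappear: the fraction of a formal composite
  depends on its starting object and letters alone. All parts are proved together because composing
  two words uses the ends of both.\<close>

lemma word_fraction:
  assumes "word_ok B s"
  shows "eval_word B s \<in> spans C W" "tgt C (fst (eval_word B s)) = word_src B s"
    "tgt C (snd (eval_word B s)) = word_tgt B s" "bpath B (word_src B s, letters s)"
    "vertex (btgt B) (word_src B s, letters s) (length (letters s)) = word_tgt B s"
    "fraction_arr C W (eval_word B s) = path_comp L (fpath (word_src B s, letters s))"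
proof -
  have "eval_word B s \<in> spans C W \<and> tgt C (fst (eval_word B s)) = word_src B s \<and>
    tgt C (snd (eval_word B s)) = word_tgt B s \<and> bpath B (word_src B s, letters s) \<and>
    vertex (btgt B) (word_src B s, letters s) (length (letters s)) = word_tgt B s \<and>
    fraction_arr C W (eval_word B s) = path_comp L (fpath (word_src B s, letters s))"
    using assms
  proof (induction s)
    case (Unit A)
    then show ?case
      by (simp add: is_path_def vertex_0 path_comp_def fraction_cat_idn)
  next
    case (Letter f)
    then have f: "f \<in> spans C W" "tgt C (fst f) \<in> Obj C"
      by (auto simp: spans_def)
    then show ?case
      using L.idn_right[OF fraction_arr_hom[OF f(1)]] by (simp add: is_path_def vertex_def path_comp_def)
  next
    case (Seq s t)
    then have ok: "word_ok B s" "word_ok B t" "word_tgt B s = word_src B t"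
      by auto
    note IH = Seq.IH(1)[OF ok(1)] Seq.IH(2)[OF ok(2)]
    have p: "bpath B (word_src B s, letters s @ letters t)"
      using IH ok by (simp add: bpath_append)
    have "is_path (Obj L) (Arr L) (src L) (tgt L)
        (word_src B s, map (fraction_arr C W) (letters s) @ map (fraction_arr C W) (letters t))"
      using fpath_strings[OF p] by (simp add: strings_def)
    note this[THEN L.path_comp_append]
    moreover have "vertex (tgt L) (word_src B s, map (fraction_arr C W) (letters s)) (length (map (fraction_arr C W) (letters s))) =
        word_src B t"
      using vertex_fpath[of "length (letters s)" "(word_src B s, letters s)"] IH ok by simp
    moreover have "vertex (btgt B) (word_src B s, letters s @ letters t) (length (letters s) + length (letters t)) = word_tgt B t"
      using IH ok by (simp only: vertex_append)
    ultimately show ?case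
      using p IH ok span_comp_fraction[of "eval_word B s" "eval_word B t"] by simp
  qed
  then show "eval_word B s \<in> spans C W" "tgt C (fst (eval_word B s)) = word_src B s"
    "tgt C (snd (eval_word B s)) = word_tgt B s" "bpath B (word_src B s, letters s)"
    "vertex (btgt B) (word_src B s, letters s) (length (letters s)) = word_tgt B s"
    "fraction_arr C W (eval_word B s) = path_comp L (fpath (word_src B s, letters s))"
    by blast+
qed

text \<open>\<open>chosen_composites\<close> prescribes only the letters of a bracketing.
  Unit-freeness rules out units at wrong objects, so that typing follows from the path.\<close>

lemma unit_free_word:
  "unit_free s \<Longrightarrow> bpath B (a, letters s) \<Longrightarrow> word_ok B s \<and> word_src B s = a"
proof (induction s arbitrary: a)
  case (Unit A)
  then show ?case by simp
next
  case (Letter f)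
  then show ?case by (simp add: is_path_def)
next
  case (Seq s t)
  then have p: "bpath B (a, letters s)" "bpath B (vertex (btgt B) (a, letters s) (length (letters s)), letters t)"
    by (simp_all add: bpath_append)
  show ?case
    using Seq.IH(1)[OF _ p(1)] Seq.IH(2)[OF _ p(2)] Seq.prems(1) word_fraction(5)[of s] by auto
qed

section \<open>Coherence cells between formal composites\<close>

definition parallel :: "('o, 'a span) word \<Rightarrow> ('o, 'a span) word \<Rightarrow> bool" where
  "parallel s t \<longleftrightarrow> word_ok B s \<and> word_ok B t \<and> word_src B s = word_src B t \<and> letters s = letters t"

lemma parallel_tgt: "parallel s t \<Longrightarrow> word_tgt B s = word_tgt B t"
  unfolding parallel_def using word_fraction(5) by metis

lemma parallel_fraction:
  assumes "parallel s t"
  shows "eval_word B s \<in> spans C W" "eval_word B t \<in> spans C W"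
    "fraction_arr C W (eval_word B s) = fraction_arr C W (eval_word B t)"
  using assms word_fraction(1,6) by (simp_all add: parallel_def)

lemma parallel_fcell:
  assumes "parallel s t"
  shows "fst (the_fcell C W (eval_word B s) (eval_word B t)) = eval_word B s"
    "snd (snd (the_fcell C W (eval_word B s) (eval_word B t))) = eval_word B t"
  using the_fcell_eq(2,3)[OF parallel_fraction[OF assms]] .

lemma inverse_the_fcell:
  assumes s: "s \<in> spans C W" and t: "t \<in> spans C W" and eq: "fraction_arr C W s = fraction_arr C W t"
  shows "inverse_cells B (the_fcell C W s t) (the_fcell C W t s)"
    and "inverse_cells B (the_fcell C W s t) \<beta> \<Longrightarrow> \<beta> = the_fcell C W t s"
proof -
  note st = the_fcell_eq[OF s t eq] and ts = the_fcell_eq[OF t s eq[symmetric]]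
  show "inverse_cells B (the_fcell C W s t) (the_fcell C W t s)"
    using st(1-3) ts(1-3) by (simp add: inverse_cells_def)
  show "\<beta> = the_fcell C W t s" if "inverse_cells B (the_fcell C W s t) \<beta>"
    using that st(2,3) by (intro ts(4)) (simp_all add: inverse_cells_def)
qed

text \<open>The uniqueness half of coherence: every rule relates words with the same start and
  letters, and every operation on cells returns the unique cell between its ends.\<close>

lemma coherence_sound:
  "coherence B s t \<alpha> \<Longrightarrow> parallel s t \<and> \<alpha> = the_fcell C W (eval_word B s) (eval_word B t)"
proof (induction rule: coherence.induct)
  case (coh_id s)
  then show ?case by (simp add: parallel_def)
next
  case (coh_assoc r s t)
  then show ?case by (simp add: parallel_def)
next
  case (coh_lunit s)
  then have "word_tgt B s \<in> Obj C"
    by (rule word_ends)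
  then show ?case
    using coh_lunit word_fraction(3)[of s] by (simp add: parallel_def)
next
  case (coh_runit s)
  then have "word_src B s \<in> Obj C"
    by (rule word_ends)
  then show ?case
    using coh_runit word_fraction(2)[of s] by (simp add: parallel_def)
next
  case (coh_inv s t \<alpha> \<beta>)
  then have "parallel s t" "\<beta> = the_fcell C W (eval_word B t) (eval_word B s)"
    using inverse_the_fcell(2)[OF parallel_fraction[of s t]] by blast+
  then show ?case
    by (simp add: parallel_def)
next
  case (coh_vcomp r s \<alpha> t \<beta>)
  then have p: "parallel r s" "parallel s t" "parallel r t"
    by (auto simp: parallel_def)
  then show ?case
    using coh_vcomp parallel_fcell[OF p(1)] parallel_fcell[OF p(2)] by simp
next
  case (coh_hcomp s s' \<alpha> t t' \<beta>)
  then have p: "parallel s s'" "parallel t t'"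
    by auto
  then have "parallel (Seq s t) (Seq s' t')"
    using coh_hcomp parallel_tgt[of s s'] by (simp add: parallel_def)
  then show ?case
    using coh_hcomp parallel_fcell[OF p(1)] parallel_fcell[OF p(2)] by simp
qed

lemma coherence_sym: "coherence B s t \<alpha> \<Longrightarrow> \<exists>\<beta>. coherence B t s \<beta>"
  using coherence_sound[of s t \<alpha>] inverse_the_fcell(1)[OF parallel_fraction[of s t]] coh_inv[of B s t \<alpha>]
  by blast

lemma coherence_trans: "\<exists>\<alpha>. coherence B r s \<alpha> \<Longrightarrow> \<exists>\<alpha>. coherence B s t \<alpha> \<Longrightarrow> \<exists>\<alpha>. coherence B r t \<alpha>"
  using coh_vcomp by metis

text \<open>Right-nested words closed by a unit, as in Mac Lane's coherence proof. The final unit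
  treats the empty path like all others.\<close>

primrec normal_word :: "'o \<Rightarrow> 'a span list \<Rightarrow> ('o, 'a span) word" where
  "normal_word a [] = Unit a"
| "normal_word a (f # fs) = Seq (Letter f) (normal_word (btgt B f) fs)"

lemma normal_word_ok: "bpath B (a, fs) \<Longrightarrow> word_ok B (normal_word a fs) \<and> word_src B (normal_word a fs) = a"
proof (induction fs arbitrary: a)
  case Nil
  then show ?case by (simp add: is_path_def)
next
  case (Cons f fs)
  then have "f \<in> spans C W" "tgt C (fst f) = a"
    by (simp_all add: is_path_def)
  moreover have "bpath B (tgt C (snd f), fs)"
    using Cons.prems bpath_append[where a = a and fs = "[f]" and gs = fs] by (simp add: vertex_def)
  ultimately show ?case
    using Cons.IH by simp
qed

text \<open>The tail \<open>fs\<close> carries the induction: \<open>Seq s t\<close> is absorbed by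
  pushing first \<open>t\<close> and then \<open>s\<close> onto the tail, with one reassociation in
  front.\<close>

lemma coherence_normal_word:
  "word_ok B s \<Longrightarrow> bpath B (word_tgt B s, fs) \<Longrightarrow>
    \<exists>\<alpha>. coherence B (Seq s (normal_word (word_tgt B s) fs)) (normal_word (word_src B s) (letters s @ fs)) \<alpha>"
proof (induction s arbitrary: fs)
  case (Unit A)
  then show ?case
    using normal_word_ok[of A fs] coh_runit[of B "normal_word A fs"]
    by (metis append_Nil letters.simps(1) word_src.simps(1) word_tgt.simps(1))
next
  case (Letter f)
  then show ?case
    using normal_word_ok[of "btgt B f" fs] coh_id[of B "Seq (Letter f) (normal_word (btgt B f) fs)"]
    by (auto simp del: fractions_sel split_paired_Ex)
next
  case (Seq s t)
  let ?n = "normal_word (word_tgt B t) fs"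
  have ok: "word_ok B s" "word_ok B t" "word_tgt B s = word_src B t" "bpath B (word_tgt B t, fs)"
    using Seq.prems by auto
  have n: "word_ok B ?n" "word_src B ?n = word_tgt B t"
    using normal_word_ok[OF ok(4)] by auto
  have p: "bpath B (word_tgt B s, letters t @ fs)"
    using word_fraction(4,5)[OF ok(2)] ok by (simp add: bpath_append)
  have "word_ok B (Seq s (Seq t ?n))"
    using ok n by simp
  \<comment> \<open>In traversal order \<open>coh_assoc\<close> leads from the right-nested to the
    left-nested word, hence the inverse.\<close>
  then have "\<exists>\<alpha>. coherence B (Seq (Seq s t) ?n) (Seq s (Seq t ?n)) \<alpha>"
    using coherence_sym coh_assoc by metis
  moreover have "\<exists>\<alpha>. coherence B (Seq s (Seq t ?n)) (Seq s (normal_word (word_tgt B s) (letters t @ fs))) \<alpha>"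
    using Seq.IH(2)[OF ok(2,4)] coh_hcomp[OF coh_id[OF ok(1)]] ok(3) by (metis word_src.simps(3))
  moreover have "\<exists>\<alpha>. coherence B (Seq s (normal_word (word_tgt B s) (letters t @ fs)))
      (normal_word (word_src B s) (letters s @ letters t @ fs)) \<alpha>"
    using Seq.IH(1)[OF ok(1) p] .
  ultimately show ?case
    using coherence_trans by (metis append_assoc letters.simps(3) word_src.simps(3) word_tgt.simps(3))
qed

text \<open>The existence half: both words reduce to the same normal word. The definite description
  in \<open>Phi\<close> calls for such a derivation from associativity and unit cells.\<close>

lemma coherence_complete:
  assumes "parallel s t"
  shows "\<exists>\<alpha>. coherence B s t \<alpha>"
proof -
  have nf: "\<exists>\<alpha>. coherence B s (normal_word (word_src B s) (letters s)) \<alpha>" if s: "word_ok B s" for s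
  proof -
    have "word_tgt B s \<in> Obj C"
      using s by (rule word_ends)
    then have "bpath B (word_tgt B s, [])"
      by (simp add: is_path_def)
    \<comment> \<open>With an empty tail the reduction starts at \<open>s\<close> followed by a
      unit, which \<open>coh_lunit\<close> removes.\<close>
    then have "\<exists>\<alpha>. coherence B (Seq s (Unit (word_tgt B s))) (normal_word (word_src B s) (letters s)) \<alpha>"
      using coherence_normal_word[OF s, of "[]"] by simp
    then show ?thesis
      using coherence_trans coherence_sym coh_lunit[OF s] by metis
  qed
  show ?thesis
    using nf[of s] nf[of t] assms coherence_trans coherence_sym unfolding parallel_def by metis
qed


lemma bpath_segment:
  assumes "bpath B p" "i \<le> j" "j \<le> length (snd p)"
  shows "bpath B (segment (btgt B) p i j)"
    "vertex (btgt B) (segment (btgt B) p i j) (length (snd (segment (btgt B) p i j))) = vertex (btgt B) p j"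
  using is_path_segment[OF assms(1) btgt_in assms(2,3)] by simp_all

end

section \<open>The double category of marked paths\<close>

lemma hor_concat_simp [simp]: "hor_concat ((p, i, j), (q, k, l)) = (p, i, l)"
  by (simp add: hor_concat_def)

lemma mark_simps [simp]: "mark0 (p, i, j) = (p, i)" "mark1 (p, i, j) = (p, j)"
  by (simp_all add: mark0_def mark1_def)

locale chosen_bracketing = chosen_fractions C W sq
  for C :: "('o, 'a) cat" (structure) and W sq +
  fixes br :: "'o \<times> 'a span list \<Rightarrow> ('o, 'a span) word"
  assumes br: "chosen_composites B br"
begin

lemma br_word:
  assumes "bpath B p"
  shows "word_ok B (br p)" "letters (br p) = snd p" "word_src B (br p) = fst p"
    "word_tgt B (br p) = vertex (btgt B) p (length (snd p))"
proof -
  obtain a fs where p: "p = (a, fs)" by fastforce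
  have *: "if fs = [] then br (a, fs) = Unit a else unit_free (br (a, fs)) \<and> letters (br (a, fs)) = fs"
    using br assms unfolding chosen_composites_def p by blast
  have "word_ok B (br p) \<and> letters (br p) = snd p \<and> word_src B (br p) = fst p"
  proof (cases "fs = []")
    case True
    then show ?thesis
      using * assms by (simp add: p is_path_def)
  next
    case False
    then show ?thesis
      using * unit_free_word[of "br p" a] assms by (simp add: p)
  qed
  then show w: "word_ok B (br p)" "letters (br p) = snd p" "word_src B (br p) = fst p"
    by auto
  show "word_tgt B (br p) = vertex (btgt B) p (length (snd p))"
    using word_fraction(5)[OF w(1)] w by simp
qed

abbreviation path_fraction :: "('o, 'a span) mpath2 \<Rightarrow> 'o \<times> ('a \<times> 'a) set \<times> 'o" where
  "path_fraction h \<equiv> fraction_arr C W (mcomp B br h)"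

lemma marked_word:
  assumes "(p, i, j) \<in> marked2 B"
  shows "word_ok B (mword B br (p, i, j))" "letters (mword B br (p, i, j)) = drop i (take j (snd p))"
    "word_src B (mword B br (p, i, j)) = mobj B (p, i)" "word_tgt B (mword B br (p, i, j)) = mobj B (p, j)"
proof -
  have h: "bpath B p" "i \<le> j" "j \<le> length (snd p)"
    using assms by (auto simp: marked2_def)
  note s = bpath_segment[OF h]
  show "word_ok B (mword B br (p, i, j))" "letters (mword B br (p, i, j)) = drop i (take j (snd p))"
    "word_src B (mword B br (p, i, j)) = mobj B (p, i)" "word_tgt B (mword B br (p, i, j)) = mobj B (p, j)"
    using br_word[OF s(1)] s(2) by (simp_all add: mword_def mobj_def del: fractions_sel) (simp_all add: segment_def)
qed

text \<open>The chosen bracketings leave no trace in \<open>L\<close>, so that compatibility of the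
  projection with horizontal composition becomes the triangle law
  \<open>seg_comp_trans\<close>.\<close>

lemma path_fraction_eq:
  assumes "(p, i, j) \<in> marked2 B"
  shows "path_fraction (p, i, j) = seg_comp L (fpath p) i j"
  using word_fraction(6)[OF marked_word(1)[OF assms]] marked_word(2,3)[OF assms] vertex_fpath[of i p] assms
  by (simp add: mcomp_def seg_comp_def segment_def mobj_def marked2_def drop_map take_map del: fractions_sel)

lemma mcomp_span:
  assumes "h \<in> marked2 B"
  shows "mcomp B br h \<in> spans C W" "tgt C (fst (mcomp B br h)) = mobj B (mark0 h)"
    "tgt C (snd (mcomp B br h)) = mobj B (mark1 h)"
proof -
  obtain p i j where h: "h = (p, i, j)"
    by (metis surj_pair)
  show "mcomp B br h \<in> spans C W" "tgt C (fst (mcomp B br h)) = mobj B (mark0 h)"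
    "tgt C (snd (mcomp B br h)) = mobj B (mark1 h)"
    using word_fraction(1-3)[OF marked_word(1)] marked_word(3,4) assms by (simp_all add: h mcomp_def del: fractions_sel)
qed

definition dcell :: "('o, 'a span) mpath2 \<Rightarrow> ('o, 'a span) mpath2 \<Rightarrow> ('o, 'a span, 'a fcell) mcell" where
  "dcell h k = (h, the_fcell C W (mcomp B br h) (mcomp B br k), k)"

lemma path_fraction_ends:
  "h \<in> marked2 B \<Longrightarrow> k \<in> marked2 B \<Longrightarrow> path_fraction h = path_fraction k \<Longrightarrow>
    mobj B (mark0 h) = mobj B (mark0 k) \<and> mobj B (mark1 h) = mobj B (mark1 k)"
  using mcomp_span[of h] mcomp_span[of k] by (simp add: fraction_arr_def del: fractions_sel)

lemma Dbl_cell_iff: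
  "c \<in> Arr (Dbl_X1 B br) \<longleftrightarrow>
    (\<exists>h \<in> marked2 B. \<exists>k \<in> marked2 B. path_fraction h = path_fraction k \<and> c = dcell h k)"
proof
  assume c: "c \<in> Arr (Dbl_X1 B br)"
  obtain h \<alpha> k where e: "c = (h, \<alpha>, k)"
    by (metis surj_pair)
  have hk: "h \<in> marked2 B" "k \<in> marked2 B" "\<alpha> \<in> fcells C W" "fst \<alpha> = mcomp B br h" "snd (snd \<alpha>) = mcomp B br k"
    using c by (auto simp: Dbl_X1_def e)
  have "path_fraction h = path_fraction k"
    using fcells_ends(3)[OF hk(3)] hk by simp
  moreover from this have "\<alpha> = the_fcell C W (mcomp B br h) (mcomp B br k)"
    using the_fcell_eq(4)[OF mcomp_span(1) mcomp_span(1)] hk by blast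
  ultimately show "\<exists>h \<in> marked2 B. \<exists>k \<in> marked2 B. path_fraction h = path_fraction k \<and> c = dcell h k"
    using hk e unfolding dcell_def by blast
next
  assume "\<exists>h \<in> marked2 B. \<exists>k \<in> marked2 B. path_fraction h = path_fraction k \<and> c = dcell h k"
  then obtain h k where hk: "h \<in> marked2 B" "k \<in> marked2 B" "path_fraction h = path_fraction k" "c = dcell h k"
    by blast
  then show "c \<in> Arr (Dbl_X1 B br)"
    using the_fcell_eq(1-3)[OF mcomp_span(1)[OF hk(1)] mcomp_span(1)[OF hk(2)] hk(3)] path_fraction_ends[OF hk(1-3)]
    by (simp add: Dbl_X1_def dcell_def)
qed

lemma Dbl_X0_kernel_groupoid: "kernel_groupoid (Dbl_X0 B) (mobj B)"
proof (unfold_locales, goal_cases)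
  case (4 a b)
  then have "(a, b) \<in> hom (Dbl_X0 B) a b"
    by (simp add: Dbl_X0_def hom_def del: fractions_sel)
  then show ?case by blast
next
  case (7 f g)
  then show ?case
    by (cases f; cases g) (simp add: Dbl_X0_def hom_def del: fractions_sel)
qed (simp_all add: Dbl_X0_def hom_def split_beta prod_eq_iff del: fractions_sel)

lemma Dbl_X1_kernel_groupoid: "kernel_groupoid (Dbl_X1 B br) path_fraction"
proof -
  have sel: "Obj (Dbl_X1 B br) = marked2 B" "src (Dbl_X1 B br) (dcell h k) = h" "tgt (Dbl_X1 B br) (dcell h k) = k"
    "idn (Dbl_X1 B br) h = dcell h h" for h k
    by (simp_all add: Dbl_X1_def dcell_def)
  have hom: "dcell h k \<in> hom (Dbl_X1 B br) h k"
    if "h \<in> marked2 B" "k \<in> marked2 B" "path_fraction h = path_fraction k" for h k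
    using that Dbl_cell_iff unfolding hom_def by (simp add: sel) blast
  have cmp: "dcell k l \<cdot>\<^bsub>Dbl_X1 B br\<^esub> dcell h k = dcell h l"
    if "h \<in> marked2 B" "k \<in> marked2 B" "l \<in> marked2 B" "path_fraction h = path_fraction k" "path_fraction k = path_fraction l" for h k l
    using that the_fcell_eq(2)[OF mcomp_span(1) mcomp_span(1), of h k] the_fcell_eq(3)[OF mcomp_span(1) mcomp_span(1), of k l]
    by (simp add: Dbl_X1_def dcell_def)
  have arE: thesis if "c \<in> Arr (Dbl_X1 B br)"
    "\<And>h k. h \<in> marked2 B \<Longrightarrow> k \<in> marked2 B \<Longrightarrow> path_fraction h = path_fraction k \<Longrightarrow> c = dcell h k \<Longrightarrow> thesis" for c thesis
    using that Dbl_cell_iff by blast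
  show ?thesis
  proof (unfold_locales, goal_cases)
    case (1 f) then show ?case by (rule arE) (simp add: sel)
  next
    case (2 f) then show ?case by (rule arE) (simp add: sel)
  next
    case (3 f) then show ?case by (rule arE) (simp add: sel)
  next
    case (4 a b) then show ?case using hom[of a b] unfolding sel by blast
  next
    case (5 f g)
    obtain h k where "f = dcell h k"
      using 5(1) by (rule arE)
    moreover obtain h' k' where "g = dcell h' k'"
      using 5(2) by (rule arE)
    ultimately show ?case
      using 5 by (simp add: sel)
  next
    case (6 a) then show ?case using hom[of a a] by (simp add: sel)
  next
    case (7 f g)
    obtain h k where f: "h \<in> marked2 B" "k \<in> marked2 B" "path_fraction h = path_fraction k" "f = dcell h k"
      using 7(1) by (rule arE)
    obtain k' l where g: "k' \<in> marked2 B" "l \<in> marked2 B" "path_fraction k' = path_fraction l" "g = dcell k' l"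
      using 7(2) by (rule arE)
    have "k' = k"
      using 7(3) f(4) g(4) by (simp add: sel)
    then show ?case
      using f g cmp[of h k l] hom[of h l] by (simp add: sel)
  qed
qed

text \<open>Existence by \<open>coherence_complete\<close> and uniqueness by
  \<open>coherence_sound\<close> evaluate the definite descriptions. The two words are parallel
  because consecutive segments of \<open>p\<close> concatenate.\<close>

lemma Phi_eq:
  assumes "(p, i, j) \<in> marked2 B" "(p, j, k) \<in> marked2 B"
  defines "s \<equiv> span_comp C sq (mcomp B br (p, j, k)) (mcomp B br (p, i, j))"
  shows "s \<in> spans C W" "fraction_arr C W s = path_fraction (p, i, k)"
    "Phi B br ((p, i, j), (p, j, k)) = the_fcell C W s (mcomp B br (p, i, k))"
    "Phi_inv B br ((p, i, j), (p, j, k)) = the_fcell C W (mcomp B br (p, i, k)) s"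
proof -
  let ?s = "Seq (mword B br (p, i, j)) (mword B br (p, j, k))" and ?t = "mword B br (p, i, k)"
  have ik: "(p, i, k) \<in> marked2 B" and le: "i \<le> j" "j \<le> k" "k \<le> length (snd p)"
    using assms(1,2) by (simp_all add: marked2_def)
  note w = marked_word[OF assms(1)] marked_word[OF assms(2)] marked_word[OF ik]
  have "drop i (take j (snd p)) @ drop j (take k (snd p)) = drop i (take k (snd p))"
    using le by (intro nth_equalityI) (auto simp: nth_append add.commute)
  then have par: "parallel ?s ?t"
    using w by (simp add: parallel_def del: fractions_sel)
  have ev: "eval_word B ?s = s" "eval_word B ?t = mcomp B br (p, i, k)"
    by (simp_all add: s_def mcomp_def)
  show s: "s \<in> spans C W" "fraction_arr C W s = path_fraction (p, i, k)"
    using parallel_fraction[OF par] unfolding ev by auto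
  show Phi: "Phi B br ((p, i, j), (p, j, k)) = the_fcell C W s (mcomp B br (p, i, k))"
    unfolding Phi_def fst_conv snd_conv hor_concat_simp
  proof (rule the_equality)
    show "coherence B ?s ?t (the_fcell C W s (mcomp B br (p, i, k)))"
      using coherence_complete[OF par] coherence_sound ev by metis
    show "\<alpha> = the_fcell C W s (mcomp B br (p, i, k))" if "coherence B ?s ?t \<alpha>" for \<alpha>
      using coherence_sound[OF that] ev by simp
  qed
  note inv = inverse_the_fcell[OF s(1) mcomp_span(1)[OF ik] s(2)]
  show "Phi_inv B br ((p, i, j), (p, j, k)) = the_fcell C W (mcomp B br (p, i, k)) s"
    unfolding Phi_inv_def Phi using inv by (rule the_equality)
qed

text \<open>In the conjugation by \<open>Phi\<close> each factor is the unique cell between its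
  ends, and only the outer ends survive.\<close>

lemma Dbl_hcomp_eq:
  assumes h: "(p, i, j) \<in> marked2 B" "(p, j, k) \<in> marked2 B" and h': "(q, i', j') \<in> marked2 B" "(q, j', k') \<in> marked2 B"
    and eq: "path_fraction (p, i, j) = path_fraction (q, i', j')" "path_fraction (p, j, k) = path_fraction (q, j', k')"
  shows "path_fraction (p, i, k) = path_fraction (q, i', k')"
    and "Dbl_hcomp B br (dcell (p, i, j) (q, i', j'), dcell (p, j, k) (q, j', k')) = dcell (p, i, k) (q, i', k')"
proof -
  have ik: "(p, i, k) \<in> marked2 B" "(q, i', k') \<in> marked2 B"
    using h h' by (simp_all add: marked2_def)
  note P = Phi_eq[OF h] and Q = Phi_eq[OF h']
  note m = mcomp_span(1)[OF h(1)] mcomp_span(1)[OF h(2)] mcomp_span(1)[OF h'(1)] mcomp_span(1)[OF h'(2)]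
    mcomp_span(1)[OF ik(1)] mcomp_span(1)[OF ik(2)]
  have ends: "tgt C (snd (mcomp B br (p, i, j))) = tgt C (fst (mcomp B br (p, j, k)))"
    "tgt C (snd (mcomp B br (q, i', j'))) = tgt C (fst (mcomp B br (q, j', k')))"
    using mcomp_span(3)[OF h(1)] mcomp_span(2)[OF h(2)] mcomp_span(3)[OF h'(1)] mcomp_span(2)[OF h'(2)]
    by (simp_all del: fractions_sel)
  have c: "fraction_arr C W (span_comp C sq (mcomp B br (p, j, k)) (mcomp B br (p, i, j))) =
      path_fraction (p, j, k) \<cdot>\<^bsub>L\<^esub> path_fraction (p, i, j)"
    "fraction_arr C W (span_comp C sq (mcomp B br (q, j', k')) (mcomp B br (q, i', j'))) =
      path_fraction (q, j', k') \<cdot>\<^bsub>L\<^esub> path_fraction (q, i', j')"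
    by (rule span_comp_fraction(4)[OF m(1,2) ends(1)] span_comp_fraction(4)[OF m(3,4) ends(2)])+
  show eq': "path_fraction (p, i, k) = path_fraction (q, i', k')"
    using P(2) Q(2) c eq by simp
  show "Dbl_hcomp B br (dcell (p, i, j) (q, i', j'), dcell (p, j, k) (q, j', k')) = dcell (p, i, k) (q, i', k')"
    using the_fcell_eq(2,3)[OF m(1,3) eq(1)] the_fcell_eq(2,3)[OF m(2,4) eq(2)]
      the_fcell_eq(2,3)[OF Q(1) m(6) Q(2)] the_fcell_eq(2,3)[OF m(5) P(1) P(2)[symmetric]]
      the_fcell_eq(2,3)[OF P(1) Q(1)] the_fcell_eq(2,3)[OF m(5) Q(1)] P(2) Q(2) eq'
    by (simp add: Dbl_hcomp_def dcell_def P(3,4) Q(3,4))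
qed


text \<open>Here spans can be chosen one by one, since paths in the bicategory match at objects of
  \<open>C\<close>, which the fractions record. In \<open>CW_string_lift\<close> the matching
  objects had to be constructed as well.\<close>

lemma Dbl_string_lift:
  assumes q: "q \<in> strings L k"
  shows "\<exists>p. bpath B p \<and> fpath p = q"
proof -
  obtain A ms where e: "q = (A, ms)"
    by fastforce
  have "ms \<in> lists (fraction_arr C W ` spans C W)"
    using q by (auto simp: strings_def is_path_def e)
  then obtain fs where fs: "set fs \<subseteq> spans C W" "ms = map (fraction_arr C W) fs"
    unfolding lists_image by auto
  have len: "length fs = k"
    using q by (simp add: fs e strings_def)
  have v: "vertex (tgt L) (A, map (fraction_arr C W) fs) i = vertex (btgt B) (A, fs) i" if "i < length fs" for i
    using vertex_fpath[of i "(A, fs)"] that by simp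
  have "bpath B (A, fs)"
    using q fs(1) v by (auto simp: strings_def is_path_iff e fs(2))
  then show ?thesis
    using e fs by (intro exI[of _ "(A, fs)"]) simp
qed

lemma Dbl_kernel_dblcat: "kernel_dblcat L (Dbl B br) (mobj B) path_fraction"
proof -
  have d: "d0 (Dbl B br) = \<lparr>fob = mark0, far = \<lambda>(h, \<alpha>, k). (mark0 h, mark0 k)\<rparr>"
    "d1 (Dbl B br) = \<lparr>fob = mark1, far = \<lambda>(h, \<alpha>, k). (mark1 h, mark1 k)\<rparr>"
    "X0 (Dbl B br) = Dbl_X0 B" "X1 (Dbl B br) = Dbl_X1 B br"
    "hid (Dbl B br) = \<lparr>fob = \<lambda>(p, i). (p, i, i),
       far = \<lambda>((p, i), (q, j)). ((p, i, i), bcid B (bid B (vertex (btgt B) p i)), (q, j, j))\<rparr>"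
    "hm (Dbl B br) = \<lparr>fob = hor_concat, far = Dbl_hcomp B br\<rparr>"
    by (simp_all add: Dbl_def del: fractions_sel)
  have sel: "Obj (Dbl_X1 B br) = marked2 B" "src (Dbl_X1 B br) (dcell h k) = h" "tgt (Dbl_X1 B br) (dcell h k) = k"
    "Obj (Dbl_X0 B) = marked1 B" "src (Dbl_X0 B) = fst" "tgt (Dbl_X0 B) = snd" for h k
    by (simp_all add: Dbl_X1_def Dbl_X0_def dcell_def)
  have ar0: "v \<in> Arr (Dbl_X0 B) \<longleftrightarrow> fst v \<in> marked1 B \<and> snd v \<in> marked1 B \<and> mobj B (fst v) = mobj B (snd v)" for v
    by (auto simp: Dbl_X0_def simp del: fractions_sel)
  have dcell_hom: "dcell h k \<in> hom (Dbl_X1 B br) h k"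
    if "h \<in> marked2 B" "k \<in> marked2 B" "path_fraction h = path_fraction k" for h k
    using that Dbl_cell_iff unfolding hom_def by (simp add: sel) blast
  have marks: "mark0 h \<in> marked1 B" "mark1 h \<in> marked1 B" if "h \<in> marked2 B" for h
    using that by (auto simp: marked1_def marked2_def mark0_def mark1_def simp del: fractions_sel)
  have far_marks: "far (d0 (Dbl B br)) (dcell h k) = (mark0 h, mark0 k)" "far (d1 (Dbl B br)) (dcell h k) = (mark1 h, mark1 k)" for h k
    by (simp_all add: d dcell_def del: fractions_sel)
  have id_in: "(p, i, i) \<in> marked2 B" if "(p, i) \<in> marked1 B" for p i
    using that by (simp add: marked1_def marked2_def del: fractions_sel)
  \<comment> \<open>The segment between equal marks is empty, and its prescribed composite is a
    unit.\<close>
  have mcomp_id: "mcomp B br (p, i, i) = (idn C (mobj B (p, i)), idn C (mobj B (p, i)))"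
    and mobj_in: "mobj B (p, i) \<in> Obj C" if "(p, i) \<in> marked1 B" for p i
  proof -
    have "bpath B (segment (btgt B) p i i)" "segment (btgt B) p i i = (vertex (btgt B) p i, [])"
      using that bpath_segment(1)[of p i i] by (simp_all add: marked1_def segment_def del: fractions_sel)
    then have "bpath B (vertex (btgt B) p i, [])" "br (segment (btgt B) p i i) = Unit (vertex (btgt B) p i)"
      using br unfolding chosen_composites_def by (auto simp del: fractions_sel)
    then show "mcomp B br (p, i, i) = (idn C (mobj B (p, i)), idn C (mobj B (p, i)))" "mobj B (p, i) \<in> Obj C"
      by (simp_all add: mcomp_def mword_def mobj_def is_path_def)
  qed
  have cellE: thesis if "c \<in> Arr (Dbl_X1 B br)"
    "\<And>h k. h \<in> marked2 B \<Longrightarrow> k \<in> marked2 B \<Longrightarrow> path_fraction h = path_fraction k \<Longrightarrow> c = dcell h k \<Longrightarrow> thesis" for c thesis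
    using that Dbl_cell_iff by blast
  have hcat: "Obj (hcat_ob (Dbl B br)) = marked1 B" "Arr (hcat_ob (Dbl B br)) = marked2 B" "src (hcat_ob (Dbl B br)) = mark0"
    "tgt (hcat_ob (Dbl B br)) = mark1" "idn (hcat_ob (Dbl B br)) = (\<lambda>(p, i). (p, i, i))"
    "cmp (hcat_ob (Dbl B br)) = (\<lambda>k h. hor_concat (h, k))"
    by (simp_all add: hcat_ob_def d sel del: fractions_sel)
  have path_fraction_comp: "path_fraction (p, i, k) = path_fraction (p, j, k) \<cdot>\<^bsub>L\<^esub> path_fraction (p, i, j)"
    if "(p, i, j) \<in> marked2 B" "(p, j, k) \<in> marked2 B" for p i j k
  proof -
    have ik: "(p, i, k) \<in> marked2 B" "i \<le> j" "j \<le> k" "k \<le> length (snd p)" "bpath B p"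
      using that by (simp_all add: marked2_def)
    interpret s: string_in L "fpath p" "length (snd p)"
      by unfold_locales (rule fpath_strings[OF ik(5)])
    show ?thesis
      using s.seg_comp_trans[OF ik(2-4)] by (simp add: path_fraction_eq that ik(1) del: fractions_sel)
  qed
  show ?thesis
  proof (rule kernel_dblcat.intro)
    show "category L"
      by (rule fraction_cat_category)
    show "kernel_groupoid (X0 (Dbl B br)) (mobj B)" "kernel_groupoid (X1 (Dbl B br)) path_fraction"
      unfolding d by (rule Dbl_X0_kernel_groupoid Dbl_X1_kernel_groupoid)+
    show "graph_map (X1 (Dbl B br)) (X0 (Dbl B br)) (d0 (Dbl B br))"
      unfolding graph_map_def d(3,4) sel
    proof (intro conjI ballI)
      fix c assume "c \<in> Arr (Dbl_X1 B br)"
      then obtain h k where c: "h \<in> marked2 B" "k \<in> marked2 B" "path_fraction h = path_fraction k" "c = dcell h k"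
        by (rule cellE)
      then show "far (d0 (Dbl B br)) c \<in> hom (Dbl_X0 B) (fob (d0 (Dbl B br)) (src (Dbl_X1 B br) c))
          (fob (d0 (Dbl B br)) (tgt (Dbl_X1 B br) c))"
        using path_fraction_ends[OF c(1-3)] marks
        by (simp add: far_marks hom_def ar0 sel del: fractions_sel) (simp add: d del: fractions_sel)
    qed (simp add: d marks del: fractions_sel)
    show "graph_map (X1 (Dbl B br)) (X0 (Dbl B br)) (d1 (Dbl B br))"
      unfolding graph_map_def d(3,4) sel
    proof (intro conjI ballI)
      fix c assume "c \<in> Arr (Dbl_X1 B br)"
      then obtain h k where c: "h \<in> marked2 B" "k \<in> marked2 B" "path_fraction h = path_fraction k" "c = dcell h k"
        by (rule cellE)
      then show "far (d1 (Dbl B br)) c \<in> hom (Dbl_X0 B) (fob (d1 (Dbl B br)) (src (Dbl_X1 B br) c))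
          (fob (d1 (Dbl B br)) (tgt (Dbl_X1 B br) c))"
        using path_fraction_ends[OF c(1-3)] marks
        by (simp add: far_marks hom_def ar0 sel del: fractions_sel) (simp add: d del: fractions_sel)
    qed (simp add: d marks del: fractions_sel)
    show "graph_map (X0 (Dbl B br)) (X1 (Dbl B br)) (hid (Dbl B br))"
      unfolding graph_map_def d(3,4) sel
    proof (intro conjI ballI)
      fix x assume "x \<in> marked1 B"
      then show "fob (hid (Dbl B br)) x \<in> marked2 B"
        using id_in by (cases x) (simp add: d del: fractions_sel)
    next
      fix v assume v: "v \<in> Arr (Dbl_X0 B)"
      obtain p i q j where e: "v = ((p, i), (q, j))"
        by (metis surj_pair)
      have pq: "(p, i) \<in> marked1 B" "(q, j) \<in> marked1 B" "mobj B (p, i) = mobj B (q, j)"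
        using v by (simp_all add: ar0 e del: fractions_sel)
      \<comment> \<open>\<open>hid\<close> names the identity at the object marked in
        \<open>(p, i)\<close> only; as the marked objects agree, its 2-cell also ends at the
        composite for \<open>(q, j, j)\<close>.\<close>
      have "far (hid (Dbl B br)) v = dcell (p, i, i) (q, j, j)"
        using pq(3) by (simp add: d e dcell_def mcomp_id pq(1,2)) (simp add: mobj_def)
      moreover have "dcell (p, i, i) (q, j, j) \<in> hom (Dbl_X1 B br) (p, i, i) (q, j, j)"
        by (intro dcell_hom id_in pq) (simp add: mcomp_id pq del: fractions_sel)
      ultimately show "far (hid (Dbl B br)) v \<in> hom (Dbl_X1 B br) (fob (hid (Dbl B br)) (fst v)) (fob (hid (Dbl B br)) (snd v))"
        by (simp add: d e del: fractions_sel)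
    qed
    show "graph_map (hpairs (Dbl B br)) (X1 (Dbl B br)) (hm (Dbl B br))"
      unfolding graph_map_def
    proof (intro conjI ballI)
      fix a assume "a \<in> Obj (hpairs (Dbl B br))"
      moreover obtain p i j q k l where "a = ((p, i, j), (q, k, l))"
        by (metis surj_pair)
      ultimately show "fob (hm (Dbl B br)) a \<in> Obj (X1 (Dbl B br))"
        by (auto simp: hpairs_def d sel marked2_def simp del: fractions_sel)
    next
      fix c assume c: "c \<in> Arr (hpairs (Dbl B br))"
      obtain c1 c2 where e: "c = (c1, c2)"
        by (cases c)
      have c12: "c1 \<in> Arr (Dbl_X1 B br)" "c2 \<in> Arr (Dbl_X1 B br)" "far (d1 (Dbl B br)) c1 = far (d0 (Dbl B br)) c2"
        using c by (simp_all add: e hpairs_def) (simp_all add: d)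
      obtain h k where c1: "h \<in> marked2 B" "k \<in> marked2 B" "path_fraction h = path_fraction k" "c1 = dcell h k"
        using c12(1) by (rule cellE)
      obtain h' k' where c2: "h' \<in> marked2 B" "k' \<in> marked2 B" "path_fraction h' = path_fraction k'" "c2 = dcell h' k'"
        using c12(2) by (rule cellE)
      obtain p i j q i' j' where hk: "h = (p, i, j)" "k = (q, i', j')"
        by (metis surj_pair)
      obtain l l' where hk': "h' = (p, j, l)" "k' = (q, j', l')"
        using c12(3) by (cases h'; cases k') (simp add: c1(4) c2(4) far_marks hk)
      note H = Dbl_hcomp_eq[OF c1(1)[unfolded hk] c2(1)[unfolded hk'] c1(2)[unfolded hk] c2(2)[unfolded hk']
          c1(3)[unfolded hk] c2(3)[unfolded hk']]
      have "dcell (p, i, l) (q, i', l') \<in> hom (Dbl_X1 B br) (p, i, l) (q, i', l')"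
        using c1(1,2) c2(1,2) H(1) by (intro dcell_hom) (simp_all add: hk hk' marked2_def)
      then show "far (hm (Dbl B br)) c \<in> hom (X1 (Dbl B br)) (fob (hm (Dbl B br)) (src (hpairs (Dbl B br)) c))
          (fob (hm (Dbl B br)) (tgt (hpairs (Dbl B br)) c))"
        by (simp add: d e c1(4) c2(4) hk hk' H(2) hpairs_def sel del: fractions_sel)
    qed
    show "category (hcat_ob (Dbl B br))"
      by unfold_locales (auto simp: hcat hom_def marked1_def marked2_def simp del: fractions_sel)
    show "is_functor (hcat_ob (Dbl B br)) L \<lparr>fob = mobj B, far = path_fraction\<rparr>"
      unfolding is_functor_def hcat ftr.simps
    proof (intro conjI ballI impI)
      fix x assume x: "x \<in> marked1 B"
      obtain p i where e: "x = (p, i)"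
        by fastforce
      show "mobj B x \<in> Obj L" "path_fraction (case x of (p, i) \<Rightarrow> (p, i, i)) = idn L (mobj B x)"
        using x mobj_in[of p i] mcomp_id[of p i] by (simp_all add: e fraction_cat_idn del: fractions_sel)
    next
      fix h assume h: "h \<in> marked2 B"
      show "path_fraction h \<in> hom L (mobj B (mark0 h)) (mobj B (mark1 h))"
        using fraction_arr_hom[OF mcomp_span(1)[OF h]] mcomp_span[OF h] by (simp del: fractions_sel)
      fix k assume k: "k \<in> marked2 B" "mark0 k = mark1 h"
      show "path_fraction (hor_concat (h, k)) = path_fraction k \<cdot>\<^bsub>L\<^esub> path_fraction h"
        using h k path_fraction_comp by (cases h; cases k) (auto simp del: fractions_sel)
    qed
    fix q k assume q: "q \<in> strings L k"
    then obtain p where p: "bpath B p" "fpath p = q"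
      using Dbl_string_lift by blast
    have len: "length (snd p) = k"
      using q by (auto simp: strings_def simp flip: p(2))
    interpret s: string_in L q k
      using q by unfold_locales
    \<comment> \<open>Composable horizontal arrows of \<open>Dbl\<close> lie on one and the same
      path, so the whole string is lifted to \<open>p\<close> with marks at consecutive
      vertices.\<close>
    let ?hs = "((p, 0), map (\<lambda>i. (p, i, Suc i)) [0..<k])"
    have m: "(p, i, Suc i) \<in> marked2 B" if "i < k" for i
      using p(1) that len by (simp add: marked2_def)
    have "vertex mark1 ?hs i = (p, i)" if "i < k" for i
      using that by (cases i) (auto simp: vertex_def)
    then have "?hs \<in> strings (hcat_ob (Dbl B br)) k"
      using p(1) m by (auto simp: strings_def is_path_iff hcat marked1_def simp del: fractions_sel)
    moreover have "map_prod (mobj B) (map path_fraction) ?hs = q"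
    proof (rule prod_eqI)
      show "fst (map_prod (mobj B) (map path_fraction) ?hs) = fst q"
        by (simp add: mobj_def vertex_0 flip: p(2))
      show "snd (map_prod (mobj B) (map path_fraction) ?hs) = snd q"
        using s.length_p s.seg_comp_step
        by (intro nth_equalityI) (simp_all add: path_fraction_eq m p(2) del: fractions_sel)
    qed
    ultimately show "\<exists>hs \<in> strings (hcat_ob (Dbl B br)) k. map_prod (mobj B) (map path_fraction) hs = q"
      by blast
  qed
qed

end

theorem corollary7p12:
  fixes C :: "('o, 'a) cat" and W :: "'a set"
    and sq :: "'a \<Rightarrow> 'a \<Rightarrow> 'a \<times> 'a"
    and br :: "'o \<times> 'a span list \<Rightarrow> ('o, 'a span) word"
  assumes "category C"
    and "calculus_of_fractions C W"
    and "chosen_squares C W sq"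
    and "chosen_composites (fractions C W sq) br"
  shows "equivalent_in_WGDbl_ps (CW C W) (Dbl (fractions C W sq) br)"
proof -
  interpret calculus_of_fractions C W
    by fact
  interpret chosen_bracketing C W sq br
    using assms(3,4) by unfold_locales
  \<comment> \<open>Both project to \<open>fraction_cat C W\<close>, whatever the choices
    \<open>sq\<close> and \<open>br\<close>.\<close>
  show ?thesis
    by (rule kernel_dblcat_equivalent[OF CW_kernel_dblcat Dbl_kernel_dblcat])
qed

end
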